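(* Let $K\ge1$, $t_0>0$, and let $H$ be the self-adjoint Hankel operator in $L^2(\mathbb{R}_+)$ with kernel $$h(t)=\sum_{k=0}^Kh_k\delta^{(k)}(t-t_0),\quad h_k\in\mathbb{R},\quad h_K\neq0,$$ where $\delta$ is the Dirac delta function. Then $\operatorname{Ker}H=L^2(t_0,\infty)$. The non-zero spectrum of $H$ consists of an infinite number of eigenvalues $\lambda_n^{(\pm)}$ of multiplicities not exceeding $K$ such that $0<\lambda_1^{(+)}\le\lambda_2^{(+)}\le\cdots\le\lambda_n^{(+)}\le\cdots$ and $0>\lambda_1^{(-)}\ge\lambda_2^{(-)}\ge\cdots\ge\lambda_n^{(-)}\ge\cdots$. The eigenvalues $\lambda_n^{(\pm)}$ accumulate to $\pm\infty$ as $n\to\infty$ and have the asymptotics $$\lambda_n^{(\pm)}=\pm|h_K|\,(2\pi t_0^{-1}n)^K\,(1+O(n^{-1}))$$ as $n\to\infty$. The corresponding eigenfunctions $f_n^{(\pm)}(t)$ satisfy the equation $$\sum_{k=0}^K(-1)^kh_k\frac{d^kf_n^{(\pm)}(t)}{dt^k}=\lambda_n^{(\pm)}f_n^{(\pm)}(t_0-t),\quad t\in(0,t_0),$$ and the boundary conditions $f(0)=f'(0)=\cdots=f^{(K-1)}(0)=0$ (with $f=f_n^{(\pm)}$).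
   Context: The Hankel operator with this distributional kernel is defined as follows: $(Hf)(t)=\sum_{k=0}^K(-1)^kh_kf^{(k)}(t_0-t)$ for $t\in(0,t_0)$ and $(Hf)(t)=0$ for $t>t_0$; here $f^{(k)}(t_0-t)$ is the $k$-th derivative of $f$ evaluated at $t_0-t$. Thus $H$ is zero on $L^2(t_0,\infty)$, and its restriction to $L^2(0,t_0)$ is self-adjoint on the domain of all $f$ in the Sobolev space $\mathsf{H}^K(0,t_0)$ such that $f(0)=f'(0)=\cdots=f^{(K-1)}(0)=0$. Eigenvalues are enumerated with multiplicities taken into account. *)

theory Defs
  imports "HOL-Analysis.Analysis" "HOL-Library.Landau_Symbols"
begin

section \<open>The Hilbert space $L^2(0,\infty)$\<close>

definition L2_fun :: "real set \<Rightarrow> (real \<Rightarrow> complex) \<Rightarrow> bool"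
  where "L2_fun S f \<longleftrightarrow> set_borel_measurable lborel S f \<and> set_integrable lborel S (\<lambda>x. (norm (f x))\<^sup>2)"

definition ae_eq :: "real set \<Rightarrow> (real \<Rightarrow> complex) \<Rightarrow> (real \<Rightarrow> complex) \<Rightarrow> bool"
  where "ae_eq S f g \<longleftrightarrow> (AE x in lborel. x \<in> S \<longrightarrow> f x = g x)"

lemma L2_fun_alt:
  "L2_fun S f \<longleftrightarrow> (\<lambda>x. indicator S x *\<^sub>R f x) \<in> borel_measurable lborel \<and>
     integrable lborel (\<lambda>x. (norm (indicator S x *\<^sub>R f x))\<^sup>2)"
proof -
  have "(norm (indicator S x *\<^sub>R f x))\<^sup>2 = indicator S x *\<^sub>R (norm (f x))\<^sup>2" for x
    by (auto simp: indicator_def)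
  then show ?thesis
    unfolding L2_fun_def set_borel_measurable_def set_integrable_def by simp
qed

lemma L2_fun_0: "L2_fun S (\<lambda>x. 0)"
  by (simp add: L2_fun_alt)

lemma L2_fun_cmult:
  assumes "L2_fun S f"
  shows "L2_fun S (\<lambda>x. c * f x)"
proof -
  let ?F = "\<lambda>x. indicator S x *\<^sub>R f x"
  have [measurable]: "?F \<in> borel_measurable lborel" and i: "integrable lborel (\<lambda>x. (norm (?F x))\<^sup>2)"
    using assms by (auto simp only: L2_fun_alt)
  have "(\<lambda>x. c * ?F x) \<in> borel_measurable lborel" by measurable
  moreover have "integrable lborel (\<lambda>x. (norm c)\<^sup>2 * (norm (?F x))\<^sup>2)"
    using i by (rule integrable_mult_right)
  moreover have "indicator S x *\<^sub>R (c * f x) = c * ?F x" for x by simp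
  ultimately show ?thesis unfolding L2_fun_alt by (simp only: norm_mult power_mult_distrib)
qed

lemma L2_fun_mult_integrable:
  assumes "L2_fun S f" "L2_fun S g"
  shows "set_integrable lborel S (\<lambda>x. f x * cnj (g x))"
proof -
  let ?F = "\<lambda>x. indicator S x *\<^sub>R f x" and ?G = "\<lambda>x. indicator S x *\<^sub>R g x"
  have [measurable]: "?F \<in> borel_measurable lborel" "?G \<in> borel_measurable lborel"
    and i: "integrable lborel (\<lambda>x. (norm (?F x))\<^sup>2 + (norm (?G x))\<^sup>2)"
    using assms by (auto simp only: L2_fun_alt intro!: Bochner_Integration.integrable_add)
  have [measurable]: "cnj \<in> borel_measurable borel"
    by (intro borel_measurable_continuous_onI continuous_intros)
  have "integrable lborel (\<lambda>x. ?F x * cnj (?G x))"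
  proof (rule Bochner_Integration.integrable_bound[OF i])
    show "(\<lambda>x. ?F x * cnj (?G x)) \<in> borel_measurable lborel" by measurable
    have "norm (a * cnj b) \<le> norm ((norm a)\<^sup>2 + (norm b)\<^sup>2)" for a b :: complex
    proof -
      have "0 \<le> (norm a - norm b)\<^sup>2" by simp
      moreover have "0 \<le> norm a * norm b" by simp
      ultimately have "norm a * norm b \<le> (norm a)\<^sup>2 + (norm b)\<^sup>2"
        unfolding power2_diff by linarith
      then show ?thesis by (simp add: norm_mult)
    qed
    then show "AE x in lborel. norm (?F x * cnj (?G x)) \<le> norm ((norm (?F x))\<^sup>2 + (norm (?G x))\<^sup>2)"
      by blast
  qed
  moreover have "?F x * cnj (?G x) = indicator S x *\<^sub>R (f x * cnj (g x))" for x
    by (auto simp: indicator_def)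
  ultimately show ?thesis unfolding set_integrable_def by (simp only:)
qed

lemma L2_fun_add:
  assumes "L2_fun S f" "L2_fun S g"
  shows "L2_fun S (\<lambda>x. f x + g x)"
proof -
  let ?F = "\<lambda>x. indicator S x *\<^sub>R f x" and ?G = "\<lambda>x. indicator S x *\<^sub>R g x"
  have [measurable]: "?F \<in> borel_measurable lborel" "?G \<in> borel_measurable lborel"
    and i: "integrable lborel (\<lambda>x. 2 * (norm (?F x))\<^sup>2 + 2 * (norm (?G x))\<^sup>2)"
    using assms
    by (auto simp only: L2_fun_alt intro!: Bochner_Integration.integrable_add integrable_mult_right)
  have "integrable lborel (\<lambda>x. (norm (?F x + ?G x))\<^sup>2)"
  proof (rule Bochner_Integration.integrable_bound[OF i])
    show "(\<lambda>x. (norm (?F x + ?G x))\<^sup>2) \<in> borel_measurable lborel" by measurable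
    have "norm ((norm (a + b))\<^sup>2) \<le> norm (2 * (norm a)\<^sup>2 + 2 * (norm b)\<^sup>2)" for a b :: complex
    proof -
      have "(norm (a + b))\<^sup>2 \<le> (norm a + norm b)\<^sup>2"
        by (intro power_mono norm_triangle_ineq) simp
      moreover have "0 \<le> (norm a - norm b)\<^sup>2" by simp
      ultimately have "(norm (a + b))\<^sup>2 \<le> 2 * (norm a)\<^sup>2 + 2 * (norm b)\<^sup>2"
        unfolding power2_diff power2_sum by linarith
      then show ?thesis by simp
    qed
    then show "AE x in lborel. norm ((norm (?F x + ?G x))\<^sup>2)
        \<le> norm (2 * (norm (?F x))\<^sup>2 + 2 * (norm (?G x))\<^sup>2)"
      by blast
  qed
  moreover have "?F x + ?G x = indicator S x *\<^sub>R (f x + g x)" for x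
    by (simp add: scaleR_add_right)
  moreover have "(\<lambda>x. ?F x + ?G x) \<in> borel_measurable lborel" by measurable
  ultimately show ?thesis unfolding L2_fun_alt by simp
qed

quotient_type L2 = "real \<Rightarrow> complex" / partial:
  "\<lambda>f g. L2_fun {0<..} f \<and> L2_fun {0<..} g \<and> ae_eq {0<..} f g"
proof (rule part_equivpI)
  show "\<exists>f. L2_fun {0<..} f \<and> L2_fun {0<..} f \<and> ae_eq {0<..} f f"
    by (rule exI[of _ "\<lambda>x. 0"]) (simp add: L2_fun_0 ae_eq_def)
  show "symp (\<lambda>f g. L2_fun {0<..} f \<and> L2_fun {0<..} g \<and> ae_eq {0<..} f g)"
    by (auto simp: symp_def ae_eq_def)
  show "transp (\<lambda>f g. L2_fun {0<..} f \<and> L2_fun {0<..} g \<and> ae_eq {0<..} f g)"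
    by (auto simp: transp_def ae_eq_def elim: AE_mp)
qed

lemma ae_eq_integral_cong:
  assumes "L2_fun S f" "L2_fun S f'" "ae_eq S f f'" "L2_fun S g" "L2_fun S g'" "ae_eq S g g'"
  shows "(LINT x:S|lborel. f x * cnj (g x)) = (LINT x:S|lborel. f' x * cnj (g' x))"
proof -
  have "AE x in lborel. indicator S x *\<^sub>R (f x * cnj (g x)) = indicator S x *\<^sub>R (f' x * cnj (g' x))"
    using assms(3,6) unfolding ae_eq_def by eventually_elim (auto simp: indicator_def)
  then show ?thesis
    unfolding set_lebesgue_integral_def
    using L2_fun_mult_integrable[OF assms(1,4)] L2_fun_mult_integrable[OF assms(2,5)]
    unfolding set_integrable_def by (intro integral_cong_AE) auto
qed

lift_definition cscale :: "complex \<Rightarrow> L2 \<Rightarrow> L2" is "\<lambda>c f x. c * f x"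
  by (auto simp: L2_fun_cmult ae_eq_def elim: AE_mp)

instantiation L2 :: real_vector
begin
lift_definition zero_L2 :: L2 is "\<lambda>x. 0" by (simp add: L2_fun_0 ae_eq_def)
lift_definition plus_L2 :: "L2 \<Rightarrow> L2 \<Rightarrow> L2" is "\<lambda>f g x. f x + g x"
proof -
  fix f f' g g' :: "real \<Rightarrow> complex"
  assume *: "L2_fun {0<..} f \<and> L2_fun {0<..} f' \<and> ae_eq {0<..} f f'"
    "L2_fun {0<..} g \<and> L2_fun {0<..} g' \<and> ae_eq {0<..} g g'"
  then have "AE x in lborel. x \<in> {0<..} \<longrightarrow> f x = f' x" "AE x in lborel. x \<in> {0<..} \<longrightarrow> g x = g' x"
    by (auto simp only: ae_eq_def)
  then have "AE x in lborel. x \<in> {0<..} \<longrightarrow> f x + g x = f' x + g' x"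
    by eventually_elim auto
  with * show "L2_fun {0<..} (\<lambda>x. f x + g x) \<and> L2_fun {0<..} (\<lambda>x. f' x + g' x) \<and>
      ae_eq {0<..} (\<lambda>x. f x + g x) (\<lambda>x. f' x + g' x)"
    by (simp add: L2_fun_add ae_eq_def)
qed
definition scaleR_L2 :: "real \<Rightarrow> L2 \<Rightarrow> L2" where "scaleR_L2 r u = cscale (complex_of_real r) u"
definition uminus_L2 :: "L2 \<Rightarrow> L2" where "uminus_L2 u = cscale (- 1) u"
definition minus_L2 :: "L2 \<Rightarrow> L2 \<Rightarrow> L2" where "minus_L2 u v = u + cscale (- 1) v" for u v :: L2
instance
proof
  fix a b :: real and u v w :: L2
  show "u + v + w = u + (v + w)" by transfer (auto simp: L2_fun_add ae_eq_def add.assoc)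
  show "u + v = v + u" by transfer (auto simp: L2_fun_add ae_eq_def add.commute)
  show "0 + u = u" by transfer (auto simp: L2_fun_add ae_eq_def)
  show "- u + u = 0" unfolding uminus_L2_def
    by transfer (use L2_fun_add L2_fun_cmult[of _ _ "-1"] in \<open>auto simp: ae_eq_def L2_fun_0\<close>)
  show "u - v = u + - v" by (simp add: minus_L2_def uminus_L2_def)
  show "a *\<^sub>R (u + v) = a *\<^sub>R u + a *\<^sub>R v" unfolding scaleR_L2_def
    by transfer (auto simp: ae_eq_def L2_fun_add L2_fun_cmult ring_distribs)
  show "(a + b) *\<^sub>R u = a *\<^sub>R u + b *\<^sub>R u" unfolding scaleR_L2_def
    by transfer (use L2_fun_cmult[of _ _ "_ + _"] in \<open>auto simp: ae_eq_def L2_fun_add L2_fun_cmult ring_distribs\<close>)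
  show "a *\<^sub>R b *\<^sub>R u = (a * b) *\<^sub>R u" unfolding scaleR_L2_def
    by transfer (use L2_fun_cmult[of _ _ "_ * _"] in \<open>auto simp: ae_eq_def L2_fun_cmult mult.assoc\<close>)
  show "1 *\<^sub>R u = u" unfolding scaleR_L2_def
    by transfer (auto simp: ae_eq_def)
qed
end

text \<open>The distribution has no class of complex vector spaces, so complex linear algebra in
  $L^2$ (span, linear independence) is obtained from the locale of vector spaces over a field.\<close>

global_interpretation L2: vector_space cscale
proof
  fix a b :: complex and u v :: L2
  show "cscale a (u + v) = cscale a u + cscale a v"
    by transfer (auto simp: ae_eq_def L2_fun_add L2_fun_cmult ring_distribs)
  show "cscale (a + b) u = cscale a u + cscale b u"
    by transfer (use L2_fun_cmult[of _ _ "_ + _"] in \<open>auto simp: ae_eq_def L2_fun_add L2_fun_cmult ring_distribs\<close>)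
  show "cscale a (cscale b u) = cscale (a * b) u"
    by transfer (use L2_fun_cmult[of _ _ "_ * _"] in \<open>auto simp: ae_eq_def L2_fun_cmult mult.assoc\<close>)
  show "cscale 1 u = u"
    by transfer (auto simp: ae_eq_def)
qed

lift_definition cinner_L2 :: "L2 \<Rightarrow> L2 \<Rightarrow> complex"
  is "\<lambda>f g. LINT x:{0<..}|lborel. f x * cnj (g x)"
  using ae_eq_integral_cong by blast

text \<open>The library's norm is induced by the real part of the complex inner product.\<close>

instantiation L2 :: real_inner
begin
definition inner_L2 :: "L2 \<Rightarrow> L2 \<Rightarrow> real" where "inner_L2 u v = Re (cinner_L2 u v)"
definition norm_L2 :: "L2 \<Rightarrow> real" where "norm_L2 u = sqrt (inner u u)"
definition sgn_L2 :: "L2 \<Rightarrow> L2" where "sgn_L2 u = u /\<^sub>R norm u"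
definition dist_L2 :: "L2 \<Rightarrow> L2 \<Rightarrow> real" where "dist_L2 u v = norm (u - v)"
definition uniformity_L2 :: "(L2 \<times> L2) filter"
  where "uniformity_L2 = (INF e\<in>{0<..}. principal {(u, v). dist u v < e})"
definition open_L2 :: "L2 set \<Rightarrow> bool"
  where "open_L2 U \<longleftrightarrow> (\<forall>u\<in>U. eventually (\<lambda>(u', v). u' = u \<longrightarrow> v \<in> U) uniformity)"
instance
proof
  fix r :: real and u v w :: L2 and U :: "L2 set"
  show "dist u v = norm (u - v)" by (fact dist_L2_def)
  show "sgn u = u /\<^sub>R norm u" by (fact sgn_L2_def)
  show "uniformity = (INF e\<in>{0<..}. principal {(u::L2, v). dist u v < e})" by (fact uniformity_L2_def)
  show "open U \<longleftrightarrow> (\<forall>u\<in>U. eventually (\<lambda>(u', v). u' = u \<longrightarrow> v \<in> U) uniformity)" by (fact open_L2_def)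
  show "norm u = sqrt (inner u u)" by (fact norm_L2_def)
  have "cinner_L2 v u = cnj (cinner_L2 u v)"
  proof transfer
    fix f g :: "real \<Rightarrow> complex"
    have "(LINT x:{0<..}|lborel. g x * cnj (f x)) = (LINT x|lborel. cnj (indicator {0<..} x *\<^sub>R (f x * cnj (g x))))"
      unfolding set_lebesgue_integral_def by (simp add: mult.commute)
    also have "\<dots> = cnj (LINT x:{0<..}|lborel. f x * cnj (g x))"
      unfolding set_lebesgue_integral_def by (rule Bochner_Integration.integral_cnj)
    finally show "(LINT x:{0<..}|lborel. g x * cnj (f x)) = cnj (LINT x:{0<..}|lborel. f x * cnj (g x))" .
  qed
  then show "inner u v = inner v u" by (simp add: inner_L2_def)
  have "cinner_L2 (u + v) w = cinner_L2 u w + cinner_L2 v w"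
    by transfer (simp add: ring_distribs set_integral_add L2_fun_mult_integrable)
  then show "inner (u + v) w = inner u w + inner v w" by (simp add: inner_L2_def)
  have "cinner_L2 (cscale c u) v = c * cinner_L2 u v" for c
    by transfer (simp add: mult.assoc)
  then show "inner (r *\<^sub>R u) v = r * inner u v" by (simp add: inner_L2_def scaleR_L2_def)
  have eq: "z * cnj z = of_real ((norm z)\<^sup>2)" for z :: complex
    by (simp only: complex_norm_square)
  have re: "Re (LINT x:{0<..}|lborel. f x * cnj (f x)) = (LINT x:{0<..}|lborel. (norm (f x))\<^sup>2)" for f :: "real \<Rightarrow> complex"
    unfolding eq set_integral_complex_of_real by simp
  show "0 \<le> inner u u" unfolding inner_L2_def
  proof transfer
    fix f :: "real \<Rightarrow> complex"
    show "0 \<le> Re (LINT x:{0<..}|lborel. f x * cnj (f x))"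
      unfolding re unfolding set_lebesgue_integral_def by (rule integral_nonneg_AE) auto
  qed
  show "inner u u = 0 \<longleftrightarrow> u = 0" unfolding inner_L2_def
  proof transfer
    fix f :: "real \<Rightarrow> complex"
    assume "L2_fun {0<..} f \<and> L2_fun {0<..} f \<and> ae_eq {0<..} f f"
    then have f: "L2_fun {0<..} f" by blast
    then have i: "integrable lborel (\<lambda>x. indicator {0<..} x *\<^sub>R (norm (f x))\<^sup>2)"
      unfolding L2_fun_def set_integrable_def by blast
    have "(LINT x:{0<..}|lborel. (norm (f x))\<^sup>2) = 0 \<longleftrightarrow>
        (AE x in lborel. indicator {0<..} x *\<^sub>R (norm (f x))\<^sup>2 = 0)"
      unfolding set_lebesgue_integral_def by (rule integral_nonneg_eq_0_iff_AE[OF i]) auto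
    also have "\<dots> \<longleftrightarrow> ae_eq {0<..} f (\<lambda>x. 0)"
      unfolding ae_eq_def by (rule AE_cong) (auto simp: indicator_def)
    finally show "(Re (LINT x:{0<..}|lborel. f x * cnj (f x)) = 0) \<longleftrightarrow>
        L2_fun {0<..} f \<and> L2_fun {0<..} (\<lambda>x. 0) \<and> ae_eq {0<..} f (\<lambda>x. 0)"
      unfolding re using f by (simp add: L2_fun_0)
  qed
qed
end

definition L2_subspace :: "real set \<Rightarrow> L2 set"
  where "L2_subspace S = {abs_L2 f | f. L2_fun {0<..} f \<and> ae_eq ({0<..} - S) f (\<lambda>x. 0)}"

section \<open>Unbounded operators in $L^2(0,\infty)$\<close>

text \<open>A linear operator is represented by its graph.\<close>

definition op_ker :: "(L2 \<times> L2) set \<Rightarrow> L2 set"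
  where "op_ker A = {u. (u, 0) \<in> A}"

definition eigenspace :: "(L2 \<times> L2) set \<Rightarrow> complex \<Rightarrow> L2 set"
  where "eigenspace A z = {u. (u, cscale z u) \<in> A}"

definition eigenvector :: "(L2 \<times> L2) set \<Rightarrow> complex \<Rightarrow> L2 \<Rightarrow> bool"
  where "eigenvector A z u \<longleftrightarrow> u \<noteq> 0 \<and> u \<in> eigenspace A z"

definition eigenvalue :: "(L2 \<times> L2) set \<Rightarrow> complex \<Rightarrow> bool"
  where "eigenvalue A z \<longleftrightarrow> (\<exists>u. eigenvector A z u)"

definition has_multiplicity :: "(L2 \<times> L2) set \<Rightarrow> complex \<Rightarrow> nat \<Rightarrow> bool"
  where "has_multiplicity A z m \<longleftrightarrow>
    (\<exists>B. finite B \<and> card B = m \<and> L2.independent B \<and> L2.span B = eigenspace A z)"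

text \<open>The pair $(u, w + zu)$ lies in the graph of $A$ iff $(A - z)u = w$; so $z$ is in the
  resolvent set iff $A - z$ is a bijection of the domain of $A$ onto $L^2$ with bounded inverse.\<close>

definition resolvent_set :: "(L2 \<times> L2) set \<Rightarrow> complex set"
  where "resolvent_set A = {z. (\<forall>w. \<exists>!u. (u, w + cscale z u) \<in> A) \<and>
    (\<exists>C. \<forall>u w. (u, w + cscale z u) \<in> A \<longrightarrow> norm u \<le> C * norm w)}"

definition spectrum :: "(L2 \<times> L2) set \<Rightarrow> complex set"
  where "spectrum A = - resolvent_set A"

section \<open>Sobolev spaces on an interval\<close>

definition test_function :: "real set \<Rightarrow> (real \<Rightarrow> real) \<Rightarrow> bool"
  where "test_function S \<phi> \<longleftrightarrow>
    (\<forall>k x. (deriv ^^ k) \<phi> field_differentiable at x) \<and>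
    (\<exists>C. compact C \<and> C \<subseteq> S \<and> (\<forall>x. x \<notin> C \<longrightarrow> \<phi> x = 0))"

definition locally_integrable :: "real set \<Rightarrow> (real \<Rightarrow> complex) \<Rightarrow> bool"
  where "locally_integrable S f \<longleftrightarrow> (\<forall>C. compact C \<and> C \<subseteq> S \<longrightarrow> set_integrable lborel C f)"

definition weak_deriv :: "nat \<Rightarrow> real set \<Rightarrow> (real \<Rightarrow> complex) \<Rightarrow> (real \<Rightarrow> complex) \<Rightarrow> bool"
  where "weak_deriv k S f g \<longleftrightarrow> locally_integrable S f \<and> locally_integrable S g \<and>
    (\<forall>\<phi>. test_function S \<phi> \<longrightarrow>
      (LINT x:S|lborel. (deriv ^^ k) \<phi> x *\<^sub>R f x) = (- 1) ^ k * (LINT x:S|lborel. \<phi> x *\<^sub>R g x))"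

definition sobolev :: "nat \<Rightarrow> real set \<Rightarrow> (real \<Rightarrow> complex) set"
  where "sobolev K S = {f. L2_fun S f \<and> (\<forall>k\<le>K. \<exists>g. L2_fun S g \<and> weak_deriv k S f g)}"

section \<open>The Hankel operator\<close>

text \<open>For $j < K$ the value $f^{(j)}(0)$ is that of the representative of the $j$-th weak
  derivative which is continuous on $[0, t_0]$. Nothing is required of $f$ on $(t_0, \infty)$.\<close>

definition hankel_dom :: "nat \<Rightarrow> real \<Rightarrow> (real \<Rightarrow> complex) set"
  where "hankel_dom K t0 = {f. L2_fun {0<..} f \<and> f \<in> sobolev K {0<..<t0} \<and>
    (\<forall>j<K. \<exists>g. weak_deriv j {0<..<t0} f g \<and> continuous_on {0..t0} g \<and> g 0 = 0)}"

definition hankel_op :: "nat \<Rightarrow> (nat \<Rightarrow> real) \<Rightarrow> real \<Rightarrow> (L2 \<times> L2) set"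
  where "hankel_op K h t0 = {(abs_L2 f, abs_L2 g) | f g. f \<in> hankel_dom K t0 \<and> L2_fun {0<..} g \<and>
    (\<exists>d. (\<forall>k\<le>K. weak_deriv k {0<..<t0} f (d k)) \<and>
      ae_eq {0<..<t0} g (\<lambda>t. \<Sum>k\<le>K. (- 1) ^ k * of_real (h k) * d k (t0 - t))) \<and>
    ae_eq {t0<..} g (\<lambda>t. 0)}"

text \<open>The boundary value problem, in the classical sense: \<open>D k\<close> is the $k$-th derivative of $f$
  on $[0, t_0]$, one-sided at the end points.\<close>

definition solves_bvp :: "nat \<Rightarrow> (nat \<Rightarrow> real) \<Rightarrow> real \<Rightarrow> real \<Rightarrow> (real \<Rightarrow> complex) \<Rightarrow> bool"
  where "solves_bvp K h t0 l f \<longleftrightarrow> (\<exists>D.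
    (\<forall>t\<in>{0..t0}. D 0 t = f t) \<and>
    (\<forall>k<K. \<forall>t\<in>{0..t0}. (D k has_vector_derivative D (Suc k) t) (at t within {0..t0})) \<and>
    (\<forall>t\<in>{0<..<t0}. (\<Sum>k\<le>K. (- 1) ^ k * of_real (h k) * D k t) = of_real l * f (t0 - t)) \<and>
    (\<forall>j<K. D j 0 = 0))"

end

theory Submission
  imports Defs "HOL-Complex_Analysis.Great_Picard"
begin

text \<open>
On $(0,t_0)$ the Hankel operator $H$ is the inverse of a compact symmetric operator $T$. Let $V$ be integration
from $0$, let $J$ be the reflection $t \mapsto t_0 - t$, and let $D = \sum_k (-1)^k h_k V^{K-k}$. The boundary
conditions at $0$ say that $f = V^Ky$ with $y = f^{(K)}$, and then $Hf = g$ reads $Dy = Jg$. Here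
$D = (-1)^K h_K(1 - VR)$ with a polynomial $R$ in $V$, which is invertible since $V$ is quasi-nilpotent. So
$T = V^KD^{-1}J$ (\<open>hankel_op_iff\<close>). It is compact because $V$ is, by Arzela and Ascoli, and symmetric because
$V^* = JVJ$ (\<open>T_sym\<close>). That a function in the domain really is a $K$-fold primitive rests on the lemma of
du Bois-Reymond.

The maximum principle for the form of a compact symmetric operator (\<open>maximum_principle\<close>) yields the positive
eigenvalues of $T$ one after the other, hence those of $H$, and the min-max argument \<open>spectral_sequence_le\<close>
bounds them. They are compared with those of the periodic problem for the same equation, whose eigenfunctions are
$e_m + \theta e_{-m}$ and $e_m - \theta e_{-m}$ with $e_m(t) = \exp(2\pi imt/t_0)$, $|\theta| = 1$, and whose eigenvalues
are $\pm|p(m)|$ with $p(m) = \sum_k (-1)^k h_k (2\pi im/t_0)^k$. The two problems have the same form on the functions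
whose derivatives of order less than $K$ vanish at both ends of the interval. These are cut out by $K$ conditions in
either space of functions, so the $n$-th positive eigenvalue of $H$ lies, up to lower order terms, between
$|p(n-K-1)|$ and $|p(n+K)|$ (\<open>form_lower_bound\<close>, \<open>form_upper_bound\<close>), and a bounded shift of the index
changes $|p(n)|$ by a factor $1 + O(1/n)$. The upper bound of the form needs the completeness of the trigonometric
system, which follows from the maximum principle as well: it is applied to integration on functions of mean zero,
whose only eigenfunctions are the harmonics (\<open>fourier_approximation\<close>). The negative eigenvalues of $H$ are those
for the coefficients $-h_k$ with the sign reversed.

If the derivatives of order less than $K$ of an eigenfunction vanish at $t_0$, then on it $J$ commutes with $V$ up to
sign, and the eigenvalue equation becomes a homogeneous Volterra equation, which has only the solution $0$
(\<open>eigenvector_eq_0\<close>). These are $K$ linear conditions, so multiplicities do not exceed $K$. Finally, a number $z \ne 0$ which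
is not an eigenvalue is in the resolvent set: on the complement of finitely many eigenvectors $zT$ has norm at most
$1/2$, and the resolvent equation is solved there by a Neumann series (\<open>fredholm_alternative\<close>). The limits
of Neumann series come from compactness of the operator (\<open>neumann_series\<close>).
\<close>

section \<open>Compact symmetric operators\<close>

text \<open>Subsequences are required to converge, not just to be Cauchy, so that compactness also yields limits in a
  space without completeness.\<close>

definition compact_operator :: "('a::real_normed_vector \<Rightarrow> 'b::real_normed_vector) \<Rightarrow> bool"
  where "compact_operator A \<longleftrightarrow>
    (\<forall>x :: nat \<Rightarrow> 'a. bounded (range x) \<longrightarrow> (\<exists>l r. strict_mono r \<and> (\<lambda>n. A (x (r n))) \<longlonglongrightarrow> l))"

lemma compact_operator_compose_left:
  assumes "compact_operator A" "bounded_linear B"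
  shows "compact_operator (\<lambda>u. B (A u))"
  unfolding compact_operator_def
proof (intro allI impI)
  fix x :: "nat \<Rightarrow> 'a"
  assume "bounded (range x)"
  then obtain l r where "strict_mono r" "(\<lambda>n. A (x (r n))) \<longlonglongrightarrow> l"
    using assms(1) unfolding compact_operator_def by blast
  then show "\<exists>l r. strict_mono r \<and> (\<lambda>n. B (A (x (r n)))) \<longlonglongrightarrow> l"
    using bounded_linear.tendsto[OF assms(2)] by blast
qed

lemma compact_operator_compose_right:
  assumes "compact_operator A" "bounded_linear B"
  shows "compact_operator (\<lambda>u. A (B u))"
  unfolding compact_operator_def
proof (intro allI impI)
  fix x :: "nat \<Rightarrow> 'c"
  assume "bounded (range x)"
  then have "bounded (range (\<lambda>n. B (x n)))"
    using bounded_linear_image[OF _ assms(2), of "range x"] by (simp add: image_image)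
  then show "\<exists>l r. strict_mono r \<and> (\<lambda>n. A (B (x (r n)))) \<longlonglongrightarrow> l"
    using assms(1) unfolding compact_operator_def by blast
qed

text \<open>Write $q(u,v) = \langle (\mu - A)u, v\rangle$, where $\mu$ is the supremum of the form of $A$
  on the unit sphere of $M$. Since $q(v,v) \ge 0$ on $M$, expanding $q(u - sw, u - sw)$ with $w = (\mu - A)u$
  for a suitable $s$ gives $\|(\mu-A)u\|^2 \le B\,q(u,u)$; hence $(\mu - A)u_n \to 0$ along a maximizing sequence, and
  compactness of $A$ makes $u_n$ itself converge.\<close>

lemma maximum_principle:
  fixes A :: "'a::real_inner \<Rightarrow> 'a"
  assumes A: "bounded_linear A" and cpt: "compact_operator A"
    and sym: "\<And>u v. inner (A u) v = inner u (A v)"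
    and M: "subspace M" "closed M" and inv: "\<And>u. u \<in> M \<Longrightarrow> A u \<in> M"
    and u0: "u0 \<in> M" "inner (A u0) u0 > 0"
  obtains \<mu> \<phi> where "0 < \<mu>" "\<phi> \<in> M" "norm \<phi> = 1" "A \<phi> = \<mu> *\<^sub>R \<phi>"
    "\<And>u. u \<in> M \<Longrightarrow> inner (A u) u \<le> \<mu> * (norm u)\<^sup>2"
proof -
  interpret A: bounded_linear A by (fact A)
  obtain N where N: "0 < N" "\<And>u. norm (A u) \<le> norm u * N"
    using A.pos_bounded by blast
  have up: "inner (A u) u \<le> N * (norm u)\<^sup>2" for u
  proof -
    have "inner (A u) u \<le> norm (A u) * norm u" by (rule norm_cauchy_schwarz)
    also have "\<dots> \<le> (norm u * N) * norm u" by (intro mult_right_mono N) auto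
    finally show ?thesis by (simp add: power2_eq_square mult_ac)
  qed
  define S where "S = (\<lambda>u. inner (A u) u) ` {u \<in> M. norm u = 1}"
  define \<mu> where "\<mu> = Sup S"
  have nz: "u0 \<noteq> 0" using u0(2) by (auto simp: A.zero)
  have in_S: "inner (A u) u / (norm u)\<^sup>2 \<in> S" if "u \<in> M" "u \<noteq> 0" for u
  proof -
    let ?v = "(1 / norm u) *\<^sub>R u"
    have "?v \<in> M" "norm ?v = 1" using M(1) that by (auto intro: subspace_scale)
    moreover have "inner (A ?v) ?v = inner (A u) u / (norm u)\<^sup>2"
      by (simp add: A.scaleR power2_eq_square)
    ultimately show ?thesis unfolding S_def by force
  qed
  have bdd: "bdd_above S" unfolding S_def 
  proof (rule bdd_aboveI2)
    show "inner (A u) u \<le> N" if "u \<in> {u \<in> M. norm u = 1}" for u using up[of u] that by simp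
  qed
  have \<mu>_pos: "0 < \<mu>"
  proof -
    have "0 < inner (A u0) u0 / (norm u0)\<^sup>2" using u0(2) nz by simp
    also have "\<dots> \<le> \<mu>" unfolding \<mu>_def by (intro cSup_upper in_S u0 nz bdd)
    finally show ?thesis .
  qed
  have form: "inner (A u) u \<le> \<mu> * (norm u)\<^sup>2" if "u \<in> M" for u
  proof (cases "u = 0")
    case True
    then show ?thesis by (simp add: A.zero)
  next
    case False
    have "inner (A u) u / (norm u)\<^sup>2 \<le> \<mu>" unfolding \<mu>_def by (intro cSup_upper in_S that False bdd)
    then show ?thesis using False by (simp add: divide_simps)
  qed
  have "\<exists>u. u \<in> M \<and> norm u = 1 \<and> inner (A u) u > \<mu> - 1 / Suc n" for n
  proof -
    have "S \<noteq> {}" using in_S[OF u0(1) nz] by auto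
    then have "\<exists>x\<in>S. \<mu> - 1 / Suc n < x"
      unfolding \<mu>_def by (subst less_cSup_iff[symmetric]) (use bdd in auto)
    then show ?thesis unfolding S_def by auto
  qed
  then obtain u where u: "\<And>n. u n \<in> M" "\<And>n. norm (u n) = 1" "\<And>n. inner (A (u n)) (u n) > \<mu> - 1 / Suc n"
    by metis
  define w where "w n = \<mu> *\<^sub>R u n - A (u n)" for n
  have wM: "w n \<in> M" for n unfolding w_def using M(1) u(1) inv by (intro subspace_diff subspace_scale) auto
  define B where "B = \<mu> + N"
  have B: "B > 0" unfolding B_def using \<mu>_pos N by simp
  have w_le: "(norm (w n))\<^sup>2 \<le> B * (1 / Suc n)" for n
  proof -
    define s where "s = 1 / B"
    define v where "v = u n - s *\<^sub>R w n"
    have vM: "v \<in> M" unfolding v_def using M(1) u(1) wM by (intro subspace_diff subspace_scale) auto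
    have "0 \<le> \<mu> * (norm v)\<^sup>2 - inner (A v) v" using form[OF vM] by simp
    also have "\<dots> = (\<mu> * (norm (u n))\<^sup>2 - inner (A (u n)) (u n))
        - 2 * s * inner (w n) (w n) + s\<^sup>2 * (\<mu> * (norm (w n))\<^sup>2 - inner (A (w n)) (w n))"
    proof -
      have "inner (A (w n)) (u n) = inner (w n) (A (u n))" by (rule sym)
      moreover have e: "\<mu> * inner (w n) (u n) = inner (w n) (w n) + inner (w n) (A (u n))"
        by (subst (2) w_def) (simp add: inner_diff_right)
      have "s * (\<mu> * inner (w n) (u n)) = s * inner (w n) (w n) + s * inner (w n) (A (u n))"
        unfolding e distrib_left ..
      ultimately show ?thesis
        unfolding v_def power2_norm_eq_inner by (simp add: A.diff A.scaleR inner_diff_left inner_diff_right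
          inner_commute algebra_simps power2_eq_square)
    qed
    also have "\<dots> \<le> (\<mu> * (norm (u n))\<^sup>2 - inner (A (u n)) (u n)) - 2 * s * inner (w n) (w n)
        + s\<^sup>2 * (B * (norm (w n))\<^sup>2)"
    proof -
      have "- inner (A (w n)) (w n) \<le> norm (A (w n)) * norm (w n)"
        using Cauchy_Schwarz_ineq2[of "A (w n)" "w n"] by linarith
      also have "\<dots> \<le> (norm (w n) * N) * norm (w n)" by (intro mult_right_mono N) auto
      finally have "\<mu> * (norm (w n))\<^sup>2 - inner (A (w n)) (w n) \<le> B * (norm (w n))\<^sup>2"
        unfolding B_def by (simp add: power2_eq_square algebra_simps)
      from mult_left_mono[OF this, of "s\<^sup>2"] show ?thesis by simp
    qed
    also have "\<dots> = (\<mu> - inner (A (u n)) (u n)) - (1 / B) * (norm (w n))\<^sup>2"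
    proof -
      have "s\<^sup>2 * (B * (norm (w n))\<^sup>2) = s * (norm (w n))\<^sup>2"
        using B by (simp add: s_def power2_eq_square)
      moreover have "inner (w n) (w n) = (norm (w n))\<^sup>2" by (simp add: power2_norm_eq_inner)
      ultimately show ?thesis using u(2)[of n] unfolding s_def[symmetric] by simp
    qed
    finally have "(1 / B) * (norm (w n))\<^sup>2 \<le> 1 / Suc n" using u(3)[of n] by linarith
    then show ?thesis using B by (simp add: field_simps)
  qed
  have "(\<lambda>n. (norm (w n))\<^sup>2) \<longlonglongrightarrow> 0"
  proof (rule tendsto_sandwich[OF _ _ tendsto_const])
    show "(\<lambda>n. B * (1 / real (Suc n))) \<longlonglongrightarrow> 0"
      using tendsto_mult_left[OF LIMSEQ_inverse_real_of_nat, of B] by (simp add: divide_inverse)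
  qed (use w_le in auto)
  then have "(\<lambda>n. sqrt ((norm (w n))\<^sup>2)) \<longlonglongrightarrow> sqrt 0" by (rule tendsto_real_sqrt)
  then have w0: "w \<longlonglongrightarrow> 0" by (simp add: tendsto_norm_zero_iff)
  have "bounded (range u)" using u(2) by (auto simp: bounded_iff intro!: exI[of _ 1])
  then obtain l r where r: "strict_mono r" "(\<lambda>n. A (u (r n))) \<longlonglongrightarrow> l"
    using cpt unfolding compact_operator_def by blast
  define \<phi> where "\<phi> = (1 / \<mu>) *\<^sub>R l"
  have "(\<lambda>n. w (r n)) \<longlonglongrightarrow> 0" using LIMSEQ_subseq_LIMSEQ[OF w0 r(1)] by (simp add: o_def)
  from tendsto_add[OF this r(2)] have "(\<lambda>n. \<mu> *\<^sub>R u (r n)) \<longlonglongrightarrow> l" by (simp add: w_def)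
  from tendsto_scaleR[OF tendsto_const[of "1 / \<mu>"] this]
  have lim: "(\<lambda>n. u (r n)) \<longlonglongrightarrow> \<phi>" unfolding \<phi>_def using \<mu>_pos by simp
  have "\<phi> \<in> M" by (rule closed_sequentially[OF M(2) _ lim]) (rule u(1))
  moreover have "norm \<phi> = 1"
    by (rule LIMSEQ_unique[OF tendsto_norm[OF lim]]) (simp add: u(2))
  moreover have "A \<phi> = \<mu> *\<^sub>R \<phi>"
    using LIMSEQ_unique[OF A.tendsto[OF lim] r(2)] \<mu>_pos by (simp add: \<phi>_def)
  ultimately show thesis using that \<mu>_pos form by blast
qed

text \<open>Polarization: $4\langle Au,v\rangle$ is a difference of two values of the form, so the
  parallelogram identity bounds it by $2c(\|u\|^2+\|v\|^2)$; take $v$ to be a multiple of $Au$ with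
  $\|v\| = \|u\|$.\<close>

lemma norm_le_of_form_bound:
  fixes A :: "'a::real_inner \<Rightarrow> 'a"
  assumes A: "linear A" and sym: "\<And>u v. inner (A u) v = inner u (A v)"
    and M: "subspace M" and inv: "\<And>u. u \<in> M \<Longrightarrow> A u \<in> M"
    and form: "\<And>u. u \<in> M \<Longrightarrow> \<bar>inner (A u) u\<bar> \<le> c * (norm u)\<^sup>2"
    and u: "u \<in> M"
  shows "norm (A u) \<le> c * norm u"
proof (cases "u = 0 \<or> A u = 0")
  case True
  have "0 \<le> c * norm u"
  proof (cases "u = 0")
    case False
    have "0 \<le> c * (norm u)\<^sup>2" using form[OF u] by linarith
    then show ?thesis using False by (simp add: zero_le_mult_iff)
  qed simp
  then show ?thesis using True linear_0[OF A] by auto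
next
  case False
  define v where "v = (norm u / norm (A u)) *\<^sub>R A u"
  have v: "v \<in> M" "norm v = norm u" unfolding v_def using M inv[OF u] False
    by (auto intro: subspace_scale)
  have "4 * inner (A u) v = inner (A (u + v)) (u + v) - inner (A (u - v)) (u - v)"
    using sym[of v u] by (simp add: linear_add[OF A] linear_diff[OF A] inner_add_left inner_add_right
        inner_diff_left inner_diff_right inner_commute)
  also have "\<dots> \<le> c * (norm (u + v))\<^sup>2 + c * (norm (u - v))\<^sup>2"
    using form[of "u + v"] form[of "u - v"] subspace_add[OF M u v(1)] subspace_diff[OF M u v(1)] by linarith
  also have "\<dots> = c * (2 * (norm u)\<^sup>2 + 2 * (norm v)\<^sup>2)"
    by (simp add: power2_norm_eq_inner inner_add_left inner_add_right inner_diff_left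
        inner_diff_right inner_commute algebra_simps)
  finally have "inner (A u) v \<le> c * (norm u)\<^sup>2" using v(2) by (simp add: algebra_simps)
  moreover have "inner (A u) v = norm u * norm (A u)"
    unfolding v_def using False by (simp add: power2_norm_eq_inner[symmetric] power2_eq_square)
  ultimately show ?thesis using False by (simp add: power2_eq_square mult_ac)
qed

text \<open>The partial sums $s_n$ of the Neumann series satisfy $s_{n+1} = w + A s_n$. They are bounded,
  so $A s_n$ converges along a subsequence by compactness; as they also form a Cauchy sequence, the
  whole sequence converges.\<close>

lemma neumann_series:
  fixes A :: "'a::real_normed_vector \<Rightarrow> 'a"
  assumes A: "bounded_linear A" and cpt: "compact_operator A"
    and q: "summable q" "\<And>n u. norm ((A ^^ n) u) \<le> q n * norm u"
  obtains y where "y - A y = w" "norm y \<le> suminf q * norm w" "\<And>y'. y' - A y' = w \<Longrightarrow> y' = y"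
proof -
  interpret A: bounded_linear A by (fact A)
  define s where "s n = (\<Sum>k<n. (A ^^ k) w)" for n
  have s_Suc: "s (Suc n) = w + A (s n)" for n
    unfolding s_def by (subst sum.lessThan_Suc_shift) (simp add: A.sum)
  have q_nonneg: "0 \<le> q n * norm w" for n using q(2)[of n w] norm_ge_zero order_trans by blast
  have qs: "summable (\<lambda>n. q n * norm w)" by (intro summable_mult2 q)
  have suminf_eq: "(\<Sum>n. q n * norm w) = suminf q * norm w" by (rule suminf_mult2[OF q(1), symmetric])
  have s_le: "norm (s n) \<le> suminf q * norm w" for n
  proof -
    have "norm (s n) \<le> (\<Sum>k<n. q k * norm w)" unfolding s_def
      by (rule order_trans[OF norm_sum]) (intro sum_mono q)
    also have "\<dots> \<le> suminf q * norm w" unfolding suminf_eq[symmetric]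
      by (intro sum_le_suminf qs) (use q_nonneg in auto)
    finally show ?thesis .
  qed
  have "bounded (range s)" using s_le by (auto simp: bounded_iff)
  then obtain l r where r: "strict_mono r" "(\<lambda>n. A (s (r n))) \<longlonglongrightarrow> l"
    using cpt unfolding compact_operator_def by blast
  define y where "y = w + l"
  have sub: "(\<lambda>n. s (Suc (r n))) \<longlonglongrightarrow> y" unfolding s_Suc y_def by (intro tendsto_add tendsto_const r)
  have "Cauchy s"
  proof -
    have "Cauchy (\<lambda>n. \<Sum>k<n. q k * norm w)"
      using summable_LIMSEQ[OF qs] by (rule LIMSEQ_imp_Cauchy)
    then show ?thesis
      unfolding Cauchy_altdef2
    proof (intro allI impI, goal_cases)
      case (1 e)
      then obtain N where N: "\<And>n. n \<ge> N \<Longrightarrow> dist (\<Sum>k<n. q k * norm w) (\<Sum>k<N. q k * norm w) < e" by blast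
      have "dist (s n) (s N) < e" if "n \<ge> N" for n
      proof -
        have "s n - s N = (\<Sum>k\<in>{N..<n}. (A ^^ k) w)" unfolding s_def using that
          by (simp add: sum_diff[of "{..<n}" "{..<N}", symmetric] lessThan_minus_lessThan)
        also have "norm \<dots> \<le> (\<Sum>k\<in>{N..<n}. q k * norm w)"
          by (rule order_trans[OF norm_sum]) (intro sum_mono q)
        also have "\<dots> = (\<Sum>k<n. q k * norm w) - (\<Sum>k<N. q k * norm w)" using that
          by (simp add: sum_diff[of "{..<n}" "{..<N}", symmetric] lessThan_minus_lessThan)
        also have "\<dots> < e" using N[OF that] by (simp add: dist_real_def)
        finally show ?thesis by (simp add: dist_norm)
      qed
      then show ?case by blast
    qed
  qed
  have r': "strict_mono (\<lambda>n. Suc (r n))" using r(1) by (simp add: strict_mono_def)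
  have lim: "s \<longlonglongrightarrow> y"
  proof (rule metric_LIMSEQ_I)
    fix e :: real assume "e > 0"
    obtain N where N: "\<And>m n. m \<ge> N \<Longrightarrow> n \<ge> N \<Longrightarrow> dist (s m) (s n) < e / 2"
      using metric_CauchyD[OF \<open>Cauchy s\<close>, of "e/2"] \<open>e > 0\<close> by auto
    obtain N' where N': "\<And>n. n \<ge> N' \<Longrightarrow> dist (s (Suc (r n))) y < e / 2"
      using metric_LIMSEQ_D[OF sub, of "e/2"] \<open>e > 0\<close> by auto
    have "dist (s n) y < e" if "n \<ge> N" for n
    proof -
      have "Suc (r (max N N')) \<ge> N" using seq_suble[OF r', of "max N N'"] by auto
      then have "dist (s n) (s (Suc (r (max N N')))) < e / 2" using N that by blast
      moreover have "dist (s (Suc (r (max N N')))) y < e / 2" using N' by simp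
      ultimately show ?thesis using dist_triangle_half_r dist_commute by metis
    qed
    then show "\<exists>N. \<forall>n\<ge>N. dist (s n) y < e" by blast
  qed
  have eq: "y - A y = w"
    using LIMSEQ_unique[OF LIMSEQ_Suc[OF lim, unfolded s_Suc] tendsto_add[OF tendsto_const A.tendsto[OF lim]]]
    by (simp add: algebra_simps)
  have "norm y \<le> suminf q * norm w"
    by (rule Lim_norm_ubound[OF _ lim]) (use s_le in auto)
  moreover have "y' = y" if "y' - A y' = w" for y'
  proof -
    define d where "d = y' - y"
    have "A y = y - w" unfolding eq[symmetric] by simp
    moreover have "A y' = y' - w" unfolding that[symmetric] by simp
    ultimately have "A d = d" unfolding d_def by (simp add: A.diff)
    then have "(A ^^ n) d = d" for n by (induction n) auto
    then have "norm d \<le> q n * norm d" for n using q(2)[of n d] by simp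
    moreover have "(\<lambda>n. q n * norm d) \<longlonglongrightarrow> 0 * norm d"
      by (intro tendsto_mult summable_LIMSEQ_zero q tendsto_const)
    ultimately have "norm d \<le> 0 * norm d" by (intro LIMSEQ_le_const[of "\<lambda>n. q n * norm d"]) auto
    then show ?thesis unfolding d_def by simp
  qed
  ultimately show thesis using that eq by blast
qed

text \<open>Used to find, in the span of more than $N$ vectors, a nonzero vector subject to $N$ linear
  conditions.\<close>

lemma underdetermined_system:
  fixes l :: "nat \<Rightarrow> 'j \<Rightarrow> 'f::field"
  assumes "finite J" "card J > N"
  obtains a where "\<exists>j\<in>J. a j \<noteq> 0" "\<And>i. i < N \<Longrightarrow> (\<Sum>j\<in>J. a j * l i j) = 0"
proof -
  have "\<exists>a. (\<exists>j\<in>J. a j \<noteq> 0) \<and> (\<forall>i<N. (\<Sum>j\<in>J. a j * l i j) = 0)"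
    using assms
  proof (induction N arbitrary: J l)
    case 0
    then have "J \<noteq> {}" by auto
    then show ?case by (intro exI[of _ "\<lambda>_. 1"]) auto
  next
    case (Suc N)
    show ?case
    proof (cases "\<forall>j\<in>J. l N j = 0")
      case True
      have "N < card J" using Suc.prems by simp
      from Suc.IH[OF Suc.prems(1) this, of l]
      obtain a where a: "\<exists>j\<in>J. a j \<noteq> 0" "\<forall>i<N. (\<Sum>j\<in>J. a j * l i j) = 0" by blast
      have "(\<Sum>j\<in>J. a j * l N j) = 0" using True by (intro sum.neutral) auto
      then show ?thesis using a by (intro exI[of _ a]) (auto simp: less_Suc_eq)
    next
      case False
      then obtain k where k: "k \<in> J" "l N k \<noteq> 0" by blast
      define J' where "J' = J - {k}"
      have J': "finite J'" "N < card J'" "k \<notin> J'" "J = insert k J'"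
        using Suc.prems k unfolding J'_def by auto
      \<comment> \<open>Gaussian elimination of the unknown \<open>k\<close>.\<close>
      from Suc.IH[OF J'(1,2), of "\<lambda>i j. l i j - l i k * (l N j / l N k)"]
      obtain a where a: "\<exists>j\<in>J'. a j \<noteq> 0"
        "\<And>i. i < N \<Longrightarrow> (\<Sum>j\<in>J'. a j * (l i j - l i k * (l N j / l N k))) = 0" by blast
      define b where "b = a(k := - (\<Sum>j\<in>J'. a j * (l N j / l N k)))"
      have b: "(\<Sum>j\<in>J. b j * l i j) = (\<Sum>j\<in>J'. a j * (l i j - l i k * (l N j / l N k)))" for i
      proof -
        have "(\<Sum>j\<in>J'. b j * l i j) = (\<Sum>j\<in>J'. a j * l i j)"
          using J'(3) unfolding b_def by (intro sum.cong) auto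
        then show ?thesis using J' unfolding b_def
          by (simp add: sum_subtractf right_diff_distrib sum_distrib_right sum_distrib_left mult_ac)
      qed
      have "(\<Sum>j\<in>J. b j * l N j) = 0" unfolding b using k by simp
      then have "\<forall>i<Suc N. (\<Sum>j\<in>J. b j * l i j) = 0" using a b by (auto simp: less_Suc_eq)
      moreover have "\<exists>j\<in>J. b j \<noteq> 0" using a(1) J' unfolding b_def by auto
      ultimately show ?thesis by blast
    qed
  qed
  then show thesis using that by blast
qed

section \<open>Complex inner product and complex-linear operators\<close>

lemma L2_fun_rep: "L2_fun {0<..} (rep_L2 u)"
  using Quotient_rep_reflp[OF Quotient_L2, of u] by blast

lemma abs_rep_L2: "abs_L2 (rep_L2 u) = u"
  by (rule Quotient_abs_rep[OF Quotient_L2])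

lemma abs_L2_eq_iff:
  assumes "L2_fun {0<..} f" "L2_fun {0<..} g"
  shows "abs_L2 f = abs_L2 g \<longleftrightarrow> ae_eq {0<..} f g"
  using Quotient_rel[OF Quotient_L2, of f g] assms by (auto simp: ae_eq_def)

lemma ae_eq_refl [simp]: "ae_eq S f f"
  by (simp add: ae_eq_def)

lemma cscale_abs: "L2_fun {0<..} f \<Longrightarrow> cscale c (abs_L2 f) = abs_L2 (\<lambda>x. c * f x)"
  by (simp add: cscale.abs_eq)

lemma plus_abs: "L2_fun {0<..} f \<Longrightarrow> L2_fun {0<..} g \<Longrightarrow> abs_L2 f + abs_L2 g = abs_L2 (\<lambda>x. f x + g x)"
  by (simp add: plus_L2.abs_eq)

lemma cinner_abs: "L2_fun {0<..} f \<Longrightarrow> L2_fun {0<..} g \<Longrightarrow>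
    cinner_L2 (abs_L2 f) (abs_L2 g) = (LINT x:{0<..}|lborel. f x * cnj (g x))"
  by (simp add: cinner_L2.abs_eq)

lemma cinner_cnj: "cnj (cinner_L2 u v) = cinner_L2 v u"
proof transfer
  fix f g :: "real \<Rightarrow> complex"
  have "cnj (LINT x:{0<..}|lborel. f x * cnj (g x))
      = (LINT x|lborel. cnj (indicator {0<..} x *\<^sub>R (f x * cnj (g x))))"
    unfolding set_lebesgue_integral_def by (rule Bochner_Integration.integral_cnj[symmetric])
  also have "\<dots> = (LINT x:{0<..}|lborel. g x * cnj (f x))"
    unfolding set_lebesgue_integral_def by (simp add: mult.commute)
  finally show "cnj (LINT x:{0<..}|lborel. f x * cnj (g x)) = (LINT x:{0<..}|lborel. g x * cnj (f x))" .
qed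

lemma cinner_add_left: "cinner_L2 (u + v) w = cinner_L2 u w + cinner_L2 v w"
  by transfer (simp add: ring_distribs set_integral_add L2_fun_mult_integrable)

lemma cinner_cscale_left [simp]: "cinner_L2 (cscale c u) v = c * cinner_L2 u v"
  by transfer (simp add: mult.assoc)

lemma cinner_cscale_right [simp]: "cinner_L2 u (cscale c v) = cnj c * cinner_L2 u v"
  by (metis cinner_cnj cinner_cscale_left complex_cnj_mult)

lemma cinner_add_right: "cinner_L2 u (v + w) = cinner_L2 u v + cinner_L2 u w"
  by (metis cinner_cnj cinner_add_left complex_cnj_add)

lemma uminus_eq_cscale: "- u = cscale (- 1) u" for u :: L2
  by (rule uminus_L2_def)

lemma scaleR_eq_cscale: "r *\<^sub>R u = cscale (complex_of_real r) u"
  by (rule scaleR_L2_def)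

lemma cinner_uminus_left [simp]: "cinner_L2 (- u) v = - cinner_L2 u v"
  and cinner_uminus_right [simp]: "cinner_L2 u (- v) = - cinner_L2 u v"
  using cinner_cscale_left[of "- 1" u v] cinner_cscale_right[of u "- 1" v]
  by (simp_all only: uminus_eq_cscale) simp_all

lemma cinner_scaleR_left [simp]: "cinner_L2 (r *\<^sub>R u) v = of_real r * cinner_L2 u v"
  and cinner_scaleR_right [simp]: "cinner_L2 u (r *\<^sub>R v) = of_real r * cinner_L2 u v"
  by (simp_all add: scaleR_eq_cscale)

lemma cinner_diff_left: "cinner_L2 (u - v) w = cinner_L2 u w - cinner_L2 v w"
  and cinner_diff_right: "cinner_L2 w (u - v) = cinner_L2 w u - cinner_L2 w v"
  using cinner_add_left[of u "- v" w] cinner_add_right[of w u "- v"] by simp_all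

lemma cinner_zero_left [simp]: "cinner_L2 0 v = 0"
  and cinner_zero_right [simp]: "cinner_L2 v 0 = 0"
  using cinner_diff_left[of 0 0 v] cinner_diff_right[of v 0 0] by simp_all

lemma cinner_sum_left: "cinner_L2 (sum f A) v = (\<Sum>i\<in>A. cinner_L2 (f i) v)"
  by (induction A rule: infinite_finite_induct) (simp_all add: cinner_add_left)

lemma cinner_sum_right: "cinner_L2 v (sum f A) = (\<Sum>i\<in>A. cinner_L2 v (f i))"
  by (induction A rule: infinite_finite_induct) (simp_all add: cinner_add_right)

lemma cinner_self: "cinner_L2 u u = of_real ((norm u)\<^sup>2)"
proof -
  have "Im (cinner_L2 u u) = 0" using cinner_cnj[of u u] by (simp add: complex_eq_iff)
  then show ?thesis by (simp add: complex_eq_iff power2_norm_eq_inner inner_L2_def)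
qed

lemma norm_cscale [simp]: "norm (cscale c u) = norm c * norm u"
proof -
  have "complex_of_real ((norm (cscale c u))\<^sup>2) = of_real ((norm c * norm u)\<^sup>2)"
    unfolding cinner_self[symmetric] power_mult_distrib of_real_mult complex_norm_square
    by (simp add: mult.assoc)
  then have "(norm (cscale c u))\<^sup>2 = (norm c * norm u)\<^sup>2" by (simp only: of_real_eq_iff)
  then show ?thesis by (rule power2_eq_imp_eq) auto
qed

lemma cinner_Cauchy_Schwarz: "norm (cinner_L2 u v) \<le> norm u * norm v"
proof (cases "cinner_L2 u v = 0")
  case False
  define c where "c = cnj (cinner_L2 u v) / norm (cinner_L2 u v)"
  have c: "norm c = 1" "c * cinner_L2 u v = norm (cinner_L2 u v)"
    using False complex_norm_square[of "cinner_L2 u v"]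
    by (simp_all add: c_def norm_divide power2_eq_square field_simps)
  have "norm (cinner_L2 u v) = inner (cscale c u) v" by (simp add: inner_L2_def c(2))
  also have "\<dots> \<le> norm (cscale c u) * norm v" by (rule norm_cauchy_schwarz)
  finally show ?thesis using c by simp
qed simp

lemma continuous_on_cinner: "continuous_on S (\<lambda>u. cinner_L2 u v)"
proof -
  have "bounded_linear (\<lambda>u. cinner_L2 u v)"
    by (rule bounded_linear_intro[of _ "norm v"])
       (auto simp: cinner_add_left scaleR_conv_of_real intro: cinner_Cauchy_Schwarz)
  then show ?thesis by (rule linear_continuous_on)
qed

lemma closed_cinner: "closed {u. cinner_L2 u v = 0}"
  by (rule closed_Collect_eq[OF continuous_on_cinner continuous_on_const])

text \<open>\<^const>\<open>bounded_linear\<close> speaks of real scalars only.\<close>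

definition cblinear :: "(L2 \<Rightarrow> L2) \<Rightarrow> bool"
  where "cblinear A \<longleftrightarrow> bounded_linear A \<and> (\<forall>c u. A (cscale c u) = cscale c (A u))"

lemma cblinearI:
  assumes "\<And>u v. A (u + v) = A u + A v" "\<And>c u. A (cscale c u) = cscale c (A u)"
    and "\<And>u. norm (A u) \<le> B * norm u"
  shows "cblinear A"
  unfolding cblinear_def
proof
  show "bounded_linear A"
    by (rule bounded_linear_intro[of _ B]) (use assms in \<open>auto simp: scaleR_eq_cscale mult.commute\<close>)
qed (use assms in blast)

lemma cblinear_bounded_linear: "cblinear A \<Longrightarrow> bounded_linear A"
  by (simp add: cblinear_def)

lemma cblinear_linear: "cblinear A \<Longrightarrow> linear A"
  by (simp add: cblinear_def bounded_linear.linear)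

lemma cblinear_cscale: "cblinear A \<Longrightarrow> A (cscale c u) = cscale c (A u)"
  by (simp add: cblinear_def)

lemma cblinear_add: "cblinear A \<Longrightarrow> A (u + v) = A u + A v"
  by (simp add: cblinear_linear linear_add)

lemma cblinear_diff: "cblinear A \<Longrightarrow> A (u - v) = A u - A v"
  by (simp add: cblinear_linear linear_diff)

lemma cblinear_zero: "cblinear A \<Longrightarrow> A 0 = 0"
  by (simp add: cblinear_linear linear_0)

lemma cblinear_sum: "cblinear A \<Longrightarrow> A (sum f S) = (\<Sum>i\<in>S. A (f i))"
  by (simp add: cblinear_linear linear_sum)

lemma cblinear_bound: assumes "cblinear A" obtains B where "0 < B" "\<And>u. norm (A u) \<le> B * norm u"
  using bounded_linear.pos_bounded[OF cblinear_bounded_linear[OF assms]] by (auto simp: mult.commute)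

lemma cscale_commute: "cscale a (cscale b u) = cscale b (cscale a u)"
  by (simp add: mult.commute)

lemma cblinear_id: "cblinear (\<lambda>u. u)"
  by (rule cblinearI[of _ 1]) auto

lemma cblinear_compose: assumes "cblinear A" "cblinear B" shows "cblinear (\<lambda>u. A (B u))"
  using assms by (auto simp: cblinear_def intro: bounded_linear_compose)

lemma cblinear_cmult: assumes "cblinear A" shows "cblinear (\<lambda>u. cscale c (A u))"
proof -
  obtain B where "\<And>u. norm (A u) \<le> B * norm u" using cblinear_bound[OF assms] by blast
  then show ?thesis
    by (intro cblinearI[of _ "norm c * B"])
       (auto simp: cblinear_add[OF assms] cblinear_cscale[OF assms] L2.scale_right_distrib
         mult.commute[of c] mult.assoc intro: mult_left_mono)
qed

lemma cblinear_scaleR: "cblinear A \<Longrightarrow> cblinear (\<lambda>u. r *\<^sub>R A u)"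
  unfolding scaleR_eq_cscale by (rule cblinear_cmult)

lemma cblinear_plus: assumes "cblinear A" "cblinear B" shows "cblinear (\<lambda>u. A u + B u)"
  using assms by (auto simp: cblinear_def L2.scale_right_distrib intro: bounded_linear_add)

lemma cblinear_const0: "cblinear (\<lambda>u. 0)"
  by (rule cblinearI[of _ 0]) auto

lemma cblinear_Sum: "(\<And>i. i \<in> S \<Longrightarrow> cblinear (A i)) \<Longrightarrow> cblinear (\<lambda>u. \<Sum>i\<in>S. A i u)"
  by (induction S rule: infinite_finite_induct) (auto intro: cblinear_const0 cblinear_plus)

lemma cblinear_minus: assumes "cblinear A" "cblinear B" shows "cblinear (\<lambda>u. A u - B u)"
  using assms by (auto simp: cblinear_def L2.scale_right_diff_distrib intro: bounded_linear_sub)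

lemma cblinear_funpow: "cblinear A \<Longrightarrow> cblinear (A ^^ n)"
  by (induction n) (auto simp: o_def id_def intro: cblinear_id cblinear_compose)

lemma norm_funpow_le:
  fixes A :: "L2 \<Rightarrow> L2"
  assumes "\<And>u. norm (A u) \<le> b * norm u" "0 \<le> b"
  shows "norm ((A ^^ n) u) \<le> b ^ n * norm u"
proof (induction n)
  case (Suc n)
  have "norm ((A ^^ Suc n) u) \<le> b * norm ((A ^^ n) u)" using assms(1)[of "(A ^^ n) u"] by simp
  also have "\<dots> \<le> b * (b ^ n * norm u)" by (intro mult_left_mono Suc assms)
  finally show ?case by (simp add: mult.assoc)
qed simp

section \<open>Functions on an interval as elements of $L^2(0,\infty)$\<close>

lemma L2_fun_bounded:
  assumes "set_borel_measurable lborel {0<..<a} f" "\<And>t. t \<in> {0<..<a} \<Longrightarrow> norm (f t) \<le> M"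
  shows "L2_fun {0<..<a::real} f"
  unfolding L2_fun_alt
proof
  show m: "(\<lambda>x. indicator {0<..<a} x *\<^sub>R f x) \<in> borel_measurable lborel"
    using assms(1) unfolding set_borel_measurable_def .
  show "integrable lborel (\<lambda>x. (norm (indicator {0<..<a} x *\<^sub>R f x))\<^sup>2)"
  proof (rule Bochner_Integration.integrable_bound)
    show "integrable lborel (\<lambda>x. M\<^sup>2 * indicator {0<..<a} x :: real)"
      by (intro integrable_mult_right integrable_real_indicator emeasure_bounded_finite) auto
    show "(\<lambda>x. (norm (indicator {0<..<a} x *\<^sub>R f x))\<^sup>2) \<in> borel_measurable lborel" using m by measurable
    show "AE x in lborel. norm ((norm (indicator {0<..<a} x *\<^sub>R f x))\<^sup>2) \<le> norm (M\<^sup>2 * indicator {0<..<a} x)"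
      using assms(2) by (intro AE_I2) (auto simp: indicator_def intro!: power_mono)
  qed
qed

lemma L2_fun_continuous:
  assumes "continuous_on {0..a} f"
  shows "L2_fun {0<..<a::real} f"
proof -
  have "compact (f ` {0..a})" using assms by (intro compact_continuous_image) auto
  then obtain M where "\<forall>x\<in>f ` {0..a}. norm x \<le> M" using compact_imp_bounded bounded_iff by blast
  moreover have "set_borel_measurable lborel {0<..<a} f" unfolding set_borel_measurable_def measurable_lborel2
    by (intro borel_measurable_continuous_on_indicator continuous_on_subset[OF assms]) auto
  ultimately show ?thesis by (intro L2_fun_bounded[of _ _ M]) auto
qed

lemma L2_fun_subset:
  assumes "L2_fun S f" "T \<in> sets lborel" "T \<subseteq> S"
  shows "L2_fun T f"
proof -
  have eq: "indicator T x *\<^sub>R f x = indicator T x *\<^sub>R (indicator S x *\<^sub>R f x)"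
    "indicator T x *\<^sub>R (norm (f x))\<^sup>2 = indicator T x *\<^sub>R (indicator S x *\<^sub>R (norm (f x))\<^sup>2)" for x
    using assms(3) by (auto simp: indicator_def)
  have [measurable]: "T \<in> sets borel" using assms(2) by simp
  have m: "(\<lambda>x. indicator S x *\<^sub>R f x) \<in> borel_measurable lborel"
    and i: "integrable lborel (\<lambda>x. indicator S x *\<^sub>R (norm (f x))\<^sup>2)"
    using assms(1) unfolding L2_fun_def set_borel_measurable_def set_integrable_def by auto
  have "(\<lambda>x. indicator T x *\<^sub>R (indicator S x *\<^sub>R f x)) \<in> borel_measurable lborel"
    using m by measurable
  then show ?thesis unfolding L2_fun_def set_borel_measurable_def set_integrable_def eq
    using integrable_mult_indicator[OF _ i, of T] assms(2) by blast
qed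

lemma L2_fun_integrable:
  assumes "L2_fun S f" "emeasure lborel S < \<infinity>" "S \<in> sets lborel"
  shows "set_integrable lborel S f"
proof -
  have [measurable]: "S \<in> sets borel" using assms(3) by simp
  have "(norm (indicator S x *\<^sub>R (1::complex)))\<^sup>2 = indicator S x" for x by (auto simp: indicator_def)
  then have "L2_fun S (\<lambda>x. 1)" using integrable_real_indicator[OF assms(3,2)] unfolding L2_fun_alt by simp
  then show ?thesis using L2_fun_mult_integrable[OF assms(1)] by fastforce
qed

lemma AE_reflect:
  assumes "AE x in lborel. P (x::real)"
  shows "AE x in lborel. P (a - x)"
proof -
  have "distr lborel borel (\<lambda>x::real. a + (-1) * x) = lborel"
    using lborel_real_affine[of "-1" a] by (simp add: density_1)
  then have "AE x in distr lborel borel (\<lambda>x::real. a + (-1) * x). P x" using assms by (simp only:)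
  then have "AE x in lborel. P (a + (-1) * x)" by (rule AE_distrD[rotated]) measurable
  then show ?thesis by simp
qed

text \<open>Extension by zero makes $L^2(0,a)$ a subspace of $L^2(0,\infty)$, so that operators on the interval
  become operators that read and produce only the part on $(0,a)$.\<close>

definition emb :: "real \<Rightarrow> (real \<Rightarrow> complex) \<Rightarrow> L2"
  where "emb a f = abs_L2 (\<lambda>t. indicator {0<..<a} t *\<^sub>R f t)"

lemma L2_fun_indicator:
  assumes "L2_fun {0<..<a} f"
  shows "L2_fun {0<..} (\<lambda>t. indicator {0<..<a} t *\<^sub>R f t)"
proof -
  have "indicator {0<..} x *\<^sub>R indicator {0<..<a} x *\<^sub>R f x = indicator {0<..<a} x *\<^sub>R f x" for x
    by (auto simp: indicator_def)
  then show ?thesis using assms unfolding L2_fun_alt by (simp only:)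
qed

lemma emb_cong: "(\<And>t. t \<in> {0<..<a} \<Longrightarrow> f t = g t) \<Longrightarrow> emb a f = emb a g"
  unfolding emb_def by (intro arg_cong[of _ _ abs_L2] ext) (auto simp: indicator_def)

lemma emb_eq_iff:
  assumes "L2_fun {0<..<a} f" "L2_fun {0<..<a} g"
  shows "emb a f = emb a g \<longleftrightarrow> ae_eq {0<..<a} f g"
  unfolding emb_def using abs_L2_eq_iff[OF assms[THEN L2_fun_indicator]]
  by (auto simp: ae_eq_def indicator_def elim!: AE_mp)

lemma emb_add:
  assumes "L2_fun {0<..<a} f" "L2_fun {0<..<a} g"
  shows "emb a f + emb a g = emb a (\<lambda>t. f t + g t)"
  unfolding emb_def using plus_abs[OF assms[THEN L2_fun_indicator]] by (simp add: algebra_simps)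

lemma emb_cscale:
  assumes "L2_fun {0<..<a} f"
  shows "cscale c (emb a f) = emb a (\<lambda>t. c * f t)"
  unfolding emb_def using cscale_abs[OF L2_fun_indicator[OF assms]] by simp

lemma emb_zero [simp]: "emb a (\<lambda>t. 0) = 0"
  by (simp add: emb_def zero_L2_def)

lemma emb_sum:
  assumes "finite S" "\<And>i. i \<in> S \<Longrightarrow> L2_fun {0<..<a} (f i)"
  shows "L2_fun {0<..<a} (\<lambda>t. \<Sum>i\<in>S. f i t) \<and> (\<Sum>i\<in>S. emb a (f i)) = emb a (\<lambda>t. \<Sum>i\<in>S. f i t)"
  using assms by (induction S) (auto simp: emb_add L2_fun_0 L2_fun_add)

lemma cinner_emb:
  assumes "L2_fun {0<..<a} f" "L2_fun {0<..<a} g"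
  shows "cinner_L2 (emb a f) (emb a g) = (LINT x:{0<..<a}|lborel. f x * cnj (g x))"
proof -
  have "indicator {0<..} x *\<^sub>R (indicator {0<..<a} x *\<^sub>R f x * cnj (indicator {0<..<a} x *\<^sub>R g x))
      = indicator {0<..<a} x *\<^sub>R (f x * cnj (g x))" for x
    by (auto simp: indicator_def)
  then show ?thesis
    unfolding emb_def cinner_abs[OF assms[THEN L2_fun_indicator]] set_lebesgue_integral_def by (simp only:)
qed

lemma norm_emb:
  assumes "L2_fun {0<..<a} f"
  shows "(norm (emb a f))\<^sup>2 = (LINT x:{0<..<a}|lborel. (norm (f x))\<^sup>2)"
proof -
  have "complex_of_real ((norm (emb a f))\<^sup>2) = (LINT x:{0<..<a}|lborel. complex_of_real ((norm (f x))\<^sup>2))"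
    unfolding cinner_self[symmetric] cinner_emb[OF assms assms] by (simp only: complex_norm_square)
  then show ?thesis unfolding set_integral_complex_of_real by (simp only: of_real_eq_iff)
qed

lemma norm_emb_le:
  assumes "L2_fun {0<..<a} f" "\<And>t. t \<in> {0<..<a} \<Longrightarrow> norm (f t) \<le> M" "0 \<le> a" "0 \<le> M"
  shows "norm (emb a f) \<le> M * sqrt a"
proof -
  have "(norm (emb a f))\<^sup>2 \<le> (LINT x:{0<..<a}|lborel. M\<^sup>2)"
    unfolding norm_emb[OF assms(1)]
  proof (rule set_integral_mono)
    show "set_integrable lborel {0<..<a} (\<lambda>x. (norm (f x))\<^sup>2)" using assms(1) by (simp add: L2_fun_def)
    show "set_integrable lborel {0<..<a} (\<lambda>x. M\<^sup>2)" 
      unfolding set_integrable_def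
      by (intro integrable_scaleR_left integrable_real_indicator emeasure_bounded_finite) auto
  qed (use assms(2) in \<open>auto intro: power_mono\<close>)
  also have "\<dots> = (M * sqrt a)\<^sup>2" using assms(3) by (simp add: set_lebesgue_integral_def power_mult_distrib)
  finally show ?thesis using assms by (intro power2_le_imp_le[OF _ mult_nonneg_nonneg]) auto
qed

lemma LINT_FTC:
  fixes f :: "real \<Rightarrow> complex"
  assumes "0 \<le> b" "continuous_on {0..b} f"
    and "\<And>x. x \<in> {0..b} \<Longrightarrow> (F has_vector_derivative f x) (at x within {0..b})"
  shows "(LINT x:{0<..<b}|lborel. f x) = F b - F 0"
  using interval_integral_FTC_finite[of 0 b f F] assms by (simp add: interval_integral_Ioo min_def max_def zero_ereal_def)

lemma emeasure_Ioo_finite [simp]: "emeasure lborel {a<..<b::real} < top"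
  by (cases "a \<le> b") auto

lemma LINT_power:
  assumes "0 \<le> b"
  shows "(LINT x:{0<..<b}|lborel. x ^ n) = b ^ Suc n / Suc n"
proof -
  have "((\<lambda>x. x ^ Suc n / Suc n) has_vector_derivative x ^ n) (at x within {min 0 b..max 0 b})" for x :: real
    by (auto intro!: derivative_eq_intros simp: has_real_derivative_iff_has_vector_derivative[symmetric] simp del: power_Suc)
  then have "(LBINT x=0..b. x ^ n) = b ^ Suc n / Suc n - 0 ^ Suc n / Suc n"
    by (intro interval_integral_FTC_finite[of 0 b "\<lambda>x. x ^ n", unfolded zero_ereal_def[symmetric]]) (auto intro!: continuous_intros)
  then show ?thesis using assms by (simp add: interval_integral_Ioo min_def max_def zero_ereal_def continuous_intros)
qed

section \<open>The Volterra operator on an interval\<close>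

definition restr :: "real \<Rightarrow> L2 \<Rightarrow> L2" where "restr t0 u = emb t0 (rep_L2 u)"
definition refl :: "real \<Rightarrow> L2 \<Rightarrow> L2" where "refl t0 u = emb t0 (\<lambda>t. rep_L2 u (t0 - t))"
text \<open>The inner product of $u$ with the indicator function of $(0,s)$ is $\int_0^s u$, a continuous function
  of $s$ for which no representative of $u$ has to be chosen. So \<open>prim\<close> integrates from $0$.\<close>

definition chi :: "real \<Rightarrow> real \<Rightarrow> L2" where "chi t0 s = emb t0 (indicator {0<..<s})"
definition prim :: "real \<Rightarrow> L2 \<Rightarrow> L2" where "prim t0 u = emb t0 (\<lambda>t. cinner_L2 u (chi t0 t))"

locale interval =
  fixes t0 :: real
  assumes t0: "0 < t0"
begin

abbreviation "P \<equiv> restr t0"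
abbreviation "J \<equiv> refl t0"
abbreviation "V \<equiv> prim t0"
abbreviation "\<eta> \<equiv> chi t0"
abbreviation "I \<equiv> {0<..<t0}"

lemma L2_fun_I: "L2_fun {0<..} f \<Longrightarrow> L2_fun I f"
  by (erule L2_fun_subset) auto

lemma L2_fun_rep_I: "L2_fun I (rep_L2 u)"
  by (intro L2_fun_I L2_fun_rep)

lemma L2_fun_refl:
  assumes "L2_fun I f"
  shows "L2_fun I (\<lambda>t. f (t0 - t))"
proof -
  let ?F = "\<lambda>x. indicator I x *\<^sub>R f x"
  have eq: "indicator I x *\<^sub>R f (t0 - x) = ?F (t0 + (-1) * x)" for x by (auto simp: indicator_def)
  have [measurable]: "?F \<in> borel_measurable borel" and i: "integrable lborel (\<lambda>x. (norm (?F x))\<^sup>2)"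
    using assms by (auto simp only: L2_fun_alt measurable_lborel2)
  show ?thesis unfolding L2_fun_alt eq
  proof
    have "(\<lambda>x. t0 + (-1) * x) \<in> borel_measurable borel" by measurable
    from measurable_compose[OF this \<open>?F \<in> borel_measurable borel\<close>]
    show "(\<lambda>x. ?F (t0 + (-1) * x)) \<in> borel_measurable lborel" by simp
    show "integrable lborel (\<lambda>x. (norm (?F (t0 + (-1) * x)))\<^sup>2)"
      by (rule lborel_integrable_real_affine[OF i]) simp
  qed
qed

lemma ae_eq_refl_I:
  assumes "ae_eq I f g"
  shows "ae_eq I (\<lambda>t. f (t0 - t)) (\<lambda>t. g (t0 - t))"
  using AE_reflect[OF assms[unfolded ae_eq_def], of t0] unfolding ae_eq_def by (auto elim!: AE_mp)

lemma rep_abs_ae: assumes "L2_fun {0<..} f" shows "ae_eq I (rep_L2 (abs_L2 f)) f"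
proof -
  have "ae_eq {0<..} (rep_L2 (abs_L2 f)) f"
    using abs_L2_eq_iff[OF L2_fun_rep assms, of "abs_L2 f"] unfolding abs_rep_L2 by blast
  then show ?thesis by (auto simp: ae_eq_def elim!: AE_mp)
qed

lemma restr_abs: "L2_fun {0<..} f \<Longrightarrow> P (abs_L2 f) = emb t0 f"
  unfolding restr_def using emb_eq_iff[OF L2_fun_rep_I L2_fun_I] rep_abs_ae by blast

lemma refl_abs: "L2_fun {0<..} f \<Longrightarrow> J (abs_L2 f) = emb t0 (\<lambda>t. f (t0 - t))"
  unfolding refl_def using emb_eq_iff[OF L2_fun_refl[OF L2_fun_rep_I] L2_fun_refl[OF L2_fun_I]]
    ae_eq_refl_I[OF rep_abs_ae] by blast

lemma restr_emb: "L2_fun I f \<Longrightarrow> P (emb t0 f) = emb t0 f"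
  by (subst (1) emb_def) (auto simp: restr_abs[OF L2_fun_indicator] intro!: emb_cong)

lemma refl_emb: "L2_fun I f \<Longrightarrow> J (emb t0 f) = emb t0 (\<lambda>t. f (t0 - t))"
  by (subst (1) emb_def) (auto simp: refl_abs[OF L2_fun_indicator] intro!: emb_cong)

lemma L2_cases: obtains f where "L2_fun {0<..} f" "u = abs_L2 f"
  using L2_fun_rep abs_rep_L2 by metis

lemma cinner_emb_right: assumes "L2_fun I g"
  shows "cinner_L2 u (emb t0 g) = cinner_L2 (P u) (emb t0 g)"
proof -
  have "indicator {0<..} x *\<^sub>R (rep_L2 u x * cnj (indicator I x *\<^sub>R g x))
      = indicator I x *\<^sub>R (rep_L2 u x * cnj (g x))" for x
    by (auto simp: indicator_def)
  then have "cinner_L2 (abs_L2 (rep_L2 u)) (emb t0 g) = (LINT x:I|lborel. rep_L2 u x * cnj (g x))"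
    unfolding emb_def cinner_abs[OF L2_fun_rep L2_fun_indicator[OF assms]]
    unfolding set_lebesgue_integral_def by (simp only:)
  then show ?thesis unfolding restr_def cinner_emb[OF L2_fun_rep_I assms] abs_rep_L2 .
qed

lemma restr_sym: "cinner_L2 (P u) v = cinner_L2 u (P v)"
proof -
  have 1: "cinner_L2 u (P v) = cinner_L2 (P u) (P v)" for u v
    unfolding restr_def[of _ v] by (rule cinner_emb_right[OF L2_fun_rep_I])
  from 1[of v u] have "cinner_L2 (P u) v = cinner_L2 (P u) (P v)" by (metis cinner_cnj)
  then show ?thesis using 1[of u v] by simp
qed

lemma restr_restr [simp]: "P (P u) = P u"
  unfolding restr_def[of _ u] by (rule restr_emb[OF L2_fun_rep_I])

lemma norm_restr_le: "norm (P u) \<le> norm u"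
proof -
  have "(norm (P u))\<^sup>2 = norm (cinner_L2 (P u) (P u))" unfolding cinner_self by (simp only: norm_of_real) simp
  also have "\<dots> = norm (cinner_L2 u (P u))" by (simp add: restr_sym)
  also have "\<dots> \<le> norm u * norm (P u)" by (rule cinner_Cauchy_Schwarz)
  finally show ?thesis by (cases "P u = 0") (auto simp: power2_eq_square)
qed

lemma restr_add: "P (u + v) = P u + P v"
  by (rule L2_cases[of u], rule L2_cases[of v]) (simp add: plus_abs restr_abs L2_fun_add emb_add L2_fun_I)

lemma restr_cscale: "P (cscale c u) = cscale c (P u)"
  by (rule L2_cases[of u]) (simp add: cscale_abs restr_abs L2_fun_cmult emb_cscale L2_fun_I)

lemma cblinear_restr: "cblinear P"
  by (rule cblinearI[of _ 1]) (auto simp: restr_add restr_cscale norm_restr_le)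

lemma refl_add: "J (u + v) = J u + J v"
  by (rule L2_cases[of u], rule L2_cases[of v])
     (simp add: plus_abs refl_abs L2_fun_add emb_add L2_fun_I L2_fun_refl)

lemma refl_cscale: "J (cscale c u) = cscale c (J u)"
  by (rule L2_cases[of u]) (simp add: cscale_abs refl_abs L2_fun_cmult emb_cscale L2_fun_I L2_fun_refl)

lemma refl_refl [simp]: "J (J u) = P u"
  unfolding refl_def[of _ u] restr_def by (simp add: refl_emb L2_fun_refl L2_fun_rep_I)

lemma restr_refl [simp]: "P (J u) = J u"
  unfolding refl_def by (simp add: restr_emb L2_fun_refl L2_fun_rep_I)

lemma refl_restr [simp]: "J (P u) = J u"
  unfolding refl_def[of _ u] restr_def by (simp add: refl_emb L2_fun_rep_I)

lemma refl_sym: "cinner_L2 (J u) v = cinner_L2 u (J v)"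
proof -
  let ?f = "rep_L2 u" and ?g = "rep_L2 v"
  have "cinner_L2 (J u) (P v) = (LINT x:I|lborel. ?f (t0 - x) * cnj (?g x))"
    unfolding refl_def restr_def by (rule cinner_emb[OF L2_fun_refl[OF L2_fun_rep_I] L2_fun_rep_I])
  also have "\<dots> = \<bar>- 1\<bar> *\<^sub>R (LINT x|lborel. indicator I (t0 + (-1) * x) *\<^sub>R (?f (t0 - (t0 + (-1) * x)) * cnj (?g (t0 + (-1) * x))))"
    unfolding set_lebesgue_integral_def by (rule lborel_integral_real_affine) simp
  also have "\<dots> = (LINT x:I|lborel. ?f x * cnj (?g (t0 - x)))"
    unfolding set_lebesgue_integral_def
    by (simp, intro Bochner_Integration.integral_cong) (auto simp: indicator_def)
  also have "\<dots> = cinner_L2 (P u) (J v)"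
    unfolding refl_def restr_def by (rule cinner_emb[OF L2_fun_rep_I L2_fun_refl[OF L2_fun_rep_I], symmetric])
  finally have "cinner_L2 (J u) (P v) = cinner_L2 (P u) (J v)" .
  then show ?thesis using restr_sym[of "J u" v, symmetric] restr_sym[of u "J v"] by (simp only: restr_refl)
qed

lemma norm_refl_le: "norm (J u) \<le> norm u"
proof -
  have "(norm (J u))\<^sup>2 = norm (cinner_L2 (J u) (J u))" unfolding cinner_self by (simp only: norm_of_real) simp
  also have "\<dots> = norm (cinner_L2 u (P u))" by (simp add: refl_sym)
  also have "\<dots> \<le> norm u * norm (P u)" by (rule cinner_Cauchy_Schwarz)
  also have "\<dots> \<le> norm u * norm u" by (intro mult_left_mono norm_restr_le) auto
  finally have "(norm (J u))\<^sup>2 \<le> (norm u)\<^sup>2" by (simp only: power2_eq_square)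
  then show ?thesis by (rule power2_le_imp_le) simp
qed

lemma cblinear_refl: "cblinear J"
  by (rule cblinearI[of _ 1]) (auto simp: refl_add refl_cscale norm_refl_le)

lemma L2_fun_chi: "L2_fun I (indicator {0<..<s})"
  by (rule L2_fun_bounded[of _ _ 1]) (auto simp: set_borel_measurable_def indicator_def)

lemma cinner_chi: assumes "L2_fun I f" "t \<le> t0"
  shows "cinner_L2 (emb t0 f) (\<eta> t) = (LINT s:{0<..<t}|lborel. f s)"
  unfolding chi_def cinner_emb[OF assms(1) L2_fun_chi] set_lebesgue_integral_def
  using assms(2) by (intro Bochner_Integration.integral_cong) (auto simp: indicator_def)

lemma chi_0 [simp]: "\<eta> 0 = 0"
  unfolding chi_def by (subst emb_zero[of t0, symmetric]) (rule emb_cong, simp)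

lemma norm_chi_diff:
  assumes "0 \<le> s" "s \<le> t" "t \<le> t0"
  shows "norm (\<eta> t - \<eta> s) \<le> sqrt (t - s)"
proof -
  have c: "cinner_L2 (\<eta> x) (\<eta> y) = x" if "0 \<le> x" "x \<le> y" "y \<le> t0" for x y
  proof -
    have "cinner_L2 (\<eta> x) (\<eta> y) = (LINT s:{0<..<y}|lborel. indicator {0<..<x} s)"
      using cinner_chi[OF L2_fun_chi, of y x] that by (simp add: chi_def)
    also have "\<dots> = (LINT s|lborel. complex_of_real (indicator {0<..<x} s))"
      unfolding set_lebesgue_integral_def using that
      by (intro Bochner_Integration.integral_cong) (auto simp: indicator_def)
    also have "\<dots> = x" using that by simp
    finally show ?thesis .
  qed
  have c': "cinner_L2 (\<eta> t) (\<eta> s) = s" using c[OF assms] cinner_cnj[of "\<eta> s" "\<eta> t"] by simp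
  have "complex_of_real ((norm (\<eta> t - \<eta> s))\<^sup>2) = complex_of_real (t - s)"
    unfolding cinner_self[symmetric] cinner_diff_left cinner_diff_right using assms c c' by simp
  then have "(norm (\<eta> t - \<eta> s))\<^sup>2 = t - s" by (simp only: of_real_eq_iff)
  then have "norm (\<eta> t - \<eta> s) = sqrt (t - s)" by (intro real_sqrt_unique[symmetric]) auto
  then show ?thesis by simp
qed

text \<open>Primitives of $L^2$ functions are Hoelder continuous of exponent $1/2$, by Cauchy and Schwarz.\<close>

lemma cinner_chi_diff_le:
  assumes "s \<in> {0..t0}" "t \<in> {0..t0}"
  shows "norm (cinner_L2 u (\<eta> t) - cinner_L2 u (\<eta> s)) \<le> norm u * sqrt \<bar>t - s\<bar>"
proof -
  have *: "norm (cinner_L2 u (\<eta> t) - cinner_L2 u (\<eta> s)) \<le> norm u * sqrt \<bar>t - s\<bar>" if "0 \<le> s" "s \<le> t" "t \<le> t0" for s t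
  proof -
    have "norm (cinner_L2 u (\<eta> t - \<eta> s)) \<le> norm u * norm (\<eta> t - \<eta> s)" by (rule cinner_Cauchy_Schwarz)
    also have "\<dots> \<le> norm u * sqrt (t - s)" by (intro mult_left_mono norm_chi_diff that) auto
    finally show ?thesis using that by (simp add: cinner_diff_right)
  qed
  show ?thesis
  proof (cases "s \<le> t")
    case False
    then have "norm (cinner_L2 u (\<eta> s) - cinner_L2 u (\<eta> t)) \<le> norm u * sqrt \<bar>s - t\<bar>" using assms by (intro *) auto
    then show ?thesis by (subst norm_minus_commute, subst abs_minus_commute)
  qed (use * assms in simp)
qed

lemma norm_cinner_chi_le:
  assumes "t \<in> {0..t0}"
  shows "norm (cinner_L2 u (\<eta> t)) \<le> norm u * sqrt t0"
proof -
  have "norm (cinner_L2 u (\<eta> t)) \<le> norm u * sqrt t" using cinner_chi_diff_le[of 0 t u] assms t0 by simp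
  also have "\<dots> \<le> norm u * sqrt t0" using assms by (intro mult_left_mono) auto
  finally show ?thesis .
qed

lemma continuous_on_cinner_chi: "continuous_on {0..t0} (\<lambda>t. cinner_L2 u (\<eta> t))"
  unfolding continuous_on_def
proof
  fix s assume s: "s \<in> {0..t0}"
  show "((\<lambda>t. cinner_L2 u (\<eta> t)) \<longlongrightarrow> cinner_L2 u (\<eta> s)) (at s within {0..t0})"
  proof (rule LIM_zero_cancel, rule Lim_null_comparison)
    show "\<forall>\<^sub>F t in at s within {0..t0}. norm (cinner_L2 u (\<eta> t) - cinner_L2 u (\<eta> s)) \<le> norm u * sqrt \<bar>t - s\<bar>"
      using cinner_chi_diff_le[OF s] by (auto simp: eventually_at_filter)
    have "((\<lambda>t. norm u * sqrt \<bar>t - s\<bar>) \<longlongrightarrow> norm u * sqrt \<bar>s - s\<bar>) (at s within {0..t0})"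
      by (intro tendsto_intros)
    then show "((\<lambda>t. norm u * sqrt \<bar>t - s\<bar>) \<longlongrightarrow> 0) (at s within {0..t0})" by simp
  qed
qed

lemma L2_fun_cinner_chi: "L2_fun I (\<lambda>t. cinner_L2 u (\<eta> t))"
  by (rule L2_fun_continuous[OF continuous_on_cinner_chi])

lemma prim_restr [simp]: "V (P u) = V u"
  unfolding prim_def chi_def by (simp add: cinner_emb_right[OF L2_fun_chi, of u, symmetric])

lemma restr_prim [simp]: "P (V u) = V u"
  unfolding prim_def by (rule restr_emb[OF L2_fun_cinner_chi])

lemma prim_emb: "L2_fun I f \<Longrightarrow> V (emb t0 f) = emb t0 (\<lambda>t. LINT s:{0<..<t}|lborel. f s)"
  unfolding prim_def by (intro emb_cong cinner_chi) auto

lemma norm_prim_le: "norm (V u) \<le> t0 * norm u"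
proof -
  have "norm (V u) \<le> (norm u * sqrt t0) * sqrt t0" unfolding prim_def
    using t0 by (intro norm_emb_le L2_fun_cinner_chi norm_cinner_chi_le) auto
  also have "\<dots> = t0 * norm u" using t0 by (simp add: mult.assoc)
  finally show ?thesis .
qed

lemma cblinear_prim: "cblinear V"
proof (rule cblinearI)
  show "V (u + v) = V u + V v" for u v unfolding prim_def
    by (simp add: emb_add L2_fun_cinner_chi cinner_add_left)
  show "V (cscale c u) = cscale c (V u)" for c u unfolding prim_def
    by (simp add: emb_cscale L2_fun_cinner_chi)
qed (rule norm_prim_le)

text \<open>Each application of $V$ gains a factor $t/n$ in the pointwise bound, so $V$ is
  quasi-nilpotent.\<close>

lemma norm_prim_funpow_le: "norm ((V ^^ Suc n) u) \<le> t0 * (t0 ^ n / fact n) * norm u"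
proof -
  have pw: "norm (cinner_L2 ((V ^^ n) u) (\<eta> t)) \<le> (norm u * sqrt t0) * (t ^ n / fact n)"
    if "t \<in> {0..t0}" for t n using that
  proof (induction n arbitrary: t)
    case 0
    then show ?case using norm_cinner_chi_le[OF 0, of u] by simp
  next
    case (Suc n)
    let ?w = "\<lambda>s. cinner_L2 ((V ^^ n) u) (\<eta> s)"
    have sub: "{0<..<t} \<subseteq> I" using Suc.prems by auto
    have "norm (cinner_L2 ((V ^^ Suc n) u) (\<eta> t)) = norm (LINT s:{0<..<t}|lborel. ?w s)"
      using Suc.prems cinner_chi[OF L2_fun_cinner_chi, of t "(V ^^ n) u"] by (simp add: prim_def)
    also have "\<dots> \<le> (LINT s:{0<..<t}|lborel. norm (?w s))"
      by (rule set_integral_norm_bound, rule L2_fun_integrable, rule L2_fun_subset[OF L2_fun_cinner_chi _ sub])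
         auto
    also have "\<dots> \<le> (LINT s:{0<..<t}|lborel. ((norm u * sqrt t0) / fact n) * s ^ n)"
    proof (rule set_integral_mono)
      show "set_integrable lborel {0<..<t} (\<lambda>s. norm (?w s))"
        by (rule set_integrable_norm, rule L2_fun_integrable, rule L2_fun_subset[OF L2_fun_cinner_chi _ sub])
           auto
      show "set_integrable lborel {0<..<t} (\<lambda>s. ((norm u * sqrt t0) / fact n) * s ^ n)"
        by (rule set_integrable_subset[OF borel_integrable_atLeastAtMost'[of 0 t]]) (auto intro!: continuous_intros)
      show "norm (?w s) \<le> ((norm u * sqrt t0) / fact n) * s ^ n" if "s \<in> {0<..<t}" for s
        using Suc.IH[of s] that Suc.prems by simp
    qed
    also have "\<dots> = ((norm u * sqrt t0) / fact n) * (t ^ Suc n / Suc n)"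
      using LINT_power[of t n] Suc.prems by simp
    finally show ?case by (simp add: field_simps)
  qed
  have "norm ((V ^^ Suc n) u) \<le> ((norm u * sqrt t0) * (t0 ^ n / fact n)) * sqrt t0"
    unfolding funpow.simps o_def prim_def[of _ "(V ^^ n) u"]
  proof (rule norm_emb_le[OF L2_fun_cinner_chi])
    fix t assume t: "t \<in> I"
    have "norm (cinner_L2 ((V ^^ n) u) (\<eta> t)) \<le> (norm u * sqrt t0) * (t ^ n / fact n)" using t by (intro pw) auto
    also have "\<dots> \<le> (norm u * sqrt t0) * (t0 ^ n / fact n)"
      using t by (intro mult_left_mono divide_right_mono power_mono) auto
    finally show "norm (cinner_L2 ((V ^^ n) u) (\<eta> t)) \<le> (norm u * sqrt t0) * (t0 ^ n / fact n)" .
  qed (use t0 in auto)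
  also have "\<dots> = (sqrt t0 * sqrt t0) * (t0 ^ n / fact n) * norm u" by (simp only: mult_ac)
  finally show ?thesis using t0 by simp
qed

text \<open>The primitives of a bounded sequence are equicontinuous by the Hoelder bound; the theorem of Arzela
  and Ascoli gives uniform, hence $L^2$, convergence along a subsequence.\<close>

lemma compact_operator_prim: "compact_operator V"
  unfolding compact_operator_def
proof (intro allI impI)
  fix x :: "nat \<Rightarrow> L2"
  assume "bounded (range x)"
  then obtain M where M: "\<And>n. norm (x n) \<le> M" by (auto simp: bounded_iff)
  have M0: "0 \<le> M" using M[of 0] norm_ge_zero order_trans by blast
  let ?F = "\<lambda>n t. cinner_L2 (x n) (\<eta> t)"
  obtain g k where g: "continuous_on {0..t0} g" "strict_mono (k :: nat \<Rightarrow> nat)"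
    "\<And>e. 0 < e \<Longrightarrow> \<exists>N. \<forall>n t. n \<ge> N \<and> t \<in> {0..t0} \<longrightarrow> norm (?F (k n) t - g t) < e"
  proof (rule Arzela_Ascoli[of "{0..t0}" ?F "M * sqrt t0"])
    show "norm (?F n t) \<le> M * sqrt t0" if "t \<in> {0..t0}" for n t
      by (rule order_trans[OF norm_cinner_chi_le[OF that] mult_right_mono[OF M]]) (use t0 in simp)
    show "\<exists>d. 0 < d \<and> (\<forall>n s. s \<in> {0..t0} \<and> norm (t - s) < d \<longrightarrow> norm (?F n t - ?F n s) < e)"
      if "t \<in> {0..t0}" "0 < e" for t e
    proof (intro exI conjI allI impI)
      define d where "d = (e / (M + 1))\<^sup>2"
      show "0 < d" using that M0 by (simp add: d_def)
      fix n s assume s: "s \<in> {0..t0} \<and> norm (t - s) < d"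
      have "norm (?F n t - ?F n s) \<le> norm (x n) * sqrt \<bar>t - s\<bar>" using s that by (intro cinner_chi_diff_le) auto
      also have "\<dots> \<le> M * sqrt \<bar>t - s\<bar>" by (intro mult_right_mono M) auto
      also have "\<dots> \<le> M * sqrt d" using s by (intro mult_left_mono M0) auto
      also have "\<dots> = M * (e / (M + 1))" using that M0 by (simp add: d_def)
      also have "\<dots> < e" using that M0 by (simp add: field_simps)
      finally show "norm (?F n t - ?F n s) < e" .
    qed
  qed auto
  have "(\<lambda>n. V (x (k n))) \<longlonglongrightarrow> emb t0 g"
  proof (rule metric_LIMSEQ_I)
    fix e :: real assume e: "0 < e"
    define e' where "e' = e / (sqrt t0 + 1)"
    have s1: "0 < sqrt t0 + 1" using t0 by (simp add: add_nonneg_pos)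
    have e': "0 < e'" unfolding e'_def using e s1 by simp
    then obtain N where N: "\<And>n t. n \<ge> N \<Longrightarrow> t \<in> {0..t0} \<Longrightarrow> norm (?F (k n) t - g t) < e'" using g(3) by blast
    have "dist (V (x (k n))) (emb t0 g) < e" if "n \<ge> N" for n
    proof -
      have "V (x (k n)) - emb t0 g = emb t0 (\<lambda>t. ?F (k n) t + (-1) * g t)"
        unfolding minus_L2_def prim_def
        by (subst emb_cscale[OF L2_fun_continuous[OF g(1)]],
            subst emb_add[OF L2_fun_cinner_chi L2_fun_cmult[OF L2_fun_continuous[OF g(1)]]]) simp
      moreover have "norm \<dots> \<le> e' * sqrt t0"
        using t0 e' N[OF that]
        by (intro norm_emb_le L2_fun_add L2_fun_cmult L2_fun_cinner_chi L2_fun_continuous g(1)) (auto intro: less_imp_le)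
      moreover have "e' * sqrt t0 < e" unfolding e'_def using e s1 by (simp add: field_simps)
      ultimately show ?thesis by (simp add: dist_norm)
    qed
    then show "\<exists>N. \<forall>n\<ge>N. dist (V (x (k n))) (emb t0 g) < e" by blast
  qed
  then show "\<exists>l r. strict_mono r \<and> (\<lambda>n. V (x (r n))) \<longlonglongrightarrow> l" using g(2) by blast
qed

abbreviation "one \<equiv> emb t0 (\<lambda>_. 1)"

lemma L2_fun_const: "L2_fun I (\<lambda>_. c)"
  by (rule L2_fun_continuous) (rule continuous_on_const)

lemma restr_one [simp]: "P one = one"
  by (rule restr_emb[OF L2_fun_const])

lemma refl_one [simp]: "J one = one"
  by (simp add: refl_emb[OF L2_fun_const])

text \<open>By Fubini on the triangle $s < t$, the adjoint of $V$ integrates from $t$ to $t_0$; that is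
  integration from $0$ conjugated by the reflection.\<close>

lemma prim_adjoint: "cinner_L2 (V u) v = cinner_L2 u (J (V (J v)))"
proof -
  let ?f = "rep_L2 u" and ?g = "rep_L2 v"
  define F where "F x = indicator I x *\<^sub>R ?f x" for x
  define G where "G x = indicator I x *\<^sub>R ?g x" for x
  have iF: "integrable lborel F" and iG: "integrable lborel G"
    using L2_fun_integrable[OF L2_fun_rep_I] unfolding F_def G_def set_integrable_def by auto
  have [measurable]: "F \<in> borel_measurable borel" "G \<in> borel_measurable borel"
    using iF iG by auto
  have [measurable]: "cnj \<in> borel_measurable borel"
    by (intro borel_measurable_continuous_onI continuous_intros)
  have int: "integrable (lborel \<Otimes>\<^sub>M lborel) (\<lambda>(s, t). indicator {(s, t). s < t} (s, t) *\<^sub>R (F s * cnj (G t)))"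
  proof -
    have "integrable (lborel \<Otimes>\<^sub>M lborel) (\<lambda>p. F (fst p) * cnj (G (snd p)))"
    proof (rule lborel_pair.Fubini_integrable)
      show "integrable lborel (\<lambda>x. LBINT y. norm (F (fst (x, y)) * cnj (G (snd (x, y)))))"
        using iF iG by (simp add: norm_mult)
      show "AE x in lborel. integrable lborel (\<lambda>y. F (fst (x, y)) * cnj (G (snd (x, y))))"
        using iG by simp
    qed measurable
    then have "integrable (lborel \<Otimes>\<^sub>M lborel) (\<lambda>p. indicator {(s, t). s < t} p *\<^sub>R (F (fst p) * cnj (G (snd p))))"
    proof (rule integrable_mult_indicator[rotated])
      have "{p \<in> space (lborel \<Otimes>\<^sub>M lborel). fst p < (snd p :: real)} \<in> sets (lborel \<Otimes>\<^sub>M lborel)" by measurable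
      then show "{(s, t). s < (t :: real)} \<in> sets (lborel \<Otimes>\<^sub>M lborel)"
        by (simp add: space_pair_measure case_prod_beta')
    qed
    then show ?thesis by (simp add: case_prod_beta')
  qed
  have "cinner_L2 (V u) v = cinner_L2 (V u) (P v)" using restr_sym[of "V u" v] by simp
  also have "\<dots> = (LINT t:I|lborel. cinner_L2 u (\<eta> t) * cnj (?g t))"
    unfolding prim_def restr_def by (rule cinner_emb[OF L2_fun_cinner_chi L2_fun_rep_I])
  also have "\<dots> = (LBINT t. LBINT s. indicator {(s, t). s < t} (s, t) *\<^sub>R (F s * cnj (G t)))"
    unfolding set_lebesgue_integral_def
  proof (rule Bochner_Integration.integral_cong[OF refl])
    fix t
    show "indicator I t *\<^sub>R (cinner_L2 u (\<eta> t) * cnj (?g t)) =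
      (LBINT s. indicator {(s, t). s < t} (s, t) *\<^sub>R (F s * cnj (G t)))"
    proof (cases "t \<in> I")
      case True
      have "cinner_L2 u (\<eta> t) = (LINT s:{0<..<t}|lborel. ?f s)"
        using cinner_emb_right[OF L2_fun_chi, of u t] cinner_chi[OF L2_fun_rep_I, of t u] True
        by (simp add: chi_def restr_def)
      also have "\<dots> = (LBINT s. indicator {(s, t). s < t} (s, t) *\<^sub>R F s)"
        unfolding set_lebesgue_integral_def F_def using True
        by (intro Bochner_Integration.integral_cong) (auto simp: indicator_def)
      finally have "cinner_L2 u (\<eta> t) * cnj (?g t)
          = (LBINT s. (indicator {(s, t). s < t} (s, t) *\<^sub>R F s) * cnj (?g t))"
        by (simp only: integral_mult_left_zero)
      then show ?thesis using True unfolding G_def by simp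
    qed (simp add: G_def)
  qed
  also have "\<dots> = (LBINT s. LBINT t. indicator {(s, t). s < t} (s, t) *\<^sub>R (F s * cnj (G t)))"
    by (rule lborel_pair.Fubini_integral[OF int])
  also have "\<dots> = (LINT s:I|lborel. ?f s * cnj (LINT r:{0<..<t0 - s}|lborel. ?g (t0 - r)))"
    unfolding set_lebesgue_integral_def
  proof (rule Bochner_Integration.integral_cong[OF refl])
    fix s
    show "(LBINT t. indicator {(s, t). s < t} (s, t) *\<^sub>R (F s * cnj (G t))) =
      indicator I s *\<^sub>R (?f s * cnj (LBINT r. indicator {0<..<t0 - s} r *\<^sub>R ?g (t0 - r)))"
    proof (cases "s \<in> I")
      case True
      have "(LBINT r. indicator {0<..<t0 - s} r *\<^sub>R ?g (t0 - r))
        = \<bar>-1\<bar> *\<^sub>R (LBINT t. indicator {0<..<t0 - s} (t0 + (-1) * t) *\<^sub>R ?g (t0 - (t0 + (-1) * t)))"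
        by (rule lborel_integral_real_affine) simp
      also have "\<dots> = (LBINT t. indicator {(s, t). s < t} (s, t) *\<^sub>R G t)"
        unfolding G_def using True by (simp, intro Bochner_Integration.integral_cong) (auto simp: indicator_def)
      finally have eq: "(LBINT r. indicator {0<..<t0 - s} r *\<^sub>R ?g (t0 - r)) = (LBINT t. indicator {(s, t). s < t} (s, t) *\<^sub>R G t)" .
      have "(LBINT t. indicator {(s, t). s < t} (s, t) *\<^sub>R (F s * cnj (G t)))
          = (LBINT t. F s * cnj (indicator {(s, t). s < t} (s, t) *\<^sub>R G t))" by simp
      also have "\<dots> = F s * cnj (LBINT t. indicator {(s, t). s < t} (s, t) *\<^sub>R G t)"
        by (simp only: integral_mult_right_zero Bochner_Integration.integral_cnj)
      finally show ?thesis unfolding eq using True by (simp add: F_def)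
    qed (simp add: F_def)
  qed
  also have "\<dots> = cinner_L2 (P u) (J (V (J v)))"
  proof -
    have V: "V (J v) = emb t0 (\<lambda>t. LINT s:{0<..<t}|lborel. ?g (t0 - s))"
      unfolding refl_def by (rule prim_emb[OF L2_fun_refl[OF L2_fun_rep_I]])
    have eq: "cinner_L2 (J v) (\<eta> t) = (LINT s:{0<..<t}|lborel. ?g (t0 - s))" if "t \<in> I" for t
      unfolding refl_def using that by (intro cinner_chi[OF L2_fun_refl[OF L2_fun_rep_I]]) auto
    have JV: "J (V (J v)) = emb t0 (\<lambda>s. cinner_L2 (J v) (\<eta> (t0 - s)))"
      unfolding prim_def by (rule refl_emb[OF L2_fun_cinner_chi])
    have "cinner_L2 (P u) (J (V (J v))) = (LINT s:I|lborel. ?f s * cnj (cinner_L2 (J v) (\<eta> (t0 - s))))"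
      unfolding JV restr_def by (rule cinner_emb[OF L2_fun_rep_I L2_fun_refl[OF L2_fun_cinner_chi]])
    also have "\<dots> = (LINT s:I|lborel. ?f s * cnj (LINT r:{0<..<t0 - s}|lborel. ?g (t0 - r)))"
      by (rule set_lebesgue_integral_cong) (auto simp: eq)
    finally show ?thesis by simp
  qed
  finally show ?thesis using restr_sym[of u "J (V (J v))"] by simp
qed

lemma LINT_Ioo_eq_integral:
  fixes b :: "real \<Rightarrow> complex"
  assumes "0 \<le> t" "continuous_on {0..t} b"
  shows "(LINT s:{0<..<t}|lborel. b s) = integral {0..t} b"
proof -
  have "(LINT s:{0<..<t}|lborel. b s) = (LINT s:{0..t}|lborel. b s)"
    using interval_integral_Ioo[of 0 "ereal t" b] interval_integral_Icc[of 0 t b] assms(1) by (simp add: zero_ereal_def)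
  also have "\<dots> = integral {0..t} b"
    by (rule set_borel_integral_eq_integral) (rule borel_integrable_atLeastAtMost'[OF assms(2)])
  finally show ?thesis .
qed

lemma cinner_chi_has_derivative:
  assumes "continuous_on {0..t0} b" "t \<in> {0..t0}"
  shows "((\<lambda>t. cinner_L2 (emb t0 b) (\<eta> t)) has_vector_derivative b t) (at t within {0..t0})"
proof (rule has_vector_derivative_transform[OF assms(2)])
  show "((\<lambda>t. integral {0..t} b) has_vector_derivative b t) (at t within {0..t0})"
    by (rule integral_has_vector_derivative[OF assms])
  show "cinner_L2 (emb t0 b) (\<eta> s) = integral {0..s} b" if "s \<in> {0..t0}" for s
    using that cinner_chi[OF L2_fun_continuous[OF assms(1)], of s]
      LINT_Ioo_eq_integral[of s b] continuous_on_subset[OF assms(1), of "{0..s}"] by simp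
qed

text \<open>The fundamental theorem of calculus $B(t) = B(0) + \int_0^t B'$ as an identity in $L^2$.\<close>

lemma emb_primitive:
  assumes b: "continuous_on {0..t0} b"
    and B: "\<And>t. t \<in> {0..t0} \<Longrightarrow> (B has_vector_derivative b t) (at t within {0..t0})"
  shows "emb t0 B = cscale (B 0) one + V (emb t0 b)"
proof -
  have "cscale (B 0) one + V (emb t0 b) = emb t0 (\<lambda>t. B 0 * 1 + cinner_L2 (emb t0 b) (\<eta> t))"
    unfolding prim_def by (simp add: emb_cscale[OF L2_fun_const] emb_add[OF L2_fun_const L2_fun_cinner_chi])
  also have "\<dots> = emb t0 B"
  proof (rule emb_cong)
    fix t assume t: "t \<in> I"
    have "cinner_L2 (emb t0 b) (\<eta> t) = (LINT s:{0<..<t}|lborel. b s)"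
      using t by (intro cinner_chi L2_fun_continuous b) auto
    also have "\<dots> = B t - B 0" using t
      by (intro LINT_FTC continuous_on_subset[OF b] has_vector_derivative_within_subset[OF B]) auto
    finally show "B 0 * 1 + cinner_L2 (emb t0 b) (\<eta> t) = B t" by simp
  qed
  finally show ?thesis by simp
qed

lemma compact_operator_funpow_prim: "0 < n \<Longrightarrow> cblinear A \<Longrightarrow> compact_operator (\<lambda>u. (V ^^ n) (A u))"
proof -
  assume n: "0 < n" and A: "cblinear A"
  then obtain m where m: "n = Suc m" using gr0_conv_Suc by blast
  have "bounded_linear (\<lambda>u. (V ^^ m) (A u))"
    by (intro cblinear_bounded_linear cblinear_compose[OF cblinear_funpow[OF cblinear_prim] A])
  from compact_operator_compose_right[OF compact_operator_prim this] show ?thesis by (simp add: m)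
qed

text \<open>Powers of $VR$ factor as $V^nR^n$, so the quasi-nilpotency of $V$ makes the Neumann series of
  $1 - VR$ converge whatever the norm of $R$ is.\<close>

lemma volterra_solution:
  assumes R: "cblinear R" and comm: "\<And>u. R (V u) = V (R u)"
  obtains C where "\<And>w. \<exists>!y. y - V (R y) = w" "\<And>y. norm y \<le> C * norm (y - V (R y))"
proof -
  define A where "A = (\<lambda>u. V (R u))"
  obtain r where r: "0 < r" "\<And>u. norm (R u) \<le> r * norm u" using cblinear_bound[OF R] by blast
  have Vn: "V ((R ^^ n) u) = (R ^^ n) (V u)" for n u by (induction n) (simp_all add: comm[symmetric])
  have pow: "(A ^^ n) u = (V ^^ n) ((R ^^ n) u)" for n u
  proof (induction n)
    case (Suc n)
    have "R ((V ^^ n) w) = (V ^^ n) (R w)" for n w by (induction n) (simp_all add: comm)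
    then show ?case using Suc by (simp add: A_def)
  qed simp
  define q where "q n = (case n of 0 \<Rightarrow> 1 | Suc n \<Rightarrow> (t0 * r) * ((t0 * r) ^ n / fact n))" for n
  have "summable (\<lambda>n. q (Suc n))"
    unfolding q_def using summable_exp[of "t0 * r"] by (simp add: summable_mult divide_inverse mult.commute)
  then have q: "summable q" by (simp add: summable_Suc_iff)
  have qb: "norm ((A ^^ n) u) \<le> q n * norm u" for n u
  proof (cases n)
    case (Suc m)
    have "norm ((A ^^ n) u) \<le> t0 * (t0 ^ m / fact m) * norm ((R ^^ n) u)"
      unfolding pow Suc by (rule norm_prim_funpow_le)
    also have "\<dots> \<le> t0 * (t0 ^ m / fact m) * (r ^ n * norm u)"
      using t0 r by (intro mult_left_mono norm_funpow_le) auto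
    also have "\<dots> = q n * norm u" by (simp add: q_def Suc power_mult_distrib)
    finally show ?thesis .
  qed (simp add: q_def)
  have A: "bounded_linear A" unfolding A_def
    by (intro cblinear_bounded_linear cblinear_compose[OF cblinear_prim R])
  have cpt: "compact_operator A" unfolding A_def
    by (rule compact_operator_compose_right[OF compact_operator_prim cblinear_bounded_linear[OF R]])
  have sol: "(\<exists>!y. y - V (R y) = w) \<and> (\<forall>y. y - V (R y) = w \<longrightarrow> norm y \<le> suminf q * norm w)" for w
  proof (rule neumann_series[OF A cpt q qb, of w])
    fix y assume y: "y - A y = w" "norm y \<le> suminf q * norm w" "\<And>y'. y' - A y' = w \<Longrightarrow> y' = y"
    have eq: "y' - V (R y') = w \<longleftrightarrow> y' = y" for y' using y(1,3) unfolding A_def by blast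
    show ?thesis unfolding eq using y(2) by simp
  qed
  show thesis
  proof (rule that[of "suminf q"])
    show "\<exists>!y. y - V (R y) = w" for w using sol[of w] by (rule conjunct1)
    show "norm y \<le> suminf q * norm (y - V (R y))" for y
      using sol[of "y - V (R y)", THEN conjunct2, THEN spec, of y] by (rule mp) (rule refl)
  qed
qed

end

section \<open>The compact inverse of the Hankel operator\<close>

locale hankel = interval +
  fixes K :: nat and h :: "nat \<Rightarrow> real"
  assumes K: "1 \<le> K" and hK: "h K \<noteq> 0"
begin

definition coef :: "nat \<Rightarrow> real" where "coef k = (- 1) ^ k * h k"

lemma coef_K: "coef K \<noteq> 0" using hK by (simp add: coef_def)

text \<open>For $u = V^K y$ this is the differential expression $\sum_k (-1)^k h_k u^{(k)}$ in terms of
  $y = u^{(K)}$.\<close>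

definition D :: "L2 \<Rightarrow> L2" where "D y = (\<Sum>k\<le>K. coef k *\<^sub>R (V ^^ (K - k)) y)"

text \<open>The lower order terms: with this operator $D = (-1)^K h_K (1 - VR)$.\<close>

definition R :: "L2 \<Rightarrow> L2" where "R y = (\<Sum>k<K. (- coef k / coef K) *\<^sub>R (V ^^ (K - Suc k)) y)"

lemma cblinear_R: "cblinear R"
  unfolding R_def[abs_def] by (intro cblinear_Sum cblinear_scaleR cblinear_funpow cblinear_prim)

lemma prim_scaleR: "V (r *\<^sub>R u) = r *\<^sub>R V u"
  by (simp add: scaleR_eq_cscale cblinear_cscale[OF cblinear_prim])

lemma R_prim: "R (V u) = V (R u)"
  unfolding R_def cblinear_sum[OF cblinear_prim] prim_scaleR by (simp flip: funpow_swap1)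

lemma D_eq: "D y = coef K *\<^sub>R (y - V (R y))"
proof -
  have "coef K *\<^sub>R V (R y) = (\<Sum>k<K. - (coef k *\<^sub>R (V ^^ (K - k)) y))"
    unfolding R_def cblinear_sum[OF cblinear_prim] prim_scaleR scaleR_sum_right
  proof (rule sum.cong[OF refl])
    fix k assume "k \<in> {..<K}"
    then have "K - k = Suc (K - Suc k)" by auto
    then show "coef K *\<^sub>R (- coef k / coef K) *\<^sub>R V ((V ^^ (K - Suc k)) y) = - (coef k *\<^sub>R (V ^^ (K - k)) y)"
      using coef_K by simp
  qed
  moreover have "D y = coef K *\<^sub>R y + (\<Sum>k<K. coef k *\<^sub>R (V ^^ (K - k)) y)"
    unfolding D_def by (simp flip: lessThan_Suc_atMost)
  ultimately show ?thesis by (simp add: scaleR_right_diff_distrib sum_negf)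
qed

lemma cblinear_D: "cblinear D"
  unfolding D_def[abs_def] by (intro cblinear_Sum cblinear_scaleR cblinear_funpow cblinear_prim)

lemma D_bij: "bij D" and D_bounded_below: "\<exists>C. \<forall>y. norm y \<le> C * norm (D y)"
proof -
  obtain C where C: "\<And>w. \<exists>!y. y - V (R y) = w" "\<And>y. norm y \<le> C * norm (y - V (R y))"
    using volterra_solution[OF cblinear_R R_prim] by blast
  have eq: "D y = w \<longleftrightarrow> y - V (R y) = (1 / coef K) *\<^sub>R w" for y w
    unfolding D_eq using coef_K by auto
  have "\<exists>!y. D y = w" for w unfolding eq by (rule C(1))
  then show "bij D" unfolding bij_iff by auto
  have "norm y \<le> (C / \<bar>coef K\<bar>) * norm (D y)" for y
    using C(2)[of y] coef_K unfolding D_eq by simp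
  then show "\<exists>C. \<forall>y. norm y \<le> C * norm (D y)" by blast
qed

definition Y :: "L2 \<Rightarrow> L2" where "Y = inv D"

lemma D_Y [simp]: "D (Y w) = w" and Y_D [simp]: "Y (D y) = y"
  unfolding Y_def using D_bij by (simp_all add: bij_is_surj surj_f_inv_f bij_is_inj)

lemma cblinear_Y: "cblinear Y"
proof -
  obtain C where C: "\<And>y. norm y \<le> C * norm (D y)" using D_bounded_below by blast
  show ?thesis
  proof (rule cblinearI)
    show "Y (u + v) = Y u + Y v" for u v
      by (metis cblinear_add[OF cblinear_D] D_Y Y_D)
    show "Y (cscale c u) = cscale c (Y u)" for c u
      by (metis cblinear_cscale[OF cblinear_D] D_Y Y_D)
    show "norm (Y u) \<le> C * norm u" for u using C[of "Y u"] by simp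
  qed
qed

text \<open>If $f = V^Ky$ is a function on $(0,t_0)$ with $f^{(j)}(0) = 0$ for $j < K$, and $g = Hf$, then $Jg = Dy$;
  so $f = Tg$.\<close>

definition T :: "L2 \<Rightarrow> L2" where "T u = (V ^^ K) (Y (J u))"

lemma cblinear_T: "cblinear T"
  unfolding T_def[abs_def]
  by (rule cblinear_compose[OF cblinear_funpow[OF cblinear_prim] cblinear_compose[OF cblinear_Y cblinear_refl]])

lemma compact_operator_T: "compact_operator T"
  unfolding T_def[abs_def] using K
  by (intro compact_operator_funpow_prim[OF _ cblinear_compose[OF cblinear_Y cblinear_refl]]) simp

lemma restr_funpow: "0 < n \<Longrightarrow> P ((V ^^ n) u) = (V ^^ n) u"
  by (cases n) auto

lemma restr_T [simp]: "P (T u) = T u"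
  unfolding T_def using K by (intro restr_funpow) auto

lemma T_restr [simp]: "T (P u) = T u"
  unfolding T_def by simp

lemma restr_scaleR: "P (r *\<^sub>R u) = r *\<^sub>R P u"
  by (simp add: scaleR_eq_cscale cblinear_cscale[OF cblinear_restr])

lemma refl_scaleR: "J (r *\<^sub>R u) = r *\<^sub>R J u"
  by (simp add: scaleR_eq_cscale cblinear_cscale[OF cblinear_refl])

lemma restr_D: assumes "P y = y" shows "P (D y) = D y"
proof -
  have "P ((V ^^ n) y) = (V ^^ n) y" for n using assms by (cases n) auto
  then show ?thesis unfolding D_def cblinear_sum[OF cblinear_restr] restr_scaleR by simp
qed

lemma restr_eq_if_D: assumes "P (D y) = D y" shows "P y = y"
proof -
  have "y = (1 / coef K) *\<^sub>R D y + V (R y)" unfolding D_eq using coef_K by simp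
  moreover have "P ((1 / coef K) *\<^sub>R D y + V (R y)) = (1 / coef K) *\<^sub>R D y + V (R y)"
    by (simp add: cblinear_add[OF cblinear_restr] restr_scaleR assms)
  ultimately show ?thesis by simp
qed

lemma restr_Y: "P w = w \<Longrightarrow> P (Y w) = Y w"
  by (rule restr_eq_if_D) simp

text \<open>$V^*$ is $JVJ$, so $JV^a$ has adjoint $V^{*a}J = JV^a$; moving all powers of $V$ to one side
  turns $\langle Tg, g_1\rangle$ and $\langle g, Tg_1\rangle$ into the same expression.\<close>

lemma refl_prim_shift: "cinner_L2 (J ((V ^^ a) u)) ((V ^^ b) v) = cinner_L2 (J ((V ^^ (a + b)) u)) v"
proof (induction b arbitrary: a)
  case (Suc b)
  have "cinner_L2 x (V z) = cinner_L2 (J (V (J x))) z" for x z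
    using prim_adjoint[of z x] by (metis cinner_cnj)
  then have "cinner_L2 (J ((V ^^ a) u)) ((V ^^ Suc b) v) = cinner_L2 (J ((V ^^ Suc a) u)) ((V ^^ b) v)" by simp
  also have "\<dots> = cinner_L2 (J ((V ^^ (Suc a + b)) u)) v" by (rule Suc.IH)
  finally show ?case by simp
qed simp

lemma T_sym: "cinner_L2 (T g) g' = cinner_L2 g (T g')"
proof -
  define y y' where "y = Y (J g)" and "y' = Y (J g')"
  have g: "P g = J (D y)" "P g' = J (D y')" unfolding y_def y'_def by simp_all
  have "cinner_L2 (T g) g' = cinner_L2 (T g) (P g')" using restr_sym[of "T g" g'] by simp
  also have "\<dots> = cinner_L2 (J ((V ^^ K) y)) (D y')"
    unfolding g(2) T_def refl_sym[symmetric] y_def ..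
  also have "\<dots> = (\<Sum>k\<le>K. coef k * cinner_L2 (J ((V ^^ (K + (K - k))) y)) y')"
    unfolding D_def cinner_sum_right cinner_scaleR_right refl_prim_shift ..
  also have "\<dots> = (\<Sum>k\<le>K. coef k * cinner_L2 (J ((V ^^ (K - k)) y)) ((V ^^ K) y'))"
    unfolding refl_prim_shift by (simp add: add.commute)
  also have "\<dots> = cinner_L2 (J (D y)) ((V ^^ K) y')"
    unfolding D_def cblinear_sum[OF cblinear_refl] refl_scaleR cinner_sum_left cinner_scaleR_left ..
  also have "\<dots> = cinner_L2 (P g) (T g')" unfolding g(1) T_def y'_def ..
  also have "\<dots> = cinner_L2 g (T g')" using restr_sym[of g "T g'"] by simp
  finally show ?thesis .
qed

end

section \<open>Bump functions\<close>

text \<open>A sequence of successive derivatives is easier to exhibit than differentiability of all iterates of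
  \<^const>\<open>deriv\<close>; \<open>test_function_iff\<close> connects the two.\<close>

definition smooth :: "(real \<Rightarrow> real) \<Rightarrow> bool"
  where "smooth f \<longleftrightarrow> (\<exists>d. d 0 = f \<and> (\<forall>k x. (d k has_real_derivative d (Suc k) x) (at x)))"

text \<open>Reduces smoothness to membership in a class closed under differentiation, which avoids formulas for
  the higher derivatives.\<close>

lemma smooth_in_class:
  assumes "f \<in> F" and step: "\<And>g. g \<in> F \<Longrightarrow> \<exists>g'\<in>F. \<forall>x. (g has_real_derivative g' x) (at x)"
  shows "smooth f"
proof -
  obtain d where d: "\<And>g. g \<in> F \<Longrightarrow> d g \<in> F \<and> (\<forall>x. (g has_real_derivative d g x) (at x))"
    using step by metis
  have "(d ^^ k) f \<in> F" for k by (induction k) (use d assms(1) in auto)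
  then show ?thesis unfolding smooth_def using d by (intro exI[of _ "\<lambda>k. (d ^^ k) f"]) auto
qed

lemma funpow_deriv_eq:
  assumes "d 0 = f" "\<And>k x. (d k has_real_derivative d (Suc k) x) (at x)"
  shows "(deriv ^^ k) f = d k"
proof (induction k)
  case (Suc k)
  have "(deriv ^^ Suc k) f = deriv (d k)" using Suc by simp
  also have "\<dots> = d (Suc k)" using assms(2)[THEN DERIV_imp_deriv] by blast
  finally show ?case .
qed (use assms in simp)

lemma smooth_funpow_deriv:
  assumes "smooth f"
  shows "((deriv ^^ k) f has_real_derivative (deriv ^^ Suc k) f x) (at x)"
proof -
  obtain d where d: "d 0 = f" "\<And>k x. (d k has_real_derivative d (Suc k) x) (at x)"
    using assms unfolding smooth_def by blast
  show ?thesis using d(2)[of k x] unfolding funpow_deriv_eq[OF d] .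
qed

lemma test_function_iff:
  "test_function S f \<longleftrightarrow> smooth f \<and> (\<exists>C. compact C \<and> C \<subseteq> S \<and> (\<forall>x. x \<notin> C \<longrightarrow> f x = 0))"
proof
  assume f: "test_function S f"
  then have "((deriv ^^ k) f has_real_derivative (deriv ^^ Suc k) f x) (at x)" for k x
    unfolding test_function_def by (simp add: DERIV_deriv_iff_field_differentiable)
  then have "smooth f" unfolding smooth_def by (intro exI[of _ "\<lambda>k. (deriv ^^ k) f"]) auto
  then show "smooth f \<and> (\<exists>C. compact C \<and> C \<subseteq> S \<and> (\<forall>x. x \<notin> C \<longrightarrow> f x = 0))"
    using f unfolding test_function_def by blast
next
  assume "smooth f \<and> (\<exists>C. compact C \<and> C \<subseteq> S \<and> (\<forall>x. x \<notin> C \<longrightarrow> f x = 0))"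
  then show "test_function S f"
    unfolding test_function_def using smooth_funpow_deriv field_differentiable_def by blast
qed

lemma smooth_add: assumes "smooth f" "smooth g" shows "smooth (\<lambda>x. f x + c * g x)"
proof -
  obtain d e where "d 0 = f" "\<And>k x. (d k has_real_derivative d (Suc k) x) (at x)"
    "e 0 = g" "\<And>k x. (e k has_real_derivative e (Suc k) x) (at x)"
    using assms unfolding smooth_def by blast
  then show ?thesis unfolding smooth_def
    by (intro exI[of _ "\<lambda>k x. d k x + c * e k x"]) (auto intro!: derivative_eq_intros)
qed

lemma smooth_antiderivative:
  assumes "smooth f" "\<And>x. (F has_real_derivative f x) (at x)"
  shows "smooth F"
proof -
  obtain d where "d 0 = f" "\<And>k x. (d k has_real_derivative d (Suc k) x) (at x)"
    using assms unfolding smooth_def by blast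
  then show ?thesis using assms(2) unfolding smooth_def
    by (intro exI[of _ "\<lambda>k. case k of 0 \<Rightarrow> F | Suc k \<Rightarrow> d k"]) (auto split: nat.split)
qed

lemma smooth_has_derivative: "smooth f \<Longrightarrow> (f has_real_derivative deriv f x) (at x)"
  using smooth_funpow_deriv[of f 0] by simp

lemma smooth_continuous_on: "smooth f \<Longrightarrow> continuous_on S f"
  by (meson DERIV_isCont continuous_at_imp_continuous_on smooth_has_derivative)

text \<open>For $n = 0$ this is the standard example of a smooth function that is flat at $0$; the powers of
  $1/y$ occur in its derivatives.\<close>

definition flat :: "real \<Rightarrow> nat \<Rightarrow> real \<Rightarrow> real"
  where "flat e n y = (if y > 0 then exp (- e / y) / y ^ n else 0)"

text \<open>The series of $\exp(e/y)$ dominates its term of order $n+2$, which beats $1/y^n$ and leaves a factor $y^2$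
  to spare for the derivative at $0$.\<close>

lemma flat_le: assumes "e > 0" shows "\<bar>flat e n y\<bar> \<le> (fact (n + 2) / e ^ (n + 2)) * y\<^sup>2"
proof (cases "y > 0")
  case True
  have "(e / y) ^ (n + 2) / fact (n + 2) \<le> exp (e / y)"
  proof -
    have "(\<Sum>k\<in>{n + 2}. (e / y) ^ k / fact k) \<le> (\<Sum>k. (e / y) ^ k / fact k)"
      using True assms summable_exp[of "e / y"]
      by (intro sum_le_suminf) (auto simp: divide_inverse mult.commute)
    then show ?thesis by (simp add: exp_def divide_inverse mult.commute)
  qed
  moreover define q F :: real where "q = (e / y) ^ (n + 2)" and "F = fact (n + 2)"
  ultimately have "q / F \<le> exp (e / y)" by (simp only:)
  moreover have "q > 0" "F > 0" using True assms by (simp_all add: q_def F_def)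
  ultimately have "exp (- e / y) \<le> F / q" by (simp add: exp_minus field_simps)
  then have "exp (- e / y) \<le> fact (n + 2) / (e / y) ^ (n + 2)" unfolding q_def F_def .
  then have "exp (- e / y) / y ^ n \<le> (fact (n + 2) / (e / y) ^ (n + 2)) / y ^ n"
    using True by (intro divide_right_mono) auto
  also have "\<dots> = (fact (n + 2) / e ^ (n + 2)) * y\<^sup>2"
    using True assms by (simp add: field_simps power2_eq_square)
  finally show ?thesis using True by (simp add: flat_def)
qed (use assms in \<open>simp add: flat_def\<close>)

lemma flat_has_derivative:
  assumes "e > 0"
  shows "(flat e n has_real_derivative e * flat e (n + 2) y - n * flat e (n + 1) y) (at y)"
proof -
  consider "y > 0" | "y < 0" | "y = 0" by linarith
  then show ?thesis
  proof cases
    case 1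
    have "((\<lambda>y. exp (- e / y) / y ^ n) has_real_derivative
        e * (exp (- e / y) / y ^ (n + 2)) - n * (exp (- e / y) / y ^ (n + 1))) (at y)"
    proof -
      have "((\<lambda>y. y ^ n) has_real_derivative real n * (y ^ n / y)) (at y)"
        using DERIV_pow[of n y UNIV] 1 by (cases n) auto
      moreover have "((\<lambda>y. exp (- e / y)) has_real_derivative exp (- e / y) * (e / y\<^sup>2)) (at y)"
        using 1 by (auto intro!: derivative_eq_intros simp: power2_eq_square)
      ultimately have "((\<lambda>y. exp (- e / y) / y ^ n) has_real_derivative (exp (- e / y) * (e / y\<^sup>2) * y ^ n
          - exp (- e / y) * (real n * (y ^ n / y))) / (y ^ n * y ^ n)) (at y)"
        using 1 by (intro DERIV_divide) auto
      then show ?thesis by (rule DERIV_cong) (use 1 in \<open>simp add: field_simps power2_eq_square\<close>)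
    qed
    then have "(flat e n has_real_derivative
        e * (exp (- e / y) / y ^ (n + 2)) - n * (exp (- e / y) / y ^ (n + 1))) (at y)"
      by (rule has_field_derivative_transform_within_open[of _ _ _ "{0<..}"]) (use 1 in \<open>auto simp: flat_def\<close>)
    then show ?thesis using 1 by (simp add: flat_def)
  next
    case 2
    have "(flat e n has_real_derivative 0) (at y)"
      by (rule has_field_derivative_transform_within_open[of "\<lambda>_. 0" _ _ "{..<0}"]) (use 2 in \<open>auto simp: flat_def\<close>)
    then show ?thesis using 2 by (simp add: flat_def)
  next
    case 3
    have "(\<lambda>h. flat e n h / h) \<midarrow>0\<rightarrow> 0"
    proof (rule Lim_null_comparison)
      let ?C = "fact (n + 2) / e ^ (n + 2)"
      have "norm (flat e n h / h) \<le> ?C * \<bar>h\<bar>" if "h \<noteq> 0" for h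
        using flat_le[OF assms, of n h] that by (simp add: power2_eq_square divide_le_eq mult.assoc abs_mult_self_eq)
      then show "\<forall>\<^sub>F h in at 0. norm (flat e n h / h) \<le> ?C * \<bar>h\<bar>"
        unfolding eventually_at_filter by (intro always_eventually) blast
      have "((\<lambda>h. ?C * \<bar>h\<bar>) \<longlongrightarrow> ?C * \<bar>0\<bar>) (at 0)"
        by (rule tendsto_mult[OF tendsto_const tendsto_rabs[OF tendsto_ident_at]])
      then show "((\<lambda>h. ?C * \<bar>h\<bar>) \<longlongrightarrow> 0) (at 0)" by simp
    qed
    moreover have "flat e k 0 = 0" for k by (simp add: flat_def)
    ultimately show ?thesis using 3 unfolding DERIV_def by simp
  qed
qed

text \<open>The algebra generated by the functions \<open>flat e n\<close> and their affine substitutions is closed under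
  differentiation.\<close>

inductive_set flat_algebra :: "real \<Rightarrow> (real \<Rightarrow> real) set" for e where
  const: "(\<lambda>x. c) \<in> flat_algebra e"
| flat: "(\<lambda>x. flat e n (s * x + c)) \<in> flat_algebra e"
| add: "f \<in> flat_algebra e \<Longrightarrow> g \<in> flat_algebra e \<Longrightarrow> (\<lambda>x. f x + g x) \<in> flat_algebra e"
| mult: "f \<in> flat_algebra e \<Longrightarrow> g \<in> flat_algebra e \<Longrightarrow> (\<lambda>x. f x * g x) \<in> flat_algebra e"

lemma flat_algebra_derivative:
  assumes "e > 0" "f \<in> flat_algebra e"
  shows "\<exists>f'\<in>flat_algebra e. \<forall>x. (f has_real_derivative f' x) (at x)"
  using assms(2)
proof induction
  case (const c)
  then show ?case by (intro bexI[of _ "\<lambda>x. 0"]) (auto intro: flat_algebra.const)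
next
  case (flat n s c)
  let ?f' = "\<lambda>x. s * (e * flat e (n + 2) (s * x + c) + (- real n) * flat e (n + 1) (s * x + c))"
  have "?f' \<in> flat_algebra e" by (intro flat_algebra.intros)
  moreover have "((\<lambda>x. flat e n (s * x + c)) has_real_derivative ?f' x) (at x)" for x
  proof -
    have "((\<lambda>x. s * x + c) has_real_derivative s) (at x)" by (auto intro!: derivative_eq_intros)
    from DERIV_chain2[OF flat_has_derivative[OF assms(1)] this] show ?thesis by (simp add: algebra_simps)
  qed
  ultimately show ?case by (intro bexI[of _ ?f'] allI)
next
  case (add f g)
  then obtain f' g' where "f' \<in> flat_algebra e" "g' \<in> flat_algebra e"
    "\<forall>x. (f has_real_derivative f' x) (at x)" "\<forall>x. (g has_real_derivative g' x) (at x)" by blast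
  then show ?case
    by (intro bexI[of _ "\<lambda>x. f' x + g' x"]) (auto intro: flat_algebra.intros DERIV_add)
next
  case (mult f g)
  then obtain f' g' where "f' \<in> flat_algebra e" "g' \<in> flat_algebra e"
    "\<forall>x. (f has_real_derivative f' x) (at x)" "\<forall>x. (g has_real_derivative g' x) (at x)" by blast
  then show ?case using mult.hyps
    by (intro bexI[of _ "\<lambda>x. f' x * g x + g' x * f x"]) (auto intro: flat_algebra.intros DERIV_mult)
qed

text \<open>As $e \to 0$ these test functions converge to the indicator function of $(a,b)$, boundedly.\<close>

definition bump :: "real \<Rightarrow> real \<Rightarrow> real \<Rightarrow> real \<Rightarrow> real"
  where "bump e a b x = flat e 0 (1 * x + (- a)) * flat e 0 ((- 1) * x + b)"

lemma bump_test_function: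
  assumes "e > 0" "{a..b} \<subseteq> S"
  shows "test_function S (bump e a b)"
  unfolding test_function_iff
proof
  have "bump e a b \<in> flat_algebra e" unfolding bump_def[abs_def] by (intro flat_algebra.intros)
  then show "smooth (bump e a b)" by (rule smooth_in_class) (rule flat_algebra_derivative[OF assms(1)])
  show "\<exists>C. compact C \<and> C \<subseteq> S \<and> (\<forall>x. x \<notin> C \<longrightarrow> bump e a b x = 0)"
    using assms(2) by (intro exI[of _ "{a..b}"]) (auto simp: bump_def flat_def)
qed

lemma flat_0_bounds: "e > 0 \<Longrightarrow> 0 \<le> flat e 0 y \<and> flat e 0 y \<le> 1"
  by (simp add: flat_def)

lemma bump_bounds: "e > 0 \<Longrightarrow> 0 \<le> bump e a b x \<and> bump e a b x \<le> 1"
  unfolding bump_def using flat_0_bounds by (simp add: mult_le_one)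

lemma bump_eq_0: "x \<notin> {a<..<b} \<Longrightarrow> bump e a b x = 0"
  by (auto simp: bump_def flat_def)

lemma bump_tendsto: "(\<lambda>n. bump (inverse (real (Suc n))) a b x) \<longlonglongrightarrow> indicator {a<..<b} x"
proof (cases "x \<in> {a<..<b}")
  case True
  have "(\<lambda>n. exp (- inverse (real (Suc n)) / y)) \<longlonglongrightarrow> exp (- 0 / y)" if "y \<noteq> 0" for y
    using that by (intro tendsto_intros LIMSEQ_inverse_real_of_nat)
  from tendsto_mult[OF this[of "x - a"] this[of "b - x"]] show ?thesis
    using True by (simp add: bump_def flat_def)
qed (simp add: bump_eq_0)

section \<open>The fundamental lemma of the calculus of variations\<close>

text \<open>Open intervals form an intersection-stable generator of the Borel sets, so the integral of $g$ over
  every Borel set vanishes; the total integral takes care of complements.\<close>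

lemma AE_zero_of_interval_integrals:
  fixes g :: "real \<Rightarrow> real"
  assumes g: "integrable lborel g" and total: "(\<integral>x. g x \<partial>lborel) = 0"
    and int: "\<And>a b. a < b \<Longrightarrow> (LINT x:{a<..<b}|lborel. g x) = 0"
  shows "AE x in lborel. g x = 0"
proof -
  define G where "G = range (\<lambda>(a, b). {a<..<b::real})"
  have "(LINT x:A|lborel. g x) = 0" if "A \<in> sets lborel" for A
  proof -
    have borel: "sets (borel :: real measure) = sigma_sets UNIV G"
      unfolding G_def by (subst borel_eq_box) (simp add: case_prod_beta')
    have stable: "Int_stable G" unfolding G_def Int_stable_def
    proof safe
      fix a b c d :: real
      have "{a<..<b} \<inter> {c<..<d} = {max a c<..<min b d}" by auto
      then show "{a<..<b} \<inter> {c<..<d} \<in> range (\<lambda>(a, b). {a<..<b})" by (auto intro!: image_eqI[of _ _ "(max a c, min b d)"])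
    qed
    have "A \<in> sigma_sets UNIV G" using that borel by simp
    from stable subset_UNIV[of G, folded Pow_UNIV] this show ?thesis
    proof (induction rule: sigma_sets_induct_disjoint)
      case (basic A)
      then obtain a b where "A = {a<..<b}" unfolding G_def by auto
      then show ?case using int[of a b] by (cases "a < b") (auto simp: set_lebesgue_integral_def)
    next
      case empty
      then show ?case by (simp add: set_lebesgue_integral_def)
    next
      case (compl A)
      then have A: "A \<in> sets borel" using borel by simp
      have "(\<integral>x. g x \<partial>lborel) = (LINT x:(A \<union> (UNIV - A))|lborel. g x)"
        by (simp add: set_lebesgue_integral_def)
      also have "\<dots> = (LINT x:A|lborel. g x) + (LINT x:(UNIV - A)|lborel. g x)"
        using g A by (intro set_integral_Un) (auto simp: set_integrable_def intro!: integrable_mult_indicator[where 'b = real, simplified])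
      finally show ?case using compl total by simp
    next
      case (union A)
      have "\<And>i. A i \<in> sets lborel" using union.hyps borel by auto
      then have "(LINT x:(\<Union>i. A i)|lborel. g x) = (\<Sum>i. LINT x:A i|lborel. g x)"
        using g union.hyps(1)
        by (intro lebesgue_integral_countable_add)
           (auto simp: disjoint_family_on_def set_integrable_def intro!: integrable_mult_indicator[where 'b = real, simplified])
      then show ?case using union.IH by simp
    qed
  qed
  then show ?thesis using density_unique_real[OF g, of "\<lambda>_. 0"] by simp
qed

context interval
begin

lemma test_function_integrable:
  assumes "test_function I \<phi>" "locally_integrable I f"
  shows "set_integrable lborel I (\<lambda>t. \<phi> t *\<^sub>R f t)"
proof -
  obtain C where C: "compact C" "C \<subseteq> I" "\<And>x. x \<notin> C \<Longrightarrow> \<phi> x = 0" and \<phi>: "smooth \<phi>"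
    using assms(1) unfolding test_function_iff by blast
  have i: "integrable lborel (\<lambda>x. indicator C x *\<^sub>R f x)"
    using assms(2) C unfolding locally_integrable_def set_integrable_def by blast
  have "compact (\<phi> ` C)" by (rule compact_continuous_image[OF smooth_continuous_on[OF \<phi>] C(1)])
  then obtain M where M: "\<And>x. x \<in> C \<Longrightarrow> \<bar>\<phi> x\<bar> \<le> M" using compact_imp_bounded bounded_iff by (metis imageI real_norm_def)
  have [measurable]: "\<phi> \<in> borel_measurable borel"
    by (rule borel_measurable_continuous_onI[OF smooth_continuous_on[OF \<phi>]])
  have "integrable lborel (\<lambda>x. \<phi> x *\<^sub>R (indicator C x *\<^sub>R f x))"
  proof (rule Bochner_Integration.integrable_bound)
    show "integrable lborel (\<lambda>x. M *\<^sub>R (indicator C x *\<^sub>R f x))" using i by (rule integrable_scaleR_right)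
    show "(\<lambda>x. \<phi> x *\<^sub>R (indicator C x *\<^sub>R f x)) \<in> borel_measurable lborel"
      using borel_measurable_integrable[OF i] by measurable
    show "AE x in lborel. norm (\<phi> x *\<^sub>R (indicator C x *\<^sub>R f x)) \<le> norm (M *\<^sub>R (indicator C x *\<^sub>R f x))"
    proof (intro AE_I2)
      fix x show "norm (\<phi> x *\<^sub>R (indicator C x *\<^sub>R f x)) \<le> norm (M *\<^sub>R (indicator C x *\<^sub>R f x))"
        using M[of x] by (cases "x \<in> C") (auto intro!: mult_right_mono)
    qed
  qed
  moreover have "\<phi> x *\<^sub>R (indicator C x *\<^sub>R f x) = indicator I x *\<^sub>R (\<phi> x *\<^sub>R f x)" for x
    using C(2,3) by (cases "x \<in> C"; cases "x \<in> I") auto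
  ultimately show ?thesis unfolding set_integrable_def by (simp only:)
qed

text \<open>Testing with bump functions shows, in the limit, that the integral of $f$ over every compact
  subinterval vanishes.\<close>

lemma fundamental_lemma:
  assumes f: "locally_integrable I f" and zero: "\<And>\<phi>. test_function I \<phi> \<Longrightarrow> (LINT t:I|lborel. \<phi> t *\<^sub>R f t) = 0"
  shows "AE t in lborel. t \<in> I \<longrightarrow> f t = 0"
proof -
  have int: "(LINT t:{a<..<b}|lborel. f t) = 0" if ab: "{a..b} \<subseteq> I" for a b
  proof -
    have i: "integrable lborel (\<lambda>x. indicator {a..b} x *\<^sub>R f x)"
      using f ab unfolding locally_integrable_def set_integrable_def by (metis compact_Icc)
    define s where "s n x = bump (inverse (real (Suc n))) a b x *\<^sub>R (indicator {a..b} x *\<^sub>R f x)" for n x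
    have e: "inverse (real (Suc n)) > 0" for n by simp
    have "(\<lambda>n. \<integral>x. s n x \<partial>lborel) \<longlonglongrightarrow> (\<integral>x. indicator {a<..<b} x *\<^sub>R f x \<partial>lborel)"
    proof (rule integral_dominated_convergence)
      show "integrable lborel (\<lambda>x. norm (indicator {a..b} x *\<^sub>R f x))" using i by (rule integrable_norm)
      have sm: "bump (inverse (real (Suc n))) a b \<in> borel_measurable borel" for n
        using bump_test_function[OF e, of a b "{a..b}" n] unfolding test_function_iff
        by (intro borel_measurable_continuous_onI smooth_continuous_on) auto
      show "s n \<in> borel_measurable lborel" for n unfolding s_def
        using sm[of n] borel_measurable_integrable[OF i] by measurable
      have eq: "indicator {a<..<b} x *\<^sub>R f x = indicator {a<..<b} x *\<^sub>R (indicator {a..b} x *\<^sub>R f x)" for x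
        by (auto simp: indicator_def)
      show "(\<lambda>x. indicator {a<..<b} x *\<^sub>R f x) \<in> borel_measurable lborel"
        unfolding eq using borel_measurable_integrable[OF i] by measurable
      show "AE x in lborel. (\<lambda>n. s n x) \<longlonglongrightarrow> indicator {a<..<b} x *\<^sub>R f x"
        unfolding eq s_def by (intro AE_I2 tendsto_scaleR bump_tendsto tendsto_const)
      show "AE x in lborel. norm (s n x) \<le> norm (indicator {a..b} x *\<^sub>R f x)" for n
        unfolding s_def norm_scaleR
        using bump_bounds[OF e, of n a b] by (intro AE_I2 mult_left_le_one_le) auto
    qed
    moreover have "(\<integral>x. s n x \<partial>lborel) = 0" for n
    proof -
      have "(\<integral>x. s n x \<partial>lborel) = (LINT t:I|lborel. bump (inverse (real (Suc n))) a b t *\<^sub>R f t)"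
        unfolding set_lebesgue_integral_def s_def
      proof (rule Bochner_Integration.integral_cong[OF refl])
        fix x
        show "bump (inverse (real (Suc n))) a b x *\<^sub>R (indicator {a..b} x *\<^sub>R f x) =
          indicator I x *\<^sub>R (bump (inverse (real (Suc n))) a b x *\<^sub>R f x)"
        proof (cases "x \<in> {a<..<b}")
          case True
          then have "x \<in> {a..b}" by auto
          then show ?thesis using subsetD[OF ab] by simp
        qed (simp add: bump_eq_0)
      qed
      then show ?thesis using zero[OF bump_test_function[OF e ab]] by simp
    qed
    ultimately show ?thesis unfolding set_lebesgue_integral_def by (simp add: LIMSEQ_const_iff)
  qed
  have sub: "AE t in lborel. t \<in> {\<alpha><..<\<beta>} \<longrightarrow> f t = 0" if ab: "{\<alpha>..\<beta>} \<subseteq> I" for \<alpha> \<beta>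
  proof -
    define g where "g x = indicator {\<alpha><..<\<beta>} x *\<^sub>R f x" for x
    have gi: "integrable lborel g"
    proof -
      have i: "set_integrable lborel {\<alpha>..\<beta>} f"
        using f ab unfolding locally_integrable_def by (metis compact_Icc)
      have "set_integrable lborel {\<alpha><..<\<beta>} f" by (rule set_integrable_subset[OF i]) auto
      then show ?thesis unfolding set_integrable_def g_def .
    qed
    have gint: "(LINT x:{a<..<b}|lborel. g x) = 0" for a b
    proof -
      have "(LINT x:{a<..<b}|lborel. g x) = (LINT x:{max a \<alpha><..<min b \<beta>}|lborel. f x)"
        unfolding set_lebesgue_integral_def g_def
        by (intro Bochner_Integration.integral_cong) (auto simp: indicator_def)
      also have "\<dots> = 0" using ab by (intro int) auto
      finally show ?thesis .
    qed
    have gtot: "(\<integral>x. g x \<partial>lborel) = 0"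
    proof -
      have "(\<integral>x. g x \<partial>lborel) = (LINT x:{\<alpha><..<\<beta>}|lborel. g x)"
        unfolding set_lebesgue_integral_def g_def
        by (intro Bochner_Integration.integral_cong) (auto simp: indicator_def)
      then show ?thesis using gint by simp
    qed
    have gsi: "set_integrable lborel A g" if "A \<in> sets borel" for A
      unfolding set_integrable_def by (rule integrable_mult_indicator[OF _ gi]) (use that in simp)
    have "AE x in lborel. Re (g x) = 0"
    proof (rule AE_zero_of_interval_integrals)
      show "(LINT x:{a<..<b}|lborel. Re (g x)) = 0" for a b
        using integral_Re[OF gsi[of "{a<..<b}", unfolded set_integrable_def]] gint[of a b]
        by (simp add: set_lebesgue_integral_def)
    qed (use gi gtot in \<open>auto simp: integral_Re\<close>)
    moreover have "AE x in lborel. Im (g x) = 0"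
    proof (rule AE_zero_of_interval_integrals)
      show "(LINT x:{a<..<b}|lborel. Im (g x)) = 0" for a b
        using integral_Im[OF gsi[of "{a<..<b}", unfolded set_integrable_def]] gint[of a b]
        by (simp add: set_lebesgue_integral_def)
    qed (use gi gtot in \<open>auto simp: integral_Im\<close>)
    ultimately show ?thesis
      by eventually_elim (auto simp: g_def complex_eq_iff)
  qed
  have "AE t in lborel. \<forall>n. t \<in> {t0 / real (n + 2)<..<t0 - t0 / real (n + 2)} \<longrightarrow> f t = 0"
    unfolding AE_all_countable
  proof
    fix n
    have "0 < t0 / real (n + 2)" "t0 / real (n + 2) < t0" using t0 by (auto simp: field_simps intro: add_pos_nonneg)
    then show "AE t in lborel. t \<in> {t0 / real (n + 2)<..<t0 - t0 / real (n + 2)} \<longrightarrow> f t = 0"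
      by (intro sub) auto
  qed
  then show ?thesis
  proof eventually_elim
    case (elim t)
    show ?case
    proof
      assume t: "t \<in> I"
      define m where "m = min t (t0 - t)"
      have "m > 0" using t by (simp add: m_def)
      then obtain n where "t0 / m < real n" using reals_Archimedean2 by blast
      then have "t0 / real (n + 2) < m" using \<open>m > 0\<close> by (simp add: field_simps)
      then have "t \<in> {t0 / real (n + 2)<..<t0 - t0 / real (n + 2)}" by (simp add: m_def)
      then show "f t = 0" using elim by blast
    qed
  qed
qed

end

section \<open>Weak derivatives\<close>

lemma test_function_deriv:
  assumes "test_function S f"
  shows "test_function S (deriv f)"
proof -
  obtain C where C: "compact C" "C \<subseteq> S" "\<And>x. x \<notin> C \<Longrightarrow> f x = 0" and f: "smooth f"
    using assms unfolding test_function_iff by blast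
  have "smooth (deriv f)"
    unfolding smooth_def
    using smooth_funpow_deriv[OF f, of "Suc _"] by (intro exI[of _ "\<lambda>k. (deriv ^^ Suc k) f"]) auto
  moreover have "deriv f x = 0" if "x \<notin> C" for x
  proof -
    have "(f has_real_derivative 0) (at x)"
      by (rule has_field_derivative_transform_within_open[of "\<lambda>_. 0" _ _ "- C"])
         (use that C compact_imp_closed in auto)
    then show ?thesis by (rule DERIV_imp_deriv)
  qed
  ultimately show ?thesis unfolding test_function_iff using C by blast
qed

lemma test_function_funpow_deriv: "test_function S f \<Longrightarrow> test_function S ((deriv ^^ k) f)"
  by (induction k) (simp_all add: test_function_deriv)

lemma test_function_combination:
  assumes "test_function S f" "test_function S g"
  shows "test_function S (\<lambda>x. f x + c * g x)"
proof -
  obtain C C' where C: "compact C" "C \<subseteq> S" "\<And>x. x \<notin> C \<Longrightarrow> f x = 0"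
    "compact C'" "C' \<subseteq> S" "\<And>x. x \<notin> C' \<Longrightarrow> g x = 0"
    using assms unfolding test_function_iff by blast
  have "\<exists>C. compact C \<and> C \<subseteq> S \<and> (\<forall>x. x \<notin> C \<longrightarrow> f x + c * g x = 0)"
    using C by (intro exI[of _ "C \<union> C'"]) (simp add: compact_Un)
  then show ?thesis using assms smooth_add unfolding test_function_iff by blast
qed

lemma AE_notin_Ioo: assumes "AE t in lborel. t \<notin> {a<..<b::real}" shows "b \<le> a"
proof -
  have "{a<..<b} \<in> null_sets lborel" using assms AE_iff_null_sets[of "{a<..<b}" lborel] by simp
  then have "emeasure lborel {a<..<b} = 0" by (rule null_setsD1)
  then show ?thesis by (cases "a \<le> b") auto
qed

context interval
begin

definition test_vec :: "(real \<Rightarrow> real) \<Rightarrow> L2" where "test_vec \<phi> = emb t0 (\<lambda>t. of_real (\<phi> t))"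

lemma test_continuous: "test_function I \<phi> \<Longrightarrow> continuous_on S (\<lambda>t. complex_of_real (\<phi> t))"
  unfolding test_function_iff by (intro continuous_on_of_real smooth_continuous_on) blast

lemma L2_fun_test: "test_function I \<phi> \<Longrightarrow> L2_fun I (\<lambda>t. complex_of_real (\<phi> t))"
  by (rule L2_fun_continuous[OF test_continuous])

lemma test_function_zero: "test_function I \<phi> \<Longrightarrow> t \<notin> I \<Longrightarrow> \<phi> t = 0"
  unfolding test_function_iff by blast

lemma cinner_test_vec:
  assumes "L2_fun I f" "test_function I \<phi>"
  shows "cinner_L2 (emb t0 f) (test_vec \<phi>) = (LINT t:I|lborel. \<phi> t *\<^sub>R f t)"
  unfolding test_vec_def cinner_emb[OF assms(1) L2_fun_test[OF assms(2)]] by (simp add: scaleR_conv_of_real mult.commute)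

lemma restr_test_vec: "test_function I \<phi> \<Longrightarrow> P (test_vec \<phi>) = test_vec \<phi>"
  unfolding test_vec_def by (intro restr_emb L2_fun_test)

lemma test_function_support:
  assumes "test_function I \<phi>"
  obtains \<alpha> \<beta> where "0 < \<alpha>" "\<alpha> < \<beta>" "\<beta> < t0" "\<And>x. x \<notin> {\<alpha>..\<beta>} \<Longrightarrow> \<phi> x = 0"
proof -
  obtain C where C: "compact C" "C \<subseteq> I" "\<And>x. x \<notin> C \<Longrightarrow> \<phi> x = 0"
    using assms unfolding test_function_iff by blast
  show thesis
  proof (cases "C = {}")
    case True
    then show thesis using C t0 by (intro that[of "t0/3" "t0/2"]) auto
  next
    case False
    obtain a where a: "a \<in> C" "\<forall>x\<in>C. a \<le> x" using compact_attains_inf[OF C(1) False] by blast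
    obtain b where b: "b \<in> C" "\<forall>x\<in>C. x \<le> b" using compact_attains_sup[OF C(1) False] by blast
    have ab: "a \<in> C" "b \<in> C" "\<And>x. x \<in> C \<Longrightarrow> a \<le> x \<and> x \<le> b" using a b by blast+
    have "0 < a" "b < t0" using subsetD[OF C(2) a(1)] subsetD[OF C(2) b(1)] by simp_all
    moreover have "\<phi> x = 0" if "x \<notin> {a/2..(b + t0)/2}" for x
    proof (rule C(3), rule notI)
      assume "x \<in> C"
      then have "a \<le> x" "x \<le> b" using ab(3) by auto
      then show False using that \<open>0 < a\<close> \<open>b < t0\<close> by auto
    qed
    moreover have "a \<le> b" using a b by blast
    ultimately show thesis by (intro that[of "a/2" "(b + t0)/2"]) auto
  qed
qed

text \<open>The primitive is constant on either side of the support of $\psi$. If the constant is $0$ on the left, it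
  is $\int\psi = 0$ on the right.\<close>

lemma test_antiderivative:
  assumes \<psi>: "test_function I \<psi>" and zero: "(LINT t:I|lborel. \<psi> t) = 0"
  obtains \<phi> where "test_function I \<phi>" "deriv \<phi> = \<psi>"
proof -
  have sm: "smooth \<psi>" using \<psi> unfolding test_function_iff by blast
  obtain \<alpha> \<beta> where ab: "0 < \<alpha>" "\<alpha> < \<beta>" "\<beta> < t0" "\<And>x. x \<notin> {\<alpha>..\<beta>} \<Longrightarrow> \<psi> x = 0"
    by (rule test_function_support[OF \<psi>]) blast
  have "\<exists>F. \<forall>x::real. -\<infinity> < ereal x \<longrightarrow> ereal x < \<infinity> \<longrightarrow> (F has_vector_derivative \<psi> x) (at x)"
  proof (rule einterval_antiderivative)
    show "isCont \<psi> x" for x using DERIV_isCont[OF smooth_has_derivative[OF sm]] .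
  qed simp
  then obtain F where F: "\<And>x. (F has_real_derivative \<psi> x) (at x)"
    by (auto simp: has_real_derivative_iff_has_vector_derivative)
  have const: "F y = F x" if "x \<le> y" "\<And>t. x \<le> t \<Longrightarrow> t \<le> y \<Longrightarrow> t \<in> {\<alpha>..\<beta>} \<Longrightarrow> \<psi> t = 0" for x y
  proof (cases "x = y")
    case False
    have d: "(F has_real_derivative 0) (at t)" if "x \<le> t" "t \<le> y" for t
      using F[of t] \<open>\<And>t. x \<le> t \<Longrightarrow> t \<le> y \<Longrightarrow> t \<in> {\<alpha>..\<beta>} \<Longrightarrow> \<psi> t = 0\<close>[OF that] ab(4)[of t] by (cases "t \<in> {\<alpha>..\<beta>}") auto
    have cont: "continuous_on {x..y} F" using F by (meson DERIV_isCont continuous_at_imp_continuous_on)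
    have "x < y" using False that(1) by simp
    from DERIV_isconst_end[OF this cont] d show ?thesis by auto
  qed simp
  have z: "\<psi> \<alpha> = 0" "\<psi> \<beta> = 0"
  proof -
    have cont: "continuous_on UNIV \<psi>" by (rule smooth_continuous_on[OF sm])
    have "closed {x. \<psi> x = 0}" using continuous_closed_vimage[of "{0}" \<psi>] cont
      by (simp add: vimage_def continuous_on_eq_continuous_at)
    moreover have "(\<lambda>n. \<alpha> - inverse (real (Suc n))) \<longlonglongrightarrow> \<alpha> - 0" "(\<lambda>n. \<beta> + inverse (real (Suc n))) \<longlonglongrightarrow> \<beta> + 0"
      by (intro tendsto_intros LIMSEQ_inverse_real_of_nat)+
    moreover have "\<alpha> - inverse (real (Suc n)) \<in> {x. \<psi> x = 0}" "\<beta> + inverse (real (Suc n)) \<in> {x. \<psi> x = 0}" for n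
      using ab(4)[of "\<alpha> - inverse (real (Suc n))"] ab(4)[of "\<beta> + inverse (real (Suc n))"] by auto
    ultimately have "\<alpha> - 0 \<in> {x. \<psi> x = 0}" "\<beta> + 0 \<in> {x. \<psi> x = 0}"
      by (meson closed_sequentially)+
    then show "\<psi> \<alpha> = 0" "\<psi> \<beta> = 0" by auto
  qed
  have "F t0 - F 0 = 0"
  proof -
    have "(LBINT t=0..t0. \<psi> t) = F t0 - F 0"
      using interval_integral_FTC_finite[of 0 t0 \<psi> F] F smooth_continuous_on[OF sm]
      by (simp add: zero_ereal_def has_real_derivative_iff_has_vector_derivative has_vector_derivative_at_within)
    then show ?thesis using zero t0 interval_integral_Ioo[of 0 "ereal t0" \<psi>] by simp
  qed
  then have F0: "F t0 = F 0" "F \<alpha> = F 0" "F \<beta> = F t0"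
    using const[of 0 \<alpha>] const[of \<beta> t0] ab z by (auto dest: antisym)
  define \<phi> where "\<phi> t = F t - F 0" for t
  have d: "(\<phi> has_real_derivative \<psi> x) (at x)" for x unfolding \<phi>_def using F by (auto intro!: derivative_eq_intros)
  have "\<phi> x = 0" if "x \<notin> {\<alpha>..\<beta>}" for x
  proof (cases "x < \<alpha>")
    case True
    then have "F \<alpha> = F x" using z by (intro const) (auto dest: antisym)
    then show ?thesis using F0 by (simp add: \<phi>_def)
  next
    case False
    then have "F x = F \<beta>" using z that by (intro const) (auto dest: antisym)
    then show ?thesis using F0 by (simp add: \<phi>_def)
  qed
  then have "test_function I \<phi>" unfolding test_function_iff
    using smooth_antiderivative[OF sm d] ab by (intro conjI exI[of _ "{\<alpha>..\<beta>}"]) auto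
  moreover have "deriv \<phi> = \<psi>" using d DERIV_imp_deriv by blast
  ultimately show thesis by (rule that)
qed

lemma L2_locally_integrable:
  assumes "L2_fun I f" shows "locally_integrable I f"
  unfolding locally_integrable_def
proof (intro allI impI)
  fix C :: "real set" assume C: "compact C \<and> C \<subseteq> I"
  have "set_integrable lborel I f" by (rule L2_fun_integrable[OF assms]) auto
  then show "set_integrable lborel C f"
    by (rule set_integrable_subset) (use C borel_compact in auto)
qed

lemma eq_0_if_orthogonal_to_tests:
  assumes "P u = u" "\<And>\<phi>. test_function I \<phi> \<Longrightarrow> cinner_L2 u (test_vec \<phi>) = 0"
  shows "u = 0"
proof -
  let ?f = "rep_L2 u"
  have u: "u = emb t0 ?f" using assms(1) by (simp add: restr_def)
  have "AE t in lborel. t \<in> I \<longrightarrow> ?f t = 0"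
  proof (rule fundamental_lemma[OF L2_locally_integrable[OF L2_fun_rep_I]])
    fix \<phi> assume \<phi>: "test_function I \<phi>"
    show "(LINT t:I|lborel. \<phi> t *\<^sub>R ?f t) = 0"
      using cinner_test_vec[OF L2_fun_rep_I \<phi>, of u] assms(2)[OF \<phi>] u by simp
  qed
  then have "ae_eq I ?f (\<lambda>_. 0)" by (simp add: ae_eq_def)
  then have "emb t0 ?f = emb t0 (\<lambda>_. 0)" using emb_eq_iff[OF L2_fun_rep_I L2_fun_0] by blast
  then show ?thesis using u by simp
qed

text \<open>With $\int\rho = 1$, every test function $\psi$ differs from $(\int\psi)\rho$ by the derivative
  of a test function; so $u - \langle u,\rho\rangle$ is orthogonal to all test functions.\<close>

lemma du_Bois_Reymond:
  assumes "P u = u" "\<And>\<phi>. test_function I \<phi> \<Longrightarrow> cinner_L2 u (test_vec (deriv \<phi>)) = 0"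
  obtains c where "u = cscale c one"
proof -
  let ?b = "bump 1 (t0/3) (t0/2)"
  have b: "test_function I ?b" by (rule bump_test_function) (use t0 in auto)
  have int: "set_integrable lborel I \<psi>" if "test_function I \<psi>" for \<psi>
  proof -
    have "continuous_on {0..t0} \<psi>" using that unfolding test_function_iff by (intro smooth_continuous_on) blast
    then show ?thesis by (rule set_integrable_subset[OF borel_integrable_atLeastAtMost']) auto
  qed
  have pos: "(LINT t:I|lborel. ?b t) > 0"
  proof -
    have "(LINT t:I|lborel. ?b t) \<noteq> 0"
    proof
      assume "(LINT t:I|lborel. ?b t) = 0"
      then have "AE t in lborel. indicator I t *\<^sub>R ?b t = 0"
        using integral_nonneg_eq_0_iff_AE[OF int[OF b, unfolded set_integrable_def]] bump_bounds[of 1]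
        by (auto simp: set_lebesgue_integral_def)
      then have "AE t in lborel. t \<notin> {t0/3<..<t0/2}"
      proof eventually_elim
        case (elim t)
        show ?case
        proof
          assume "t \<in> {t0/3<..<t0/2}"
          then show False using elim t0 by (auto simp: bump_def flat_def)
        qed
      qed
      then have "t0/2 \<le> t0/3" by (rule AE_notin_Ioo)
      then show False using t0 by simp
    qed
    moreover have "(LINT t:I|lborel. ?b t) \<ge> 0"
      unfolding set_lebesgue_integral_def using bump_bounds[of 1] by (intro integral_nonneg_AE) auto
    ultimately show ?thesis by simp
  qed
  define m where "m = (LINT t:I|lborel. ?b t)"
  define c where "c = cinner_L2 u (test_vec ?b) / m"
  have m: "m > 0" using pos by (simp add: m_def)
  have "u - cscale c one = 0"
  proof (rule eq_0_if_orthogonal_to_tests)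
    show "P (u - cscale c one) = u - cscale c one"
      by (simp add: cblinear_diff[OF cblinear_restr] cblinear_cscale[OF cblinear_restr] assms(1))
    fix \<psi> assume \<psi>: "test_function I \<psi>"
    define k where "k = - (LINT t:I|lborel. \<psi> t) / m"
    define \<chi>' where "\<chi>' t = \<psi> t + k * ?b t" for t
    have \<chi>': "test_function I \<chi>'" unfolding \<chi>'_def by (rule test_function_combination[OF \<psi> b])
    have "(LINT t:I|lborel. \<chi>' t) = (LINT t:I|lborel. \<psi> t) + k * m"
      unfolding \<chi>'_def m_def using int[OF \<psi>] int[OF b] by (simp add: set_integral_add)
    also have "\<dots> = 0" using m by (simp add: k_def)
    finally obtain \<phi> where "test_function I \<phi>" "deriv \<phi> = \<chi>'" by (rule test_antiderivative[OF \<chi>'])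
    then have "cinner_L2 u (test_vec \<chi>') = 0" using assms(2) by blast
    moreover have "test_vec \<chi>' = test_vec \<psi> + cscale (of_real k) (test_vec ?b)"
      unfolding test_vec_def emb_cscale[OF L2_fun_test[OF b]]
      by (subst emb_add[OF L2_fun_test[OF \<psi>] L2_fun_cmult[OF L2_fun_test[OF b]]]) (simp add: \<chi>'_def)
    ultimately have "cinner_L2 u (test_vec \<psi>) = - of_real k * (c * m)"
      using m by (simp add: cinner_add_right c_def add_eq_0_iff)
    also have "\<dots> = c * (LINT t:I|lborel. \<psi> t)" using m by (simp add: k_def)
    also have "complex_of_real (LINT t:I|lborel. \<psi> t) = cinner_L2 one (test_vec \<psi>)"
      unfolding cinner_test_vec[OF L2_fun_const \<psi>] by (simp add: scaleR_conv_of_real set_integral_complex_of_real)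
    finally show "cinner_L2 (u - cscale c one) (test_vec \<psi>) = 0" by (simp add: cinner_diff_left)
  qed
  then show thesis using that[of c] by simp
qed

lemma test_vec_eq_prim: assumes "test_function I \<phi>" shows "test_vec \<phi> = V (test_vec (deriv \<phi>))"
proof -
  have "smooth \<phi>" using assms unfolding test_function_iff by blast
  then have d: "((\<lambda>t. complex_of_real (\<phi> t)) has_vector_derivative complex_of_real (deriv \<phi> t)) (at t within {0..t0})" for t
    using smooth_has_derivative[of \<phi> t]
    by (auto intro!: has_vector_derivative_of_real simp: has_real_derivative_iff_has_vector_derivative has_vector_derivative_at_within)
  have "test_vec \<phi> = cscale (complex_of_real (\<phi> 0)) one + V (test_vec (deriv \<phi>))"
    unfolding test_vec_def by (rule emb_primitive[OF test_continuous[OF test_function_deriv[OF assms]] d])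
  then show ?thesis using test_function_zero[OF assms, of 0] by simp
qed

lemma test_function_reflect:
  assumes "test_function I \<phi>"
  shows "test_function I (\<lambda>t. \<phi> (t0 - t))" "deriv (\<lambda>t. \<phi> (t0 - t)) = (\<lambda>t. - deriv \<phi> (t0 - t))"
proof -
  obtain d where d: "d 0 = \<phi>" "\<And>k x. (d k has_real_derivative d (Suc k) x) (at x)"
    using assms unfolding test_function_iff smooth_def by blast
  have r: "((\<lambda>t. (-1) ^ k * d k (t0 - t)) has_real_derivative (-1) ^ Suc k * d (Suc k) (t0 - x)) (at x)" for k x
  proof -
    have "((\<lambda>t. t0 - t) has_real_derivative -1) (at x)" by (auto intro!: derivative_eq_intros)
    from DERIV_cmult[OF DERIV_chain2[OF d(2) this], of "(-1) ^ k"] show ?thesis by simp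
  qed
  have sm: "smooth (\<lambda>t. \<phi> (t0 - t))" unfolding smooth_def using r d(1)
    by (intro exI[of _ "\<lambda>k t. (-1) ^ k * d k (t0 - t)"]) auto
  obtain \<alpha> \<beta> where ab: "0 < \<alpha>" "\<alpha> < \<beta>" "\<beta> < t0" "\<And>x. x \<notin> {\<alpha>..\<beta>} \<Longrightarrow> \<phi> x = 0"
    by (rule test_function_support[OF assms]) blast
  then show "test_function I (\<lambda>t. \<phi> (t0 - t))" unfolding test_function_iff
    using sm by (intro conjI exI[of _ "{t0 - \<beta>..t0 - \<alpha>}"]) auto
  have "deriv \<phi> x = d 1 x" for x 
  proof -
    have "(\<phi> has_real_derivative d (Suc 0) x) (at x)" unfolding d(1)[symmetric] by (rule d(2))
    then show ?thesis by (simp add: DERIV_imp_deriv)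
  qed
  then show "deriv (\<lambda>t. \<phi> (t0 - t)) = (\<lambda>t. - deriv \<phi> (t0 - t))"
  proof (intro ext)
    fix x
    have "((\<lambda>t. \<phi> (t0 - t)) has_real_derivative - d (Suc 0) (t0 - x)) (at x)"
      using r[of 0 x] by (simp add: d(1))
    then show "deriv (\<lambda>t. \<phi> (t0 - t)) x = - deriv \<phi> (t0 - x)"
      using \<open>\<And>x. deriv \<phi> x = d 1 x\<close> by (simp add: DERIV_imp_deriv)
  qed
qed

text \<open>Integration by parts: $V^* = JVJ$, and a test function is the primitive of its derivative, from either
  end of the interval.\<close>

lemma cinner_prim_test_vec_deriv:
  assumes \<phi>: "test_function I \<phi>"
  shows "cinner_L2 (V u) (test_vec (deriv \<phi>)) = - cinner_L2 u (test_vec \<phi>)"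
proof -
  note r = test_function_reflect[OF \<phi>]
  have J: "J (test_vec f) = test_vec (\<lambda>t. f (t0 - t))" if "test_function I f" for f
    unfolding test_vec_def by (rule refl_emb[OF L2_fun_test[OF that]])
  have "J (test_vec \<phi>) = V (test_vec (\<lambda>t. - deriv \<phi> (t0 - t)))"
    unfolding J[OF \<phi>] test_vec_eq_prim[OF r(1)] r(2) ..
  also have "test_vec (\<lambda>t. - deriv \<phi> (t0 - t)) = cscale (-1) (J (test_vec (deriv \<phi>)))"
    unfolding J[OF test_function_deriv[OF \<phi>]] unfolding test_vec_def
    by (subst emb_cscale[OF L2_fun_test[OF test_function_reflect(1)[OF test_function_deriv[OF \<phi>]]]]) simp
  finally have eq: "J (test_vec \<phi>) = cscale (-1) (V (J (test_vec (deriv \<phi>))))"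
    unfolding cblinear_cscale[OF cblinear_prim] .
  have "V (J (test_vec (deriv \<phi>))) = cscale (-1) (J (test_vec \<phi>))" unfolding eq L2.scale_scale by simp
  then have "J (V (J (test_vec (deriv \<phi>)))) = cscale (-1) (J (J (test_vec \<phi>)))"
    by (simp only: cblinear_cscale[OF cblinear_refl])
  also have "J (J (test_vec \<phi>)) = test_vec \<phi>" unfolding refl_refl by (rule restr_test_vec[OF \<phi>])
  finally show ?thesis unfolding prim_adjoint by (simp only: cinner_cscale_right) simp
qed

lemma cinner_funpow_prim_test_vec:
  "test_function I \<phi> \<Longrightarrow> cinner_L2 ((V ^^ k) u) (test_vec ((deriv ^^ k) \<phi>)) = (-1) ^ k * cinner_L2 u (test_vec \<phi>)"
proof (induction k)
  case (Suc k)
  then show ?case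
    using cinner_prim_test_vec_deriv[OF test_function_funpow_deriv[OF Suc.prems], of "(V ^^ k) u" k] by simp
qed simp

lemma weak_deriv_iff:
  assumes "L2_fun I f" "L2_fun I g"
  shows "weak_deriv k I f g \<longleftrightarrow>
    (\<forall>\<phi>. test_function I \<phi> \<longrightarrow>
      cinner_L2 (emb t0 f) (test_vec ((deriv ^^ k) \<phi>)) = (-1) ^ k * cinner_L2 (emb t0 g) (test_vec \<phi>))"
  unfolding weak_deriv_def using assms
  by (auto simp: L2_locally_integrable cinner_test_vec test_function_funpow_deriv)

lemma weak_deriv_unique:
  assumes "weak_deriv k I f g" "weak_deriv k I f g'"
  shows "ae_eq I g g'"
proof -
  have loc: "locally_integrable I g" "locally_integrable I g'" using assms by (auto simp: weak_deriv_def)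
  have "AE t in lborel. t \<in> I \<longrightarrow> g t - g' t = 0"
  proof (rule fundamental_lemma)
    show "locally_integrable I (\<lambda>t. g t - g' t)"
      using loc unfolding locally_integrable_def by (auto intro: set_integral_diff(1))
    fix \<phi> assume \<phi>: "test_function I \<phi>"
    have "(LINT x:I|lborel. (deriv ^^ k) \<phi> x *\<^sub>R f x) = (-1) ^ k * (LINT x:I|lborel. \<phi> x *\<^sub>R g x)"
      "(LINT x:I|lborel. (deriv ^^ k) \<phi> x *\<^sub>R f x) = (-1) ^ k * (LINT x:I|lborel. \<phi> x *\<^sub>R g' x)"
      using assms \<phi> unfolding weak_deriv_def by blast+
    then have "(-1) ^ k * (LINT x:I|lborel. \<phi> x *\<^sub>R g x) = (-1) ^ k * (LINT x:I|lborel. \<phi> x *\<^sub>R g' x)"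
      by (simp only:)
    then show "(LINT t:I|lborel. \<phi> t *\<^sub>R (g t - g' t)) = 0"
      using set_integral_diff(2)[OF test_function_integrable[OF \<phi> loc(1)] test_function_integrable[OF \<phi> loc(2)]]
      by (simp add: scaleR_diff_right)
  qed
  then show ?thesis unfolding ae_eq_def by simp
qed

text \<open>A property that holds almost everywhere has points arbitrarily close to $0$, and continuity carries it
  over to the boundary value.\<close>

lemma continuous_eq_const_at_0:
  fixes F :: "real \<Rightarrow> complex"
  assumes "continuous_on {0..t0} F" "AE t in lborel. t \<in> I \<longrightarrow> F t = c"
  shows "F 0 = c"
proof -
  have "\<exists>t\<in>{0<..<t0 / Suc n}. F t = c" for n
  proof (rule ccontr)
    assume *: "\<not> ?thesis"
    have "t0 / real (Suc n) \<le> t0" using t0 by (simp add: field_simps)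
    then have sub: "{0<..<t0 / Suc n} \<subseteq> I" by auto
    have "AE t in lborel. t \<notin> {0<..<t0 / Suc n}" using assms(2)
    proof eventually_elim
      case (elim t)
      then show ?case using * sub by blast
    qed
    then have "t0 / Suc n \<le> 0" by (rule AE_notin_Ioo)
    then show False using t0 by (simp add: field_simps)
  qed
  then obtain s where s: "\<And>n. s n \<in> {0<..<t0 / real (Suc n)}" "\<And>n. F (s n) = c" by metis
  have "s \<longlonglongrightarrow> 0"
  proof (rule tendsto_sandwich[OF _ _ tendsto_const])
    show "(\<lambda>n. t0 / real (Suc n)) \<longlonglongrightarrow> 0"
      using tendsto_mult_left[OF LIMSEQ_inverse_real_of_nat, of t0] by (simp add: divide_inverse)
    show "\<forall>\<^sub>F n in sequentially. 0 \<le> s n" "\<forall>\<^sub>F n in sequentially. s n \<le> t0 / real (Suc n)"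
      using s(1) by (auto intro!: always_eventually intro: less_imp_le)
  qed
  moreover have "s n \<in> {0..t0}" for n
  proof -
    have "t0 / real (Suc n) \<le> t0" using t0 by (simp add: field_simps)
    then show ?thesis using s(1)[of n] by auto
  qed
  ultimately have "(\<lambda>n. F (s n)) \<longlonglongrightarrow> F 0"
    using assms(1) t0 unfolding continuous_on_sequentially by (auto simp: o_def)
  then show ?thesis using s(2) by (simp add: LIMSEQ_const_iff)
qed

end

context hankel
begin

lemma restr_funpow': "P y = y \<Longrightarrow> P ((V ^^ n) y) = (V ^^ n) y"
  by (cases n) auto

text \<open>A representative of $V^jy$, continuous on $[0,t_0]$ when $j \ge 1$.\<close>

definition prim_fun :: "nat \<Rightarrow> L2 \<Rightarrow> real \<Rightarrow> complex"
  where "prim_fun j y t = (case j of 0 \<Rightarrow> rep_L2 y t | Suc i \<Rightarrow> cinner_L2 ((V ^^ i) y) (\<eta> t))"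

lemma L2_fun_prim_fun: "L2_fun I (prim_fun j y)"
  unfolding prim_fun_def[abs_def] by (cases j) (simp_all add: L2_fun_rep_I L2_fun_cinner_chi)

lemma emb_prim_fun: assumes "P y = y" shows "emb t0 (prim_fun j y) = (V ^^ j) y"
proof (cases j)
  case 0
  then show ?thesis using assms by (simp add: prim_fun_def[abs_def] restr_def)
next
  case (Suc i)
  then show ?thesis by (simp add: prim_fun_def[abs_def] prim_def)
qed

lemma weak_deriv_prim_fun:
  assumes f: "L2_fun I f" "emb t0 f = (V ^^ K) y" and y: "P y = y" and k: "k \<le> K"
  shows "weak_deriv k I f (prim_fun (K - k) y)"
  unfolding weak_deriv_iff[OF f(1) L2_fun_prim_fun] emb_prim_fun[OF y] f(2)
proof (intro allI impI)
  fix \<phi> assume "test_function I \<phi>"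
  from cinner_funpow_prim_test_vec[OF this, of k "(V ^^ (K - k)) y"]
  show "cinner_L2 ((V ^^ K) y) (test_vec ((deriv ^^ k) \<phi>)) = (-1) ^ k * cinner_L2 ((V ^^ (K - k)) y) (test_vec \<phi>)"
    using k by (simp flip: funpow_add[THEN fun_cong, simplified o_def])
qed

lemma emb_D:
  assumes "\<And>k. k \<le> K \<Longrightarrow> L2_fun I (d k)" "\<And>k. k \<le> K \<Longrightarrow> emb t0 (d k) = (V ^^ (K - k)) y"
  shows "L2_fun I (\<lambda>t. \<Sum>k\<le>K. (- 1) ^ k * of_real (h k) * d k t)"
    "D y = emb t0 (\<lambda>t. \<Sum>k\<le>K. (- 1) ^ k * of_real (h k) * d k t)"
proof -
  have e: "emb t0 (\<lambda>t. (- 1) ^ k * of_real (h k) * d k t) = coef k *\<^sub>R (V ^^ (K - k)) y" if "k \<le> K" for k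
    unfolding assms(2)[OF that, symmetric] scaleR_eq_cscale emb_cscale[OF assms(1)[OF that]] by (simp add: coef_def)
  note s = emb_sum[of "{..K}" t0 "\<lambda>k t. (- 1) ^ k * of_real (h k) * d k t"]
  show "L2_fun I (\<lambda>t. \<Sum>k\<le>K. (- 1) ^ k * of_real (h k) * d k t)"
    using s L2_fun_cmult[OF assms(1)] by auto
  show "D y = emb t0 (\<lambda>t. \<Sum>k\<le>K. (- 1) ^ k * of_real (h k) * d k t)"
    using s L2_fun_cmult[OF assms(1)] e unfolding D_def by simp
qed

text \<open>Write $G_k$ for the class of the $k$-th weak derivative. By du Bois-Reymond $G_k - VG_{k+1}$ is
  constant, and for $k < K$ the boundary condition at $0$ makes the constant $0$; hence
  $G_k = V^{K-k}G_K$. Here \<open>\<gamma> k\<close> is the representative continuous on $[0,t_0]$ if $k < K$.\<close>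

lemma hankel_dom_primitives:
  assumes f: "f \<in> hankel_dom K t0"
  obtains \<gamma> y where "P y = y" "emb t0 f = (V ^^ K) y"
    "\<And>k. k \<le> K \<Longrightarrow> weak_deriv k I f (\<gamma> k)" "\<And>k. k \<le> K \<Longrightarrow> L2_fun I (\<gamma> k)"
    "\<And>k. k \<le> K \<Longrightarrow> emb t0 (\<gamma> k) = (V ^^ (K - k)) y"
proof -
  have fI: "L2_fun I f" using f unfolding hankel_dom_def by (auto intro: L2_fun_I)
  obtain top where top: "L2_fun I top" "weak_deriv K I f top"
    using f unfolding hankel_dom_def sobolev_def by blast
  have "\<forall>j<K. \<exists>g. weak_deriv j I f g \<and> continuous_on {0..t0} g \<and> g 0 = 0"
    using f unfolding hankel_dom_def by blast
  then obtain g where g: "\<And>j. j < K \<Longrightarrow> weak_deriv j I f (g j)"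
    "\<And>j. j < K \<Longrightarrow> continuous_on {0..t0} (g j)" "\<And>j. j < K \<Longrightarrow> g j 0 = 0"
    by metis
  define \<gamma> where "\<gamma> k = (if k < K then g k else top)" for k
  have w: "weak_deriv k I f (\<gamma> k)" if "k \<le> K" for k using that g(1) top(2) by (auto simp: \<gamma>_def)
  have L: "L2_fun I (\<gamma> k)" if "k \<le> K" for k using that L2_fun_continuous[OF g(2)] top(1) by (auto simp: \<gamma>_def)
  define G where "G k = emb t0 (\<gamma> k)" for k
  have PG: "P (G k) = G k" if "k \<le> K" for k unfolding G_def by (rule restr_emb[OF L[OF that]])
  have wG: "cinner_L2 (emb t0 f) (test_vec ((deriv ^^ k) \<phi>)) = (-1) ^ k * cinner_L2 (G k) (test_vec \<phi>)"
    if "k \<le> K" "test_function I \<phi>" for k \<phi>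
    using w[OF that(1)] that(2) unfolding weak_deriv_iff[OF fI L[OF that(1)]] G_def by blast
  have step: "G k = V (G (Suc k))" if k: "k < K" for k
  proof -
    define x where "x = G k - V (G (Suc k))"
    have Px: "P x = x" unfolding x_def using PG k by (simp add: cblinear_diff[OF cblinear_restr])
    obtain c where c: "x = cscale c one"
    proof (rule du_Bois_Reymond[OF Px])
      fix \<phi> assume \<phi>: "test_function I \<phi>"
      have "(-1) ^ k * cinner_L2 (G k) (test_vec (deriv \<phi>)) = cinner_L2 (emb t0 f) (test_vec ((deriv ^^ k) (deriv \<phi>)))"
        using wG[of k "deriv \<phi>"] test_function_deriv[OF \<phi>] k by simp
      also have "\<dots> = (-1) ^ Suc k * cinner_L2 (G (Suc k)) (test_vec \<phi>)"
        using wG[of "Suc k" \<phi>] \<phi> k by (simp add: funpow_swap1)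
      also have "\<dots> = (-1) ^ k * cinner_L2 (V (G (Suc k))) (test_vec (deriv \<phi>))"
        unfolding cinner_prim_test_vec_deriv[OF \<phi>] by simp
      finally show "cinner_L2 x (test_vec (deriv \<phi>)) = 0" unfolding x_def by (simp add: cinner_diff_left)
    qed blast
    have "G k = V (G (Suc k)) + cscale c one" using c unfolding x_def by (simp add: algebra_simps)
    also have "\<dots> = emb t0 (\<lambda>t. cinner_L2 (G (Suc k)) (\<eta> t) + c * 1)"
      unfolding prim_def emb_cscale[OF L2_fun_const] by (rule emb_add[OF L2_fun_cinner_chi L2_fun_const])
    finally have "ae_eq I (g k) (\<lambda>t. cinner_L2 (G (Suc k)) (\<eta> t) + c * 1)"
      using k emb_eq_iff[OF L2_fun_continuous[OF g(2)[OF k]] L2_fun_add[OF L2_fun_cinner_chi L2_fun_const]]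
      unfolding G_def[of k] \<gamma>_def by simp
    then have "AE t in lborel. t \<in> I \<longrightarrow> g k t - cinner_L2 (G (Suc k)) (\<eta> t) = c"
      unfolding ae_eq_def by eventually_elim auto
    from continuous_eq_const_at_0[OF continuous_on_diff[OF g(2)[OF k] continuous_on_cinner_chi] this]
    have "c = 0" using g(3)[OF k] by simp
    then show ?thesis using c unfolding x_def by simp
  qed
  have GK: "G k = (V ^^ (K - k)) (G K)" if "k \<le> K" for k
    using that
  proof (induction "K - k" arbitrary: k)
    case (Suc j)
    then have k: "k < K" and j: "j = K - Suc k" and eq: "Suc (K - Suc k) = K - k" by auto
    have "G k = V ((V ^^ (K - Suc k)) (G K))" using step[OF k] Suc.hyps(1)[of "Suc k", OF j] k by simp
    also have "\<dots> = (V ^^ Suc (K - Suc k)) (G K)" by simp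
    finally show ?case unfolding eq .
  qed simp
  have f0: "emb t0 f = G 0"
  proof -
    have "emb t0 f - G 0 = 0"
    proof (rule eq_0_if_orthogonal_to_tests)
      show "P (emb t0 f - G 0) = emb t0 f - G 0"
        using PG[of 0] by (simp add: cblinear_diff[OF cblinear_restr] restr_emb[OF fI])
      show "cinner_L2 (emb t0 f - G 0) (test_vec \<phi>) = 0" if "test_function I \<phi>" for \<phi>
        using wG[of 0 \<phi>] that by (simp add: cinner_diff_left)
    qed
    then show ?thesis by simp
  qed
  show thesis
  proof (rule that[of "G K" \<gamma>])
    show "emb t0 f = (V ^^ K) (G K)" using f0 GK[of 0] by simp
    show "emb t0 (\<gamma> k) = (V ^^ (K - k)) (G K)" if "k \<le> K" for k using GK[OF that] by (simp add: G_def)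
  qed (use w L PG in auto)
qed

lemma restr_eq_iff_vanishing:
  assumes g: "L2_fun {0<..} g"
  shows "P (abs_L2 g) = abs_L2 g \<longleftrightarrow> ae_eq {t0<..} g (\<lambda>t. 0)"
proof -
  have "P (abs_L2 g) = abs_L2 g \<longleftrightarrow> ae_eq {0<..} (\<lambda>t. indicator I t *\<^sub>R g t) g"
    unfolding restr_abs[OF g] unfolding emb_def by (rule abs_L2_eq_iff[OF L2_fun_indicator[OF L2_fun_I[OF g]] g])
  also have "\<dots> \<longleftrightarrow> ae_eq {t0<..} g (\<lambda>t. 0)"
  proof
    assume "ae_eq {0<..} (\<lambda>t. indicator I t *\<^sub>R g t) g"
    then show "ae_eq {t0<..} g (\<lambda>t. 0)" unfolding ae_eq_def
      by eventually_elim (use t0 in \<open>auto simp: indicator_def split: if_splits\<close>)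
  next
    assume "ae_eq {t0<..} g (\<lambda>t. 0)"
    then show "ae_eq {0<..} (\<lambda>t. indicator I t *\<^sub>R g t) g" unfolding ae_eq_def
      using AE_lborel_singleton[of t0]
    proof eventually_elim
      case (elim t)
      then show ?case by (cases "t < t0") auto
    qed
  qed
  finally show ?thesis .
qed

text \<open>A pair in the graph comes from $y = u^{(K)}$ with $u = V^Ky$ on $(0,t_0)$, by the boundary
  conditions at $0$; the equation then says $Jv = Dy$. So $H$ is inverse to $T$ on $(0,t_0)$.\<close>

theorem hankel_op_iff: "(u, v) \<in> hankel_op K h t0 \<longleftrightarrow> P v = v \<and> P u = T v"
proof
  assume "(u, v) \<in> hankel_op K h t0"
  then obtain f g d where f: "u = abs_L2 f" "f \<in> hankel_dom K t0" and g: "v = abs_L2 g" "L2_fun {0<..} g"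
    and d': "\<forall>k\<le>K. weak_deriv k I f (d k)"
    and eq: "ae_eq I g (\<lambda>t. \<Sum>k\<le>K. (- 1) ^ k * of_real (h k) * d k (t0 - t))"
    and van: "ae_eq {t0<..} g (\<lambda>t. 0)"
    unfolding hankel_op_def mem_Collect_eq prod.inject by (elim exE conjE) (rule that; assumption)
  have d: "weak_deriv k I f (d k)" if "k \<le> K" for k using d' that by simp
  obtain \<gamma> y where y: "P y = y" "emb t0 f = (V ^^ K) y" and w: "\<And>k. k \<le> K \<Longrightarrow> weak_deriv k I f (\<gamma> k)"
    and L: "\<And>k. k \<le> K \<Longrightarrow> L2_fun I (\<gamma> k)" and e: "\<And>k. k \<le> K \<Longrightarrow> emb t0 (\<gamma> k) = (V ^^ (K - k)) y"
    by (rule hankel_dom_primitives[OF f(2)]) (rule that; assumption)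
  have D: "L2_fun I (\<lambda>t. \<Sum>k\<le>K. (- 1) ^ k * of_real (h k) * \<gamma> k t)"
    "D y = emb t0 (\<lambda>t. \<Sum>k\<le>K. (- 1) ^ k * of_real (h k) * \<gamma> k t)"
    by (rule emb_D[of \<gamma> y]; erule L e)+
  have Pv: "P v = v" using restr_eq_iff_vanishing[OF g(2)] van g(1) by simp
  have "ae_eq I (\<lambda>t. g (t0 - t)) (\<lambda>t. \<Sum>k\<le>K. (- 1) ^ k * of_real (h k) * \<gamma> k t)"
  proof -
    have "AE t in lborel. \<forall>k\<in>{..K}. t \<in> I \<longrightarrow> d k t = \<gamma> k t"
      using weak_deriv_unique[OF d w] unfolding ae_eq_def by (intro AE_finite_allI) auto
    then show ?thesis using ae_eq_refl_I[OF eq] unfolding ae_eq_def by eventually_elim auto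
  qed
  then have "emb t0 (\<lambda>t. g (t0 - t)) = D y"
    unfolding D(2) by (subst emb_eq_iff[OF L2_fun_refl[OF L2_fun_I[OF g(2)]] D(1)])
  then have "J v = D y" unfolding g(1) refl_abs[OF g(2)] .
  then have "T v = (V ^^ K) y" unfolding T_def by simp
  also have "\<dots> = P u" unfolding f(1) y(2)[symmetric] using f(2)
    by (subst restr_abs) (auto simp: hankel_dom_def)
  finally show "P v = v \<and> P u = T v" using Pv by simp
next
  assume uv: "P v = v \<and> P u = T v"
  define y where "y = Y (J v)"
  have y: "P y = y" "J v = D y" unfolding y_def by (simp_all add: restr_Y)
  have f: "emb t0 (rep_L2 u) = (V ^^ K) y" using uv unfolding restr_def T_def y_def by simp
  have w: "weak_deriv k I (rep_L2 u) (prim_fun (K - k) y)" if "k \<le> K" for k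
    by (rule weak_deriv_prim_fun[OF L2_fun_rep_I f y(1) that])
  note D = emb_D[of "\<lambda>k. prim_fun (K - k) y" y, OF L2_fun_prim_fun emb_prim_fun[OF y(1)]]
  have dom: "rep_L2 u \<in> hankel_dom K t0"
    unfolding hankel_dom_def sobolev_def
  proof (intro CollectI conjI allI impI L2_fun_rep L2_fun_rep_I)
    show "\<exists>g. L2_fun I g \<and> weak_deriv k I (rep_L2 u) g" if "k \<le> K" for k
      by (intro exI[of _ "prim_fun (K - k) y"] conjI L2_fun_prim_fun w that)
    show "\<exists>g. weak_deriv j I (rep_L2 u) g \<and> continuous_on {0..t0} g \<and> g 0 = 0" if jK: "j < K" for j
    proof (intro exI conjI)
      show "weak_deriv j I (rep_L2 u) (prim_fun (K - j) y)" using that by (intro w) simp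
      obtain i where i: "K - j = Suc i" using jK by (cases "K - j") simp_all
      have "prim_fun (K - j) y = (\<lambda>t. cinner_L2 ((V ^^ i) y) (\<eta> t))" unfolding i by (simp add: prim_fun_def[abs_def])
      then show "continuous_on {0..t0} (prim_fun (K - j) y)" "prim_fun (K - j) y 0 = 0"
        by (simp_all only: continuous_on_cinner_chi chi_0 cinner_zero_right)
    qed
  qed
  have "v = J (D y)" using uv unfolding y(2)[symmetric] by simp
  also have "\<dots> = emb t0 (\<lambda>t. \<Sum>k\<le>K. (- 1) ^ k * of_real (h k) * prim_fun (K - k) y (t0 - t))"
    unfolding D(2) by (rule refl_emb[OF D(1)])
  finally have "emb t0 (rep_L2 v) = emb t0 (\<lambda>t. \<Sum>k\<le>K. (- 1) ^ k * of_real (h k) * prim_fun (K - k) y (t0 - t))"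
    using uv by (simp add: restr_def)
  then have eq: "ae_eq I (rep_L2 v) (\<lambda>t. \<Sum>k\<le>K. (- 1) ^ k * of_real (h k) * prim_fun (K - k) y (t0 - t))"
    by (subst (asm) emb_eq_iff[OF L2_fun_rep_I L2_fun_refl[OF D(1)]])
  have "ae_eq {t0<..} (rep_L2 v) (\<lambda>t. 0)"
    using restr_eq_iff_vanishing[OF L2_fun_rep, of v] uv by (simp add: abs_rep_L2)
  then have "(abs_L2 (rep_L2 u), abs_L2 (rep_L2 v)) \<in> hankel_op K h t0"
    unfolding hankel_op_def mem_Collect_eq
    using dom L2_fun_rep[of v] w eq
    by (intro exI[of _ "rep_L2 u"] exI[of _ "rep_L2 v"] exI[of _ "\<lambda>k. prim_fun (K - k) y"] conjI allI impI refl) assumption+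
  then show "(u, v) \<in> hankel_op K h t0" by (simp add: abs_rep_L2)
qed

end

context interval
begin

definition harmonic :: "real \<Rightarrow> L2" where "harmonic l = emb t0 (\<lambda>t. exp (\<i> * of_real l * of_real t))"

lemma continuous_on_harmonic: "continuous_on S (\<lambda>t. exp (\<i> * of_real l * complex_of_real t))"
  by (intro continuous_intros)

lemma L2_fun_harmonic: "L2_fun I (\<lambda>t. exp (\<i> * of_real l * complex_of_real t))"
  by (rule L2_fun_continuous[OF continuous_on_harmonic])

lemma harmonic_has_derivative:
  "((\<lambda>t. exp (\<i> * of_real l * complex_of_real t)) has_vector_derivative
      \<i> * of_real l * exp (\<i> * of_real l * complex_of_real t)) (at t within S)"
proof -
  have "((\<lambda>z. exp (\<i> * of_real l * z)) has_field_derivative \<i> * of_real l * exp (\<i> * of_real l * of_real t)) (at (of_real t))"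
    by (auto intro!: derivative_eq_intros)
  from has_vector_derivative_real_field[OF this] show ?thesis .
qed

text \<open>The initial value problem $f' = ilf$, $f(0) = 1$ in integrated form.\<close>

lemma harmonic_eq: "harmonic l = one + cscale (\<i> * of_real l) (V (harmonic l))"
proof -
  have "harmonic l = cscale (exp (\<i> * of_real l * complex_of_real 0)) one
      + V (emb t0 (\<lambda>t. \<i> * of_real l * exp (\<i> * of_real l * complex_of_real t)))"
    unfolding harmonic_def
    by (rule emb_primitive[OF _ harmonic_has_derivative]) (intro continuous_intros)
  also have "emb t0 (\<lambda>t. \<i> * of_real l * exp (\<i> * of_real l * complex_of_real t)) = cscale (\<i> * of_real l) (harmonic l)"
    unfolding harmonic_def by (rule emb_cscale[OF L2_fun_harmonic, symmetric])
  finally show ?thesis by (simp add: cblinear_cscale[OF cblinear_prim])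
qed

lemma harmonic_0 [simp]: "harmonic 0 = one"
  by (simp add: harmonic_def)

lemma restr_harmonic [simp]: "P (harmonic l) = harmonic l"
  unfolding harmonic_def by (rule restr_emb[OF L2_fun_harmonic])

lemma cinner_harmonic: "cinner_L2 (harmonic l) (harmonic k) = cinner_L2 (harmonic (l - k)) one"
proof -
  have "exp (\<i> * of_real l * complex_of_real t) * cnj (exp (\<i> * of_real k * complex_of_real t))
      = exp (\<i> * of_real (l - k) * complex_of_real t) * cnj 1" for t
    unfolding exp_cnj by (simp add: left_diff_distrib right_diff_distrib exp_diff exp_minus divide_inverse)
  then show ?thesis
    unfolding harmonic_def cinner_emb[OF L2_fun_harmonic L2_fun_harmonic] cinner_emb[OF L2_fun_harmonic L2_fun_const] by (simp only:)
qed

lemma cinner_one_one: "cinner_L2 one one = of_real t0"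
  using t0 unfolding cinner_emb[OF L2_fun_const L2_fun_const] by (simp add: set_lebesgue_integral_def scaleR_conv_of_real)

lemma cinner_harmonic_one:
  "\<i> * of_real l * cinner_L2 (harmonic l) one = exp (\<i> * of_real l * of_real t0) - 1"
proof (cases "l = 0")
  case False
  have "cinner_L2 (harmonic l) one = (LINT t:I|lborel. exp (\<i> * of_real l * complex_of_real t))"
    unfolding harmonic_def cinner_emb[OF L2_fun_harmonic L2_fun_const] by simp
  also have "\<dots> = exp (\<i> * of_real l * of_real t0) / (\<i> * of_real l) - exp (\<i> * of_real l * of_real 0) / (\<i> * of_real l)"
  proof (rule LINT_FTC[OF _ continuous_on_harmonic])
    show "((\<lambda>t. exp (\<i> * of_real l * complex_of_real t) / (\<i> * of_real l)) has_vector_derivative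
        exp (\<i> * of_real l * complex_of_real x)) (at x within {0..t0})" for x
      using has_vector_derivative_divide[OF harmonic_has_derivative[of l x "{0..t0}"], of "\<i> * of_real l"] False by simp
  qed (use t0 in simp)
  finally show ?thesis using False by (simp add: field_simps)
qed simp

definition \<omega> :: "int \<Rightarrow> real" where "\<omega> m = 2 * pi * of_int m / t0"

abbreviation "e m \<equiv> harmonic (\<omega> m)"

lemma \<omega>_minus: "\<omega> (- m) = - \<omega> m" and \<omega>_0 [simp]: "\<omega> 0 = 0"
  by (simp_all add: \<omega>_def)

lemma \<omega>_eq_0_iff [simp]: "\<omega> m = 0 \<longleftrightarrow> m = 0"
  using t0 by (simp add: \<omega>_def)

lemma exp_period: "exp (\<i> * of_real (\<omega> m) * of_real t0) = 1"
proof -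
  have "\<i> * of_real (\<omega> m) * of_real t0 = of_int (2 * m) * of_real pi * \<i>"
    using t0 by (simp add: \<omega>_def)
  then show ?thesis using exp_eq_1[of "\<i> * of_real (\<omega> m) * of_real t0"] by (simp add: mult_ac)
qed

lemma refl_e [simp]: "J (e m) = e (- m)"
proof -
  have "exp (\<i> * of_real (\<omega> m) * complex_of_real (t0 - t)) = exp (\<i> * of_real (\<omega> (- m)) * complex_of_real t)" for t
    using exp_period[of m] by (simp add: \<omega>_minus right_diff_distrib exp_diff exp_minus field_simps)
  then show ?thesis unfolding harmonic_def by (subst refl_emb[OF L2_fun_harmonic]) simp
qed

lemma cinner_e: "cinner_L2 (e m) (e n) = (if m = n then of_real t0 else 0)"
proof (cases "m = n")
  case False
  have "\<omega> m - \<omega> n = \<omega> (m - n)" by (simp add: \<omega>_def right_diff_distrib diff_divide_distrib)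
  then have "cinner_L2 (e m) (e n) = cinner_L2 (e (m - n)) one" by (simp add: cinner_harmonic)
  moreover have "\<i> * of_real (\<omega> (m - n)) * cinner_L2 (e (m - n)) one = 0"
    unfolding cinner_harmonic_one exp_period by simp
  ultimately show ?thesis using False by simp
qed (simp add: cinner_harmonic cinner_one_one)

lemma cinner_e_one: "m \<noteq> 0 \<Longrightarrow> cinner_L2 (e m) one = 0"
  using cinner_e[of m 0] by simp

lemma refl_chi: assumes "t \<in> {0..t0}" shows "J (\<eta> (t0 - t)) = one - \<eta> t"
proof -
  have "one - \<eta> t = emb t0 (\<lambda>s. 1 + (-1) * indicator {0<..<t} s)"
    unfolding minus_L2_def chi_def
    by (simp only: emb_cscale[OF L2_fun_chi] emb_add[OF L2_fun_const L2_fun_cmult[OF L2_fun_chi]])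
  also have "\<dots> = emb t0 (\<lambda>s. indicator {0<..<t0 - t} (t0 - s))"
  proof (subst emb_eq_iff)
    show "ae_eq I (\<lambda>s. 1 + (-1) * indicator {0<..<t} s) (\<lambda>s. indicator {0<..<t0 - t} (t0 - s) :: complex)"
      unfolding ae_eq_def using AE_lborel_singleton[of t]
      by eventually_elim (auto simp: indicator_def)
  qed (intro L2_fun_add L2_fun_const L2_fun_cmult L2_fun_chi L2_fun_refl[OF L2_fun_chi])+
  also have "\<dots> = J (\<eta> (t0 - t))" unfolding chi_def by (rule refl_emb[OF L2_fun_chi, symmetric])
  finally show ?thesis by simp
qed

text \<open>$\int_0^t u + \int_t^{t_0} u$ does not depend on $t$. So $V + V^*$ has rank one, and on functions of mean
  zero $V$ is skew-symmetric and anticommutes with $J$.\<close>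

lemma prim_plus_adjoint: "V u + J (V (J u)) = cscale (cinner_L2 u one) one"
proof -
  have "J (V (J u)) = emb t0 (\<lambda>t. cinner_L2 (J u) (\<eta> (t0 - t)))"
    unfolding prim_def by (rule refl_emb[OF L2_fun_cinner_chi])
  also have "\<dots> = emb t0 (\<lambda>t. cinner_L2 u one * 1 + (-1) * cinner_L2 u (\<eta> t))"
    by (intro emb_cong) (simp add: refl_sym refl_chi cinner_diff_right)
  also have "\<dots> = cscale (cinner_L2 u one) one + cscale (-1) (V u)"
    unfolding prim_def
    by (simp only: emb_cscale[OF L2_fun_const] emb_cscale[OF L2_fun_cinner_chi]
        emb_add[OF L2_fun_cmult[OF L2_fun_const] L2_fun_cmult[OF L2_fun_cinner_chi]])
  finally show ?thesis by simp
qed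

lemma refl_prim: assumes "cinner_L2 u one = 0" shows "J (V u) = - V (J u)"
proof -
  have "cinner_L2 (J u) one = 0" using assms by (simp add: refl_sym)
  then have "V (J u) + J (V u) = 0" using prim_plus_adjoint[of "J u"] by simp
  then show ?thesis by (simp add: eq_neg_iff_add_eq_0 add.commute)
qed

text \<open>Integration by parts: $Vu$ vanishes at both ends of the interval if $u$ has mean zero.\<close>

lemma cinner_prim_e:
  assumes "cinner_L2 u one = 0"
  shows "cinner_L2 u (e m) = \<i> * of_real (\<omega> m) * cinner_L2 (V u) (e m)"
proof -
  have "e m = J (e (- m))" by simp
  also have "\<dots> = one + cscale (\<i> * of_real (\<omega> (- m))) (J (V (e (- m))))"
    by (subst harmonic_eq) (simp only: refl_add refl_cscale refl_one)
  also have "e (- m) = J (e m)" by simp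
  finally have "e m = one + cscale (\<i> * of_real (\<omega> (- m))) (J (V (J (e m))))" .
  then have "cinner_L2 u (e m) = cinner_L2 u (one + cscale (\<i> * of_real (\<omega> (- m))) (J (V (J (e m)))))"
    by (rule arg_cong)
  also have "\<dots> = \<i> * of_real (\<omega> m) * cinner_L2 (V u) (e m)"
    unfolding prim_adjoint cinner_add_right assms cinner_cscale_right by (simp add: \<omega>_minus)
  finally show ?thesis .
qed

section \<open>Quantitative completeness of the trigonometric system\<close>

text \<open>The frequency $0$ is left out because only functions of mean zero are expanded.\<close>

definition modes :: "nat \<Rightarrow> int set" where "modes N = {- int N..int N} - {0}"

lemma finite_modes [simp]: "finite (modes N)" by (simp add: modes_def)

definition fourier_sum :: "nat \<Rightarrow> L2 \<Rightarrow> L2" where "fourier_sum N u = (\<Sum>m\<in>modes N. cscale (cinner_L2 u (e m) / t0) (e m))"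

lemma cinner_fourier_sum_e:
  "cinner_L2 (fourier_sum N u) (e n) = (if n \<in> modes N then cinner_L2 u (e n) else 0)"
proof -
  have "cinner_L2 (fourier_sum N u) (e n) = (\<Sum>m\<in>modes N. if m = n then cinner_L2 u (e n) else 0)"
    unfolding fourier_sum_def cinner_sum_left using t0
    by (intro sum.cong) (auto simp: cinner_e)
  then show ?thesis by simp
qed

lemma cinner_fourier_sum_left: "cinner_L2 (fourier_sum N u) v = (\<Sum>m\<in>modes N. cinner_L2 u (e m) * cnj (cinner_L2 v (e m)) / t0)"
  unfolding fourier_sum_def cinner_sum_left by (simp add: cinner_cnj)

lemma norm_minus_fourier_sum_le: "norm (u - fourier_sum N u) \<le> norm u"
proof -
  define x where "x = u - fourier_sum N u"
  have "cinner_L2 x (fourier_sum N u) = 0"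
    unfolding fourier_sum_def[of N u] cinner_sum_right
    by (intro sum.neutral) (simp add: x_def cinner_diff_left cinner_fourier_sum_e)
  then have "cinner_L2 x x = cinner_L2 x u" by (subst (2) x_def) (simp add: cinner_diff_right)
  then have "(norm x)\<^sup>2 = norm (cinner_L2 x u)" by (metis cinner_self norm_of_real abs_of_nonneg zero_le_power2)
  also have "\<dots> \<le> norm x * norm u" by (rule cinner_Cauchy_Schwarz)
  finally show ?thesis unfolding x_def[symmetric] by (cases "norm x = 0") (auto simp: power2_eq_square)
qed

lemma bessel: "(\<Sum>m\<in>modes N. (norm (cinner_L2 u (e m)))\<^sup>2 / t0) \<le> (norm u)\<^sup>2"
proof -
  let ?s = "\<Sum>m\<in>modes N. (norm (cinner_L2 u (e m)))\<^sup>2 / t0"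
  have 1: "cinner_L2 (fourier_sum N u) v = of_real ?s" if "\<And>m. m \<in> modes N \<Longrightarrow> cinner_L2 v (e m) = cinner_L2 u (e m)" for v
    unfolding cinner_fourier_sum_left of_real_sum
    by (intro sum.cong refl) (simp add: that complex_norm_square[symmetric] del: of_real_power)
  have s: "?s \<ge> 0" using t0 by (intro sum_nonneg) auto
  have "(norm (fourier_sum N u))\<^sup>2 = ?s"
    using 1[of "fourier_sum N u"] by (simp only: cinner_fourier_sum_e cinner_self of_real_eq_iff if_True)
  moreover have "?s \<le> norm (fourier_sum N u) * norm u"
    using cinner_Cauchy_Schwarz[of "fourier_sum N u" u] 1[of u] s by (simp add: norm_of_real del: of_real_sum)
  ultimately have "norm (fourier_sum N u) * norm (fourier_sum N u) \<le> norm (fourier_sum N u) * norm u" by (simp only: power2_eq_square)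
  then have "norm (fourier_sum N u) \<le> norm u" by (cases "norm (fourier_sum N u) = 0") auto
  then show ?thesis using \<open>(norm (fourier_sum N u))\<^sup>2 = ?s\<close> by (metis norm_ge_zero power_mono)
qed

text \<open>The orthogonal projection onto the functions on $(0,t_0)$ of mean zero.\<close>

definition Q :: "L2 \<Rightarrow> L2" where "Q u = P u - cscale (cinner_L2 u one / t0) one"

lemma cblinear_Q: "cblinear Q"
proof (rule cblinearI)
  show "Q (u + v) = Q u + Q v" for u v
    by (simp add: Q_def restr_add cinner_add_left add_divide_distrib L2.scale_left_distrib)
  show "Q (cscale c u) = cscale c (Q u)" for c u
    by (simp add: Q_def restr_cscale L2.scale_right_diff_distrib)
  show "norm (Q u) \<le> 2 * norm u" for u
  proof -
    have "norm one = sqrt t0"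
      using cinner_one_one unfolding cinner_self of_real_eq_iff by (metis norm_ge_zero real_sqrt_unique)
    then have "norm (cscale (cinner_L2 u one / t0) one) \<le> norm u * sqrt t0 / t0 * sqrt t0"
      using t0 cinner_Cauchy_Schwarz[of u one] by (simp add: norm_divide divide_right_mono mult_right_mono)
    also have "\<dots> = norm u" using t0 by (simp add: field_simps)
    finally show ?thesis
      using norm_restr_le[of u] norm_triangle_ineq4[of "P u" "cscale (cinner_L2 u one / t0) one"] unfolding Q_def by linarith
  qed
qed

lemma cinner_Q_one: "cinner_L2 (Q u) one = 0"
  using t0 by (simp add: Q_def cinner_diff_left cinner_one_one restr_sym)

lemma Q_id: "P u = u \<Longrightarrow> cinner_L2 u one = 0 \<Longrightarrow> Q u = u"
  by (simp add: Q_def)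

lemma Q_one [simp]: "Q one = 0"
  using t0 by (simp add: Q_def cinner_one_one)

lemma restr_Q [simp]: "P (Q u) = Q u"
  by (simp add: Q_def cblinear_diff[OF cblinear_restr] restr_cscale)

lemma Q_sym: "cinner_L2 (Q u) v = cinner_L2 u (Q v)"
  using cinner_cnj[of v one] by (simp add: Q_def cinner_diff_left cinner_diff_right restr_sym)

text \<open>Integration, compressed to functions of mean zero; there it is skew-symmetric, and the factor $i$ makes
  it symmetric. The harmonics are its eigenfunctions.\<close>

definition mean_free_prim :: "L2 \<Rightarrow> L2" where "mean_free_prim u = cscale \<i> (Q (V (Q u)))"

lemma cblinear_mean_free_prim: "cblinear mean_free_prim"
  unfolding mean_free_prim_def[abs_def]
  by (rule cblinear_cmult[OF cblinear_compose[OF cblinear_Q cblinear_compose[OF cblinear_prim cblinear_Q]]])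

lemma compact_operator_mean_free_prim: "compact_operator mean_free_prim"
  unfolding mean_free_prim_def[abs_def]
  by (rule compact_operator_compose_left[OF compact_operator_compose_right[OF compact_operator_prim
      cblinear_bounded_linear[OF cblinear_Q]] cblinear_bounded_linear[OF cblinear_cmult[OF cblinear_Q]]])

lemma mean_free_prim_sym: "cinner_L2 (mean_free_prim u) v = cinner_L2 u (mean_free_prim v)"
proof -
  have "J (V (J (Q v))) = - V (Q v)"
    using prim_plus_adjoint[of "Q v"] by (simp add: cinner_Q_one eq_neg_iff_add_eq_0 add.commute)
  then have "cinner_L2 (V (Q u)) (Q v) = - cinner_L2 (Q u) (V (Q v))" by (simp add: prim_adjoint)
  then show ?thesis by (simp add: mean_free_prim_def Q_sym)
qed

lemma mean_free_prim_e: assumes "m \<noteq> 0" shows "mean_free_prim (e m) = (1 / \<omega> m) *\<^sub>R e m"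
proof -
  have Qe: "Q (e m) = e m" by (rule Q_id) (simp_all add: cinner_e_one assms)
  have "Q (e m) = cscale (\<i> * of_real (\<omega> m)) (Q (V (e m)))"
    by (subst harmonic_eq) (simp add: cblinear_add[OF cblinear_Q] cblinear_cscale[OF cblinear_Q])
  then have "e m = cscale (\<i> * of_real (\<omega> m)) (Q (V (e m)))" unfolding Qe .
  then have "cscale (1 / of_real (\<omega> m)) (e m) = cscale (1 / of_real (\<omega> m)) (cscale (\<i> * of_real (\<omega> m)) (Q (V (e m))))"
    by (rule arg_cong)
  also have "\<dots> = cscale \<i> (Q (V (e m)))" using assms by simp
  finally show ?thesis by (simp add: mean_free_prim_def Qe scaleR_eq_cscale)
qed

definition high_modes :: "nat \<Rightarrow> L2 set"
  where "high_modes N = {u. P u = u \<and> cinner_L2 u one = 0 \<and> (\<forall>m\<in>modes N. cinner_L2 u (e m) = 0)}"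

lemma high_modes_props: "subspace (high_modes N)" "closed (high_modes N)" "u \<in> high_modes N \<Longrightarrow> mean_free_prim u \<in> high_modes N"
proof -
  show "subspace (high_modes N)" unfolding subspace_def high_modes_def
    by (auto simp: restr_add cinner_add_left cblinear_zero[OF cblinear_restr] scaleR_eq_cscale restr_cscale)
  have "high_modes N = {u. P u = u} \<inter> {u. cinner_L2 u one = 0} \<inter> (\<Inter>m\<in>modes N. {u. cinner_L2 u (e m) = 0})"
    by (auto simp: high_modes_def)
  moreover have "closed {u. P u = u}"
    by (rule closed_Collect_eq[OF linear_continuous_on[OF cblinear_bounded_linear[OF cblinear_restr]] continuous_on_id])
  ultimately show "closed (high_modes N)" by (auto intro!: closed_Int closed_INT closed_cinner)
  assume u: "u \<in> high_modes N"
  have "cinner_L2 (mean_free_prim u) (e m) = 0" if m: "m \<in> modes N" for m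
  proof -
    have "m \<noteq> 0" "cinner_L2 u (e m) = 0" using m u by (auto simp: modes_def high_modes_def)
    then show ?thesis unfolding mean_free_prim_sym mean_free_prim_e[OF \<open>m \<noteq> 0\<close>] cinner_scaleR_right by simp
  qed
  moreover have "P (mean_free_prim u) = mean_free_prim u" "cinner_L2 (mean_free_prim u) one = 0"
    by (simp_all only: mean_free_prim_def restr_cscale restr_Q cinner_cscale_left cinner_Q_one) simp
  ultimately show "mean_free_prim u \<in> high_modes N" by (simp add: high_modes_def)
qed

text \<open>With $l = 1/\kappa$ the eigenvalue equation says that $\phi$ is a multiple of $e^{ilt}$, up to a
  solution of a homogeneous Volterra equation, which is $0$. Mean zero makes $l$ a frequency $2\pi n/t_0$, and
  orthogonality to the modes up to $N$ makes $|n| > N$.\<close>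

lemma mean_free_prim_eigenvector:
  assumes \<phi>: "\<phi> \<in> high_modes N" "\<phi> \<noteq> 0" and eig: "mean_free_prim \<phi> = \<kappa> *\<^sub>R \<phi>" "\<kappa> \<noteq> 0"
  shows "\<bar>\<kappa>\<bar> \<le> t0 / (2 * pi * real (N + 1))"
proof -
  define l where "l = 1 / \<kappa>"
  define c where "c = \<i> * of_real l"
  have one0: "cinner_L2 \<phi> one = 0" and P\<phi>: "P \<phi> = \<phi>" using \<phi>(1) by (auto simp: high_modes_def)
  define b where "b = - (c * cinner_L2 (V \<phi>) one / t0)"
  have "\<phi> = cscale (of_real l) (mean_free_prim \<phi>)"
    using eig by (simp add: l_def scaleR_eq_cscale)
  also have "\<dots> = cscale c (Q (V \<phi>))" by (simp add: mean_free_prim_def Q_id[OF P\<phi> one0] c_def mult.commute)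
  also have "\<dots> = cscale c (V \<phi>) + cscale b one"
    by (simp add: Q_def L2.scale_right_diff_distrib b_def)
  finally have e1: "\<phi> = cscale c (V \<phi>) + cscale b one" .
  define y where "y = \<phi> - cscale b (harmonic l)"
  have e2: "cscale b (harmonic l) = cscale b one + cscale c (V (cscale b (harmonic l)))"
    by (subst harmonic_eq) (simp add: L2.scale_right_distrib cblinear_cscale[OF cblinear_prim] c_def mult.commute)
  have "y = cscale c (V y)"
    unfolding y_def cblinear_diff[OF cblinear_prim] L2.scale_right_diff_distrib
    using arg_cong2[OF e1 e2, of "(-)"] by simp
  then have "y - V (cscale c y) = 0" by (simp add: cblinear_cscale[OF cblinear_prim])
  moreover obtain C where "\<And>y. norm y \<le> C * norm (y - V (cscale c y))"
    using volterra_solution[of "cscale c"] cblinear_cmult[OF cblinear_id, of c]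
    by (metis cblinear_cscale[OF cblinear_prim])
  ultimately have "y = 0" by (metis mult_zero_right norm_le_zero_iff norm_zero)
  then have \<phi>_eq: "\<phi> = cscale b (harmonic l)" by (simp add: y_def)
  then have b: "b \<noteq> 0" using \<phi>(2) by auto
  have "cinner_L2 (harmonic l) one = 0" using one0 b unfolding \<phi>_eq by simp
  then have "exp (\<i> * of_real l * of_real t0) = 1" using cinner_harmonic_one[of l] by simp
  then obtain n :: int where n: "l * t0 = of_int (2 * n) * pi"
    using exp_eq_1[of "\<i> * of_real l * of_real t0"] by auto
  then have l: "l = \<omega> n" using t0 by (simp add: \<omega>_def field_simps)
  have "l \<noteq> 0" using eig by (simp add: l_def)
  then have "n \<noteq> 0" using l by auto
  moreover have "n \<notin> modes N"
  proof
    assume "n \<in> modes N"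
    then have "cinner_L2 \<phi> (e n) = 0" using \<phi>(1) by (auto simp: high_modes_def)
    then show False using b t0 unfolding \<phi>_eq l by (simp add: cinner_e)
  qed
  ultimately have "real (N + 1) \<le> \<bar>of_int n\<bar>" unfolding modes_def by auto
  then have "2 * pi * real (N + 1) / t0 \<le> \<bar>l\<bar>"
    unfolding l \<omega>_def using t0 by (simp add: abs_mult divide_right_mono)
  then have "1 / \<bar>l\<bar> \<le> 1 / (2 * pi * real (N + 1) / t0)"
    using t0 \<open>l \<noteq> 0\<close> by (intro divide_left_mono) auto
  moreover have "\<bar>\<kappa>\<bar> = 1 / \<bar>l\<bar>" using eig by (simp add: l_def)
  ultimately show ?thesis by simp
qed

text \<open>Otherwise the maximum principle, applied to plus or minus the operator, would produce an eigenvector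
  that \<open>mean_free_prim_eigenvector\<close> excludes.\<close>

lemma mean_free_prim_high_le:
  assumes "u \<in> high_modes N"
  shows "norm (mean_free_prim u) \<le> (t0 / (2 * pi * real (N + 1))) * norm u"
proof (rule norm_le_of_form_bound[OF cblinear_linear[OF cblinear_mean_free_prim] _ high_modes_props(1,3) _ assms])
  show "inner (mean_free_prim u) v = inner u (mean_free_prim v)" for u v by (simp add: inner_L2_def mean_free_prim_sym)
  fix u assume u: "u \<in> high_modes N"
  define c where "c = t0 / (2 * pi * real (N + 1))"
  have c: "c > 0" using t0 by (simp add: c_def)
  have *: "inner (s *\<^sub>R mean_free_prim u) u \<le> c * (norm u)\<^sup>2" if s: "\<bar>s\<bar> = 1" for s :: real
  proof (rule ccontr)
    assume n: "\<not> ?thesis"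
    have A: "cblinear (\<lambda>u. s *\<^sub>R mean_free_prim u)" by (rule cblinear_scaleR[OF cblinear_mean_free_prim])
    have pos: "inner (s *\<^sub>R mean_free_prim u) u > 0" using n c by (meson not_le order_le_less_trans mult_nonneg_nonneg less_imp_le zero_le_power2)
    have inv: "s *\<^sub>R mean_free_prim v \<in> high_modes N" if "v \<in> high_modes N" for v
      using high_modes_props that by (intro subspace_scale) auto
    obtain \<mu> \<phi> where \<mu>: "0 < \<mu>" "\<phi> \<in> high_modes N" "norm \<phi> = 1" "s *\<^sub>R mean_free_prim \<phi> = \<mu> *\<^sub>R \<phi>"
      "\<And>u. u \<in> high_modes N \<Longrightarrow> inner (s *\<^sub>R mean_free_prim u) u \<le> \<mu> * (norm u)\<^sup>2"
    proof (rule maximum_principle[OF cblinear_bounded_linear[OF A] _ _ high_modes_props(1,2) inv u pos])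
      show "compact_operator (\<lambda>u. s *\<^sub>R mean_free_prim u)"
        by (rule compact_operator_compose_left[OF compact_operator_mean_free_prim bounded_linear_scaleR_right])
      show "inner (s *\<^sub>R mean_free_prim u) v = inner u (s *\<^sub>R mean_free_prim v)" for u v by (simp add: inner_L2_def mean_free_prim_sym)
    next
      fix \<mu> \<phi>
      assume "0 < \<mu>" "\<phi> \<in> high_modes N" "norm \<phi> = 1" "s *\<^sub>R mean_free_prim \<phi> = \<mu> *\<^sub>R \<phi>"
        "\<And>u. u \<in> high_modes N \<Longrightarrow> inner (s *\<^sub>R mean_free_prim u) u \<le> \<mu> * (norm u)\<^sup>2"
      then show thesis by (rule that)
    qed
    have "s * s = 1" using s by (metis abs_mult_self_eq mult_1)
    then have "mean_free_prim \<phi> = (s * \<mu>) *\<^sub>R \<phi>" using arg_cong[OF \<mu>(4), of "\<lambda>x. s *\<^sub>R x"] by simp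
    then have "\<bar>s * \<mu>\<bar> \<le> c" unfolding c_def
      using \<mu>(1-3) s by (intro mean_free_prim_eigenvector[of \<phi>]) auto
    then have "\<mu> \<le> c" using \<mu>(1) s by (simp add: abs_mult)
    then show False using \<mu>(5)[OF u] n by (meson mult_right_mono not_le order_trans zero_le_power2)
  qed
  show "\<bar>inner (mean_free_prim u) u\<bar> \<le> t0 / (2 * pi * real (N + 1)) * (norm u)\<^sup>2"
    using *[of 1] *[of "-1"] by (simp add: c_def)
qed

text \<open>The compressed integration maps $x$ minus its Fourier sum to $Vx$ minus its Fourier sum, up to the
  factor $i$.\<close>

lemma fourier_approximation:
  assumes x: "cinner_L2 x one = 0" and f: "cinner_L2 (V x) one = 0"
  shows "norm (V x - fourier_sum N (V x)) \<le> (t0 / (2 * pi * real (N + 1))) * norm x"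
proof -
  define x' where "x' = P x - fourier_sum N x"
  have restr_fourier_sum: "P (fourier_sum N x) = fourier_sum N x" for x
    unfolding fourier_sum_def by (simp add: cblinear_sum[OF cblinear_restr] restr_cscale)
  have fourier_sum_one: "cinner_L2 (fourier_sum N x) one = 0" for x
    using cinner_fourier_sum_e[of N x 0] by (simp add: modes_def)
  have "x' \<in> high_modes N"
    unfolding high_modes_def x'_def
    by (auto simp: cblinear_diff[OF cblinear_restr] restr_fourier_sum cinner_diff_left restr_sym x fourier_sum_one cinner_fourier_sum_e)
  have fourier_sum_P: "fourier_sum N (P x) = fourier_sum N x" by (simp add: fourier_sum_def restr_sym)
  have "mean_free_prim x' = cscale \<i> (V x - fourier_sum N (V x))"
  proof -
    have "mean_free_prim (P x) = cscale \<i> (V x)"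
      unfolding mean_free_prim_def by (subst (2) Q_id) (simp_all add: restr_sym x f Q_id)
    moreover have "mean_free_prim (fourier_sum N x) = cscale \<i> (fourier_sum N (V x))"
      unfolding fourier_sum_def cblinear_sum[OF cblinear_mean_free_prim] L2.scale_sum_right
    proof (rule sum.cong[OF refl])
      fix m assume "m \<in> modes N"
      then have m: "m \<noteq> 0" by (simp add: modes_def)
      have "cinner_L2 x (e m) / of_real t0 * (1 / of_real (\<omega> m)) = \<i> * (cinner_L2 (V x) (e m) / of_real t0)"
        using cinner_prim_e[OF x, of m] m by simp
      then show "mean_free_prim (cscale (cinner_L2 x (e m) / of_real t0) (e m)) = cscale \<i> (cscale (cinner_L2 (V x) (e m) / of_real t0) (e m))"
        unfolding cblinear_cscale[OF cblinear_mean_free_prim] mean_free_prim_e[OF m] scaleR_eq_cscale L2.scale_scale of_real_divide of_real_1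
        by (simp only:)
    qed
    ultimately show ?thesis unfolding x'_def cblinear_diff[OF cblinear_mean_free_prim] L2.scale_right_diff_distrib by simp
  qed
  then have "norm (V x - fourier_sum N (V x)) = norm (mean_free_prim x')" by simp
  also have "\<dots> \<le> (t0 / (2 * pi * real (N + 1))) * norm x'" by (rule mean_free_prim_high_le[OF \<open>x' \<in> high_modes N\<close>])
  also have "\<dots> \<le> (t0 / (2 * pi * real (N + 1))) * norm x"
  proof (intro mult_left_mono)
    show "norm x' \<le> norm x" unfolding x'_def fourier_sum_P[symmetric]
      using norm_minus_fourier_sum_le[of "P x" N] norm_restr_le[of x] by linarith
  qed (use t0 in simp)
  finally show ?thesis .
qed

end

context hankel
begin

section \<open>Comparison with the periodic problem\<close>

text \<open>The differential expression $\sum_k (-1)^k h_k (d/dt)^k$ multiplies $e^{i\omega_m t}$ by this number.\<close>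

definition symbol :: "int \<Rightarrow> complex" where "symbol m = (\<Sum>k\<le>K. of_real (coef k) * (\<i> * of_real (\<omega> m)) ^ k)"

lemma symbol_minus: "symbol (- m) = cnj (symbol m)"
  by (simp add: symbol_def \<omega>_minus)

text \<open>Chosen so that $J\sum_k (-1)^k h_k (d/dt)^k$ maps $e_m + \theta e_{-m}$ to $|p(m)|$ times itself, where
  $p$ is the symbol and $\theta$ the phase; for $e_m - \theta e_{-m}$ the factor is $-|p(m)|$. If $p(m) = 0$ any unimodular
  $\theta$ will do.\<close>

definition phase :: "int \<Rightarrow> complex" where "phase m = (if symbol m = 0 then 1 else symbol m / norm (symbol m))"

lemma norm_phase [simp]: "norm (phase m) = 1"
  by (simp add: phase_def norm_divide)

lemma symbol_eq_phase: "symbol m = phase m * of_real (norm (symbol m))"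
  by (simp add: phase_def)

lemma phase_cnj: "phase m * cnj (phase m) = 1"
  by (simp flip: complex_norm_square)

text \<open>The eigenfunctions of the periodic realization for the eigenvalues $|p(m)|$.\<close>

definition periodic_mode :: "nat \<Rightarrow> L2" where "periodic_mode m = e (int m) + cscale (phase m) (e (- int m))"

lemma cinner_periodic_mode: assumes "0 < m" "0 < n"
  shows "cinner_L2 (periodic_mode m) (periodic_mode n) = (if m = n then of_real (2 * t0) else 0)"
proof -
  have "int m \<noteq> - int n" "- int m \<noteq> int n" using assms by auto
  then show ?thesis
    by (auto simp: periodic_mode_def cinner_add_left cinner_add_right cinner_e phase_cnj mult.commute[of "cnj _"])
qed

text \<open>The $k$-th derivative of \<open>periodic_mode m\<close>, and its value at $0$ and at $t_0$.\<close>

definition mode_deriv :: "nat \<Rightarrow> nat \<Rightarrow> L2"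
  where "mode_deriv k m = cscale ((\<i> * of_real (\<omega> m)) ^ k) (e (int m))
    + cscale (phase m * (\<i> * of_real (\<omega> (- int m))) ^ k) (e (- int m))"

definition mode_deriv_at_0 :: "nat \<Rightarrow> nat \<Rightarrow> complex"
  where "mode_deriv_at_0 k m = (\<i> * of_real (\<omega> m)) ^ k + phase m * (\<i> * of_real (\<omega> (- int m))) ^ k"

lemma mode_deriv_eq: "mode_deriv k m = cscale (mode_deriv_at_0 k m) one + V (mode_deriv (Suc k) m)"
proof -
  have *: "cscale (c * (\<i> * of_real l) ^ k) (harmonic l)
      = cscale (c * (\<i> * of_real l) ^ k) one + V (cscale (c * (\<i> * of_real l) ^ Suc k) (harmonic l))" for c l
    by (subst harmonic_eq) (simp add: L2.scale_right_distrib cblinear_cscale[OF cblinear_prim] mult_ac)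
  show ?thesis unfolding mode_deriv_def mode_deriv_at_0_def
    by (simp only: *[of 1, unfolded mult_1] *[of "phase m"] cblinear_add[OF cblinear_prim] L2.scale_left_distrib)
       (simp only: add_ac)
qed

lemma mode_deriv_0: "mode_deriv 0 m = periodic_mode m"
  by (simp add: mode_deriv_def periodic_mode_def)

lemma restr_mode_deriv [simp]: "P (mode_deriv k m) = mode_deriv k m"
  by (simp add: mode_deriv_def restr_add restr_cscale)

lemma sum_coef_mode_deriv: "J (\<Sum>k\<le>K. coef k *\<^sub>R mode_deriv k m) = norm (symbol m) *\<^sub>R periodic_mode m"
proof -
  have "(\<Sum>k\<le>K. coef k *\<^sub>R mode_deriv k m) = cscale (symbol m) (e (int m)) + cscale (phase m * symbol (- int m)) (e (- int m))"
    unfolding mode_deriv_def symbol_def scaleR_eq_cscale L2.scale_right_distrib sum.distrib L2.scale_scale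
      L2.scale_sum_left sum_distrib_left by (simp add: mult_ac)
  moreover have "symbol (- int m) = cnj (phase m) * of_real (norm (symbol m))"
    unfolding symbol_minus by (subst symbol_eq_phase) simp
  then have "phase m * symbol (- int m) = of_real (norm (symbol m))"
    using phase_cnj[of m] by (simp add: mult.assoc[symmetric])
  ultimately show ?thesis
    by (subst (asm) symbol_eq_phase[of m])
       (simp add: refl_add refl_cscale periodic_mode_def scaleR_eq_cscale L2.scale_right_distrib mult.commute add.commute)
qed

text \<open>Test functions: combinations $f = \sum_m a_m v_m$ of the modes $v_m$ with $1 \le m \le n + K + 1$, subject to the
  $K$ boundary conditions at $0$ and to the $n$ orthogonality conditions on $g$. The boundary conditions put $f$ into
  the domain of $H$, so $f = Tg$ with $g = \sum_m a_m|p(m)|v_m$, and orthogonality of the modes gives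
  $\|g\|^2 \le \Lambda\langle f, g\rangle$.\<close>

lemma form_lower_bound:
  assumes \<Lambda>: "0 < \<Lambda>" "\<And>m. m \<in> {1..n + K + 1} \<Longrightarrow> norm (symbol (int m)) \<le> \<Lambda>"
  obtains g where "g \<noteq> 0" "\<And>i. i < n \<Longrightarrow> cinner_L2 g (b i) = 0" "(norm g)\<^sup>2 \<le> \<Lambda> * inner (T g) g"
proof -
  define idx where "idx = {1..n + K + 1}"
  have idx: "finite idx" "card idx > n + K" "\<And>m. m \<in> idx \<Longrightarrow> 0 < m" by (auto simp: idx_def)
  define l where "l i m = (if i < n then of_real (norm (symbol (int m))) * cinner_L2 (periodic_mode m) (b i) else mode_deriv_at_0 (i - n) m)" for i m
  obtain a where a: "\<exists>m\<in>idx. a m \<noteq> 0" "\<And>i. i < n + K \<Longrightarrow> (\<Sum>m\<in>idx. a m * l i m) = 0"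
    by (rule underdetermined_system[OF idx(1,2), of l]) blast
  define F where "F k = (\<Sum>m\<in>idx. cscale (a m) (mode_deriv k m))" for k
  have step: "F k = V (F (Suc k))" if "k < K" for k
  proof -
    have "F k = (\<Sum>m\<in>idx. cscale (a m * mode_deriv_at_0 k m) one + V (cscale (a m) (mode_deriv (Suc k) m)))"
      unfolding F_def
      by (intro sum.cong refl, subst mode_deriv_eq) (simp add: L2.scale_right_distrib cblinear_cscale[OF cblinear_prim])
    also have "\<dots> = cscale (\<Sum>m\<in>idx. a m * mode_deriv_at_0 k m) one + V (F (Suc k))"
      unfolding F_def sum.distrib L2.scale_sum_left cblinear_sum[OF cblinear_prim] ..
    also have "(\<Sum>m\<in>idx. a m * mode_deriv_at_0 k m) = 0" using a(2)[of "n + k"] that by (simp add: l_def)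
    finally show ?thesis by simp
  qed
  have F: "F k = (V ^^ (K - k)) (F K)" if "k \<le> K" for k
    using that
  proof (induction "K - k" arbitrary: k)
    case (Suc j)
    then have k: "k < K" and j: "j = K - Suc k" and eq: "Suc (K - Suc k) = K - k" by auto
    have "F k = V ((V ^^ (K - Suc k)) (F K))" using step[OF k] Suc.hyps(1)[of "Suc k", OF j] k by simp
    also have "\<dots> = (V ^^ Suc (K - Suc k)) (F K)" by simp
    finally show ?case unfolding eq .
  qed simp
  define g where "g = J (D (F K))"
  have PF: "P (F K) = F K" unfolding F_def cblinear_sum[OF cblinear_restr] restr_cscale restr_mode_deriv ..
  have "T g = (V ^^ K) (F K)" unfolding g_def T_def by (simp add: restr_D[OF PF])
  then have Tg: "T g = F 0" using F[of 0] by simp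
  have "D (F K) = (\<Sum>k\<le>K. coef k *\<^sub>R F k)" unfolding D_def
    by (intro sum.cong refl arg_cong[of _ _ "scaleR _"] F[symmetric]) simp
  also have "\<dots> = (\<Sum>m\<in>idx. cscale (a m) (\<Sum>k\<le>K. coef k *\<^sub>R mode_deriv k m))"
    unfolding F_def scaleR_sum_right L2.scale_sum_right
    by (subst sum.swap) (simp add: scaleR_eq_cscale mult.commute)
  finally have DF: "D (F K) = (\<Sum>m\<in>idx. cscale (a m) (\<Sum>k\<le>K. coef k *\<^sub>R mode_deriv k m))" .
  have "J (\<Sum>m\<in>idx. cscale (a m) (X m)) = (\<Sum>m\<in>idx. cscale (a m) (J (X m)))" for X
    by (simp only: cblinear_sum[OF cblinear_refl] refl_cscale)
  then have g: "g = (\<Sum>m\<in>idx. cscale (a m) (norm (symbol (int m)) *\<^sub>R periodic_mode m))"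
    unfolding g_def DF by (simp only: sum_coef_mode_deriv)
  have F0: "F 0 = (\<Sum>m\<in>idx. cscale (a m) (periodic_mode m))" unfolding F_def mode_deriv_0 ..
  have prod: "cinner_L2 (\<Sum>m\<in>idx. cscale (x m) (periodic_mode m)) (\<Sum>m\<in>idx. cscale (y m) (periodic_mode m))
      = of_real (2 * t0) * (\<Sum>m\<in>idx. x m * cnj (y m))" for x y
  proof -
    have "cinner_L2 (\<Sum>m\<in>idx. cscale (x m) (periodic_mode m)) (\<Sum>m\<in>idx. cscale (y m) (periodic_mode m))
        = (\<Sum>i\<in>idx. \<Sum>j\<in>idx. if i = j then x i * cnj (y i) * of_real (2 * t0) else 0)"
      unfolding cinner_sum_left cinner_sum_right
      by (intro sum.cong refl) (auto simp: cinner_periodic_mode idx(3))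
    also have "\<dots> = (\<Sum>i\<in>idx. x i * cnj (y i) * of_real (2 * t0))" using idx(1) by (intro sum.cong refl) simp
    finally show ?thesis by (simp add: sum_distrib_left mult_ac)
  qed
  have g': "g = (\<Sum>m\<in>idx. cscale (of_real (norm (symbol (int m))) * a m) (periodic_mode m))"
    unfolding g scaleR_eq_cscale by (simp add: mult.commute)
  have "cinner_L2 g (b i) = 0" if "i < n" for i
    using a(2)[of i] that unfolding g' cinner_sum_left by (simp add: l_def mult_ac)
  moreover have form: "inner (T g) g = 2 * t0 * (\<Sum>m\<in>idx. norm (symbol (int m)) * (norm (a m))\<^sup>2)"
  proof -
    have "cinner_L2 (T g) g = cinner_L2 (F 0) g" unfolding Tg ..
    also have "\<dots> = of_real (2 * t0 * (\<Sum>m\<in>idx. norm (symbol (int m)) * (norm (a m))\<^sup>2))"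
      unfolding F0 g' prod of_real_mult of_real_sum complex_norm_square by (simp add: mult_ac)
    finally show ?thesis unfolding inner_L2_def by simp
  qed
  moreover have nrm: "(norm g)\<^sup>2 = 2 * t0 * (\<Sum>m\<in>idx. (norm (symbol (int m)))\<^sup>2 * (norm (a m))\<^sup>2)"
  proof -
    have "complex_of_real ((norm g)\<^sup>2) = of_real (2 * t0 * (\<Sum>m\<in>idx. (norm (symbol (int m)))\<^sup>2 * (norm (a m))\<^sup>2))"
      unfolding cinner_self[symmetric] g' prod of_real_mult of_real_sum complex_norm_square[of "a _"]
      by (simp add: mult_ac power2_eq_square)
    then show ?thesis by (simp only: of_real_eq_iff)
  qed
  moreover have "g \<noteq> 0"
  proof
    assume "g = 0"
    then have "F 0 = 0" using Tg cblinear_zero[OF cblinear_T] by simp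
    then have "(\<Sum>m\<in>idx. a m * cnj (a m)) = 0" using prod[of a a] t0 unfolding F0 by simp
    then have "complex_of_real (\<Sum>m\<in>idx. (norm (a m))\<^sup>2) = 0" by (simp only: of_real_sum complex_norm_square)
    then have "(\<Sum>m\<in>idx. (norm (a m))\<^sup>2) = 0" by (simp only: of_real_eq_0_iff)
    then have "\<forall>m\<in>idx. (norm (a m))\<^sup>2 = 0" using idx(1) by (subst (asm) sum_nonneg_eq_0_iff) auto
    then show False using a(1) by auto
  qed
  moreover have "(norm g)\<^sup>2 \<le> \<Lambda> * inner (T g) g"
  proof -
    have "(\<Sum>m\<in>idx. (norm (symbol (int m)))\<^sup>2 * (norm (a m))\<^sup>2) \<le> (\<Sum>m\<in>idx. \<Lambda> * (norm (symbol (int m)) * (norm (a m))\<^sup>2))"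
      using \<Lambda>(2)[folded idx_def] unfolding power2_eq_square[of "norm (symbol _)"] mult.assoc by (intro sum_mono mult_right_mono) auto
    then have "(\<Sum>m\<in>idx. (norm (symbol (int m)))\<^sup>2 * (norm (a m))\<^sup>2) \<le> \<Lambda> * (\<Sum>m\<in>idx. norm (symbol (int m)) * (norm (a m))\<^sup>2)"
      by (simp add: sum_distrib_left)
    from mult_left_mono[OF this, of "2 * t0"] show ?thesis unfolding form nrm using t0 by (simp add: mult_ac)
  qed
  ultimately show thesis using that by blast
qed

text \<open>For $f = Tg = V^Ky$ and $i < K$ this is the value at $t_0$ of $V^{i+1}y = f^{(K-1-i)}$. The further functionals
  are the mean of $f$ and its inner products with the modes of the periodic problem.\<close>

definition constraint :: "nat \<Rightarrow> L2 \<Rightarrow> complex"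
  where "constraint i g = (if i < K then cinner_L2 ((V ^^ i) (Y (J g))) one
    else if i = K then cinner_L2 (T g) one else cinner_L2 (T g) (periodic_mode (i - K)))"

lemma constraint_sum: "constraint i (\<Sum>j\<in>S. cscale (a j) (v j)) = (\<Sum>j\<in>S. a j * constraint i (v j))"
proof -
  have VYJ: "cblinear (\<lambda>u. (V ^^ i) (Y (J u)))"
    by (rule cblinear_compose[OF cblinear_funpow[OF cblinear_prim] cblinear_compose[OF cblinear_Y cblinear_refl]])
  show ?thesis
    unfolding constraint_def cblinear_sum[OF cblinear_T] cblinear_cscale[OF cblinear_T]
      cblinear_sum[OF VYJ] cblinear_cscale[OF VYJ] cinner_sum_left
    by auto
qed

lemma cinner_funpow_prim_e:
  assumes "\<And>i. i < n \<Longrightarrow> cinner_L2 ((V ^^ i) y) one = 0"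
  shows "cinner_L2 y (e m) = (\<i> * of_real (\<omega> m)) ^ n * cinner_L2 ((V ^^ n) y) (e m)"
  using assms
proof (induction n)
  case (Suc n)
  have "cinner_L2 ((V ^^ n) y) one = 0" using Suc.prems by simp
  from cinner_prim_e[OF this, of m] Suc.IH Suc.prems show ?case by (simp add: mult_ac)
qed simp

text \<open>The derivatives of $f = Tg$ of order less than $K$ vanish at both ends of the interval, so integrating by
  parts against $e_m$ leaves no boundary terms.\<close>

lemma cinner_dual_e:
  assumes "\<And>i. i < K \<Longrightarrow> constraint i g = 0"
  shows "cinner_L2 g (e (- m)) = symbol m * cinner_L2 (T g) (e m)"
proof -
  define y where "y = Y (J g)"
  have van: "cinner_L2 ((V ^^ i) y) one = 0" if "i < K" for i using assms[OF that] that by (simp add: constraint_def y_def)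
  have "cinner_L2 g (e (- m)) = cinner_L2 g (J (e m))" by simp
  also have "\<dots> = cinner_L2 (D y) (e m)" unfolding refl_sym[symmetric] y_def by simp
  also have "\<dots> = (\<Sum>k\<le>K. of_real (coef k) * cinner_L2 ((V ^^ (K - k)) y) (e m))"
    unfolding D_def cinner_sum_left by simp
  also have "\<dots> = (\<Sum>k\<le>K. of_real (coef k) * ((\<i> * of_real (\<omega> m)) ^ k * cinner_L2 (T g) (e m)))"
  proof (rule sum.cong[OF refl])
    fix k assume k: "k \<in> {..K}"
    have "cinner_L2 ((V ^^ (K - k)) y) (e m) = (\<i> * of_real (\<omega> m)) ^ k * cinner_L2 ((V ^^ k) ((V ^^ (K - k)) y)) (e m)"
    proof (rule cinner_funpow_prim_e)
      fix i assume "i < k"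
      then show "cinner_L2 ((V ^^ i) ((V ^^ (K - k)) y)) one = 0"
        using van[of "i + (K - k)"] k by (simp add: funpow_add)
    qed
    also have "(V ^^ k) ((V ^^ (K - k)) y) = T g"
      using k unfolding T_def y_def by (simp flip: funpow_add[THEN fun_cong, simplified o_def])
    finally show "complex_of_real (coef k) * cinner_L2 ((V ^^ (K - k)) y) (e m)
      = of_real (coef k) * ((\<i> * of_real (\<omega> m)) ^ k * cinner_L2 (T g) (e m))" by simp
  qed
  also have "\<dots> = symbol m * cinner_L2 (T g) (e m)" unfolding symbol_def sum_distrib_right by (simp add: mult_ac)
  finally show ?thesis .
qed

lemma sum_modes: "(\<Sum>m\<in>modes M. f m) = (\<Sum>m=1..M. f (int m) + f (- int m))"
proof -
  have "modes M = int ` {1..M} \<union> (\<lambda>m. - int m) ` {1..M}"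
  proof (intro equalityI subsetI)
    fix m assume m: "m \<in> modes M"
    show "m \<in> int ` {1..M} \<union> (\<lambda>m. - int m) ` {1..M}"
    proof (cases "m > 0")
      case True
      then show ?thesis using m by (auto simp: modes_def intro!: image_eqI[of _ _ "nat m"])
    next
      case False
      then have "m \<in> (\<lambda>m. - int m) ` {1..M}" using m by (intro image_eqI[of _ _ "nat (- m)"]) (auto simp: modes_def)
      then show ?thesis by blast
    qed
  qed (auto simp: modes_def)
  moreover have "int ` {1..M} \<inter> (\<lambda>m. - int m) ` {1..M} = {}" by auto
  ultimately have "(\<Sum>m\<in>modes M. f m) = (\<Sum>m\<in>int ` {1..M}. f m) + (\<Sum>m\<in>(\<lambda>m. - int m) ` {1..M}. f m)"
    by (simp add: sum.union_disjoint)
  also have "\<dots> = (\<Sum>m=1..M. f (int m)) + (\<Sum>m=1..M. f (- int m))"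
    by (simp add: sum.reindex inj_on_def)
  finally show ?thesis by (simp add: sum.distrib)
qed

text \<open>In Fourier coefficients $\langle f, g\rangle$, with $f = Tg$, is a sum over $m \ge 1$ of
  $2|p(m)|\,\mathrm{Re}(\theta\alpha\overline\beta)/t_0$, where $\alpha$ and $\beta$ are the inner products of $f$ with
  $e_m$ and $e_{-m}$. For $m \le N$ orthogonality to the mode means $\theta\alpha = -\beta$ and the summand is not
  positive; for $m > N$ it is at most $|p(m)|^{-1}$ times the share of the frequencies $m$ and $-m$ in $\|g\|^2$.\<close>

lemma form_upper_bound:
  assumes zero: "\<And>i. i \<le> K + N \<Longrightarrow> constraint i g = 0"
    and \<Lambda>: "0 < \<Lambda>" "\<And>m. N < m \<Longrightarrow> \<Lambda> \<le> norm (symbol (int m))"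
  shows "\<Lambda> * inner (T g) g \<le> (norm g)\<^sup>2"
proof -
  define f where "f = T g"
  define x where "x = (V ^^ (K - 1)) (Y (J g))"
  have "Suc (K - 1) = K" using K by simp
  then have f: "f = V x" unfolding f_def x_def T_def by (metis comp_apply funpow.simps(2))
  have x1: "cinner_L2 x one = 0" using zero[of "K - 1"] K by (simp add: constraint_def x_def)
  have f1: "cinner_L2 (V x) one = 0" using zero[of K] by (simp add: constraint_def f[symmetric] f_def)
  define \<alpha> where "\<alpha> m = cinner_L2 f (e (int m))" for m
  define \<beta> where "\<beta> m = cinner_L2 f (e (- int m))" for m
  have dual: "cinner_L2 g (e (- int m)) = symbol (int m) * \<alpha> m" "cinner_L2 g (e (int m)) = cnj (symbol (int m)) * \<beta> m" for m
    using cinner_dual_e[of g "int m"] cinner_dual_e[of g "- int m"] zero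
    by (simp_all add: \<alpha>_def \<beta>_def f_def symbol_minus)
  have fs: "\<Lambda> * Re (cinner_L2 (fourier_sum M f) g) \<le> (norm g)\<^sup>2" for M
  proof -
    define t where "t m = 2 * Re (symbol (int m) * \<alpha> m * cnj (\<beta> m)) / t0" for m
    have "cinner_L2 (fourier_sum M f) g = (\<Sum>m=1..M. \<alpha> m * cnj (cinner_L2 g (e (int m))) / t0
        + \<beta> m * cnj (cinner_L2 g (e (- int m))) / t0)"
      unfolding cinner_fourier_sum_left sum_modes \<alpha>_def \<beta>_def ..
    also have "\<dots> = (\<Sum>m=1..M. (symbol (int m) * \<alpha> m * cnj (\<beta> m) + cnj (symbol (int m) * \<alpha> m * cnj (\<beta> m))) / t0)"
      unfolding dual by (intro sum.cong refl) (simp add: add_divide_distrib mult_ac)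
    also have "\<dots> = of_real (\<Sum>m=1..M. t m)"
      unfolding of_real_sum t_def complex_add_cnj by simp
    finally have "\<Lambda> * Re (cinner_L2 (fourier_sum M f) g) = (\<Sum>m=1..M. \<Lambda> * t m)" by (simp add: sum_distrib_left)
    also have "\<dots> \<le> (\<Sum>m=1..M. (norm (cinner_L2 g (e (int m))))\<^sup>2 / t0 + (norm (cinner_L2 g (e (- int m))))\<^sup>2 / t0)"
    proof (rule sum_mono)
      fix m assume m: "m \<in> {1..M}"
      let ?r = "norm (symbol (int m))"
      let ?z = "phase m * \<alpha> m" and ?w = "\<beta> m"
      have exp: "2 * Re (symbol (int m) * \<alpha> m * cnj (\<beta> m)) = ?r * (2 * Re (?z * cnj ?w))"
      proof -
        have "symbol (int m) * \<alpha> m * cnj (\<beta> m) = of_real ?r * (?z * cnj ?w)"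
          by (subst symbol_eq_phase) (simp add: mult_ac)
        moreover have "Re (of_real r * c) = r * Re c" for r c by simp
        ultimately show ?thesis by (simp only: mult.left_commute)
      qed
      show "\<Lambda> * t m \<le> (norm (cinner_L2 g (e (int m))))\<^sup>2 / t0 + (norm (cinner_L2 g (e (- int m))))\<^sup>2 / t0"
      proof (cases "m \<le> N")
        case True
        have "cinner_L2 f (periodic_mode m) = 0" using zero[of "K + m"] m True by (simp add: constraint_def f_def)
        then have "\<alpha> m + cnj (phase m) * \<beta> m = 0" by (simp add: periodic_mode_def cinner_add_right \<alpha>_def \<beta>_def)
        then have "phase m * (\<alpha> m + cnj (phase m) * \<beta> m) = 0" by simp
        then have "?z = - ?w" using phase_cnj[of m]
          by (simp add: distrib_left mult.assoc[symmetric] eq_neg_iff_add_eq_0)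
        then have "Re (?z * cnj ?w) = - (norm ?w)\<^sup>2" by (simp flip: complex_norm_square)
        then have "2 * Re (symbol (int m) * \<alpha> m * cnj (\<beta> m)) \<le> 0"
          unfolding exp by (simp add: mult_nonneg_nonpos)
        then have "\<Lambda> * t m \<le> 0" unfolding t_def using t0 \<Lambda>(1) by (intro mult_nonneg_nonpos divide_nonpos_pos) auto
        moreover have "0 \<le> (norm (cinner_L2 g (e (int m))))\<^sup>2 / t0 + (norm (cinner_L2 g (e (- int m))))\<^sup>2 / t0"
          using t0 by simp
        ultimately show ?thesis by linarith
      next
        case False
        then have \<Lambda>r: "\<Lambda> \<le> ?r" using \<Lambda>(2) by simp
        have "2 * Re (?z * cnj ?w) \<le> (norm ?z)\<^sup>2 + (norm ?w)\<^sup>2"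
        proof -
          have "Re (?z * cnj ?w) \<le> norm (?z * cnj ?w)" by (rule complex_Re_le_cmod)
          also have "\<dots> = norm ?z * norm ?w" by (simp add: norm_mult)
          finally show ?thesis using sum_squares_bound[of "norm ?z" "norm ?w"] by linarith
        qed
        then have "2 * Re (?z * cnj ?w) \<le> (norm (\<alpha> m))\<^sup>2 + (norm (\<beta> m))\<^sup>2" by (simp add: norm_mult)
        then have "\<Lambda> * (?r * (2 * Re (?z * cnj ?w))) \<le> \<Lambda> * (?r * ((norm (\<alpha> m))\<^sup>2 + (norm (\<beta> m))\<^sup>2))"
          using \<Lambda>(1) by (intro mult_left_mono) auto
        also have "\<dots> \<le> ?r * (?r * ((norm (\<alpha> m))\<^sup>2 + (norm (\<beta> m))\<^sup>2))"
          using \<Lambda>r by (intro mult_right_mono) auto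
        also have "\<dots> = (norm (cinner_L2 g (e (int m))))\<^sup>2 + (norm (cinner_L2 g (e (- int m))))\<^sup>2"
          unfolding dual by (simp add: norm_mult power2_eq_square algebra_simps)
        finally show ?thesis unfolding t_def exp using t0
          by (simp add: add_divide_distrib[symmetric] divide_right_mono)
      qed
    qed
    also have "\<dots> = (\<Sum>m\<in>modes M. (norm (cinner_L2 g (e m)))\<^sup>2 / t0)" unfolding sum_modes ..
    also have "\<dots> \<le> (norm g)\<^sup>2" by (rule bessel)
    finally show ?thesis .
  qed
  have bound: "\<Lambda> * inner f g \<le> (norm g)\<^sup>2 + \<Lambda> * (t0 / (2 * pi) * norm x * norm g) * (1 / real (Suc M))" for M
  proof -
    have "Re (cinner_L2 (f - fourier_sum M f) g) \<le> norm (f - fourier_sum M f) * norm g"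
      by (rule order_trans[OF complex_Re_le_cmod cinner_Cauchy_Schwarz])
    also have "\<dots> \<le> (t0 / (2 * pi * real (M + 1))) * norm x * norm g"
      unfolding f by (intro mult_right_mono fourier_approximation x1 f1) auto
    also have "\<dots> = (t0 / (2 * pi) * norm x * norm g) * (1 / real (Suc M))" by simp
    finally have r: "Re (cinner_L2 (f - fourier_sum M f) g) \<le> (t0 / (2 * pi) * norm x * norm g) * (1 / real (Suc M))" .
    have "\<Lambda> * inner f g = \<Lambda> * Re (cinner_L2 (fourier_sum M f) g) + \<Lambda> * Re (cinner_L2 (f - fourier_sum M f) g)"
      by (simp add: inner_L2_def cinner_diff_left algebra_simps)
    then show ?thesis using fs[of M] mult_left_mono[OF r, of \<Lambda>] \<Lambda>(1) by (simp only: mult.assoc) linarith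
  qed
  have "(\<lambda>M. (norm g)\<^sup>2 + \<Lambda> * (t0 / (2 * pi) * norm x * norm g) * (1 / real (Suc M))) \<longlonglongrightarrow>
      (norm g)\<^sup>2 + \<Lambda> * (t0 / (2 * pi) * norm x * norm g) * 0"
    using LIMSEQ_inverse_real_of_nat unfolding inverse_eq_divide by (intro tendsto_add tendsto_mult tendsto_const)
  then have "\<Lambda> * inner f g \<le> (norm g)\<^sup>2 + \<Lambda> * (t0 / (2 * pi) * norm x * norm g) * 0"
    by (rule LIMSEQ_le_const) (use bound in blast)
  then show ?thesis by (simp add: f_def)
qed

end

section \<open>Eigenvalues of compact symmetric operators\<close>

lemma closed_orthogonal: "closed {u. \<forall>i<n::nat. cinner_L2 u (b i) = 0}"
proof -
  have "{u. \<forall>i<n. cinner_L2 u (b i) = 0} = (\<Inter>i\<in>{..<n}. {u. cinner_L2 u (b i) = 0})" by auto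
  then show ?thesis using closed_cinner by auto
qed

lemma subspace_orthogonal: "subspace {u. \<forall>i<n::nat. cinner_L2 u (b i) = 0}"
  by (simp add: subspace_def cinner_add_left)

text \<open>Each eigenvector maximizes the form of $A$ on the complement of its predecessors.\<close>

lemma spectral_sequence:
  assumes A: "cblinear A" "compact_operator A" and sym: "\<And>u v. cinner_L2 (A u) v = cinner_L2 u (A v)"
    and low: "\<And>n b. \<exists>g. g \<noteq> 0 \<and> (\<forall>i<n. cinner_L2 g (b i) = 0) \<and> a n * (norm g)\<^sup>2 \<le> inner (A g) g"
    and a: "\<And>n. 0 < a n"
  obtains \<phi> \<mu> where "\<And>i j. cinner_L2 (\<phi> i) (\<phi> j) = (if i = j then 1 else 0)"
    "\<And>n. A (\<phi> n) = \<mu> n *\<^sub>R \<phi> n" "\<And>n. a n \<le> \<mu> n" "decseq \<mu>"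
    "\<And>n u. \<forall>i<n. cinner_L2 u (\<phi> i) = 0 \<Longrightarrow> inner (A u) u \<le> \<mu> n * (norm u)\<^sup>2"
proof -
  define Pr where "Pr f n r \<longleftrightarrow> norm r = 1 \<and> (\<forall>i<n. cinner_L2 r (f i) = 0) \<and>
    (\<exists>\<mu>. A r = \<mu> *\<^sub>R r \<and> a n \<le> \<mu> \<and> (\<forall>u. (\<forall>i<n. cinner_L2 u (f i) = 0) \<longrightarrow> inner (A u) u \<le> \<mu> * (norm u)\<^sup>2))"
    for f and n :: nat and r
  have "\<exists>f. \<forall>n. Pr f n (f n)"
  proof (rule dependent_wellorder_choice)
    show "Pr f n r = Pr g n r" if "\<And>y. y < n \<Longrightarrow> f y = g y" for r f g n
    proof -
      have "(\<forall>i<n. cinner_L2 u (f i) = 0) \<longleftrightarrow> (\<forall>i<n. cinner_L2 u (g i) = 0)" for u using that by simp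
      then show ?thesis by (simp only: Pr_def)
    qed
    fix n f assume prev: "\<And>i. i < n \<Longrightarrow> Pr f i (f i)"
    define M where "M = {u. \<forall>i<n. cinner_L2 u (f i) = 0}"
    have inv: "A u \<in> M" if u: "u \<in> M" for u
      unfolding M_def
    proof (intro CollectI allI impI)
      fix i assume i: "i < n"
      then obtain \<mu> where "A (f i) = \<mu> *\<^sub>R f i" using prev[OF i] unfolding Pr_def by blast
      then show "cinner_L2 (A u) (f i) = 0" using u i unfolding sym M_def by simp
    qed
    obtain g where g: "g \<noteq> 0" "\<forall>i<n. cinner_L2 g (f i) = 0" "a n * (norm g)\<^sup>2 \<le> inner (A g) g"
      using low by blast
    have gpos: "0 < a n * (norm g)\<^sup>2" using a g(1) by simp
    show "\<exists>r. Pr f n r"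
    proof (rule maximum_principle[OF cblinear_bounded_linear[OF A(1)] A(2) _ _ _ inv, of g])
      show "inner (A u) v = inner u (A v)" for u v by (simp add: inner_L2_def sym)
      show "subspace M" "closed M" unfolding M_def by (rule subspace_orthogonal, rule closed_orthogonal)
      show "g \<in> M" using g(2) by (simp add: M_def)
      show "0 < inner (A g) g" using g(3) gpos by linarith
      fix \<mu> \<phi> assume \<mu>: "0 < \<mu>" "\<phi> \<in> M" "norm \<phi> = 1" "A \<phi> = \<mu> *\<^sub>R \<phi>"
        "\<And>u. u \<in> M \<Longrightarrow> inner (A u) u \<le> \<mu> * (norm u)\<^sup>2"
      have "a n * (norm g)\<^sup>2 \<le> \<mu> * (norm g)\<^sup>2" using g(3) \<mu>(5)[OF \<open>g \<in> M\<close>] by linarith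
      then have "a n \<le> \<mu>" using g(1) by simp
      then show ?thesis using \<mu> unfolding Pr_def M_def by blast
    qed
  qed
  then obtain \<phi> where \<phi>: "\<And>n. Pr \<phi> n (\<phi> n)" by blast
  have "\<forall>n. \<exists>\<mu>. A (\<phi> n) = \<mu> *\<^sub>R \<phi> n \<and> a n \<le> \<mu> \<and>
      (\<forall>u. (\<forall>i<n. cinner_L2 u (\<phi> i) = 0) \<longrightarrow> inner (A u) u \<le> \<mu> * (norm u)\<^sup>2)"
    using \<phi> unfolding Pr_def by blast
  then obtain \<mu> where \<mu>: "\<And>n. A (\<phi> n) = \<mu> n *\<^sub>R \<phi> n" "\<And>n. a n \<le> \<mu> n"
    "\<And>n u. (\<forall>i<n. cinner_L2 u (\<phi> i) = 0) \<Longrightarrow> inner (A u) u \<le> \<mu> n * (norm u)\<^sup>2"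
    by metis
  have n1: "norm (\<phi> n) = 1" for n using \<phi>[of n] by (simp add: Pr_def)
  have lt: "cinner_L2 (\<phi> j) (\<phi> i) = 0" if "i < j" for i j using \<phi>[of j] that by (simp add: Pr_def)
  have orth: "cinner_L2 (\<phi> i) (\<phi> j) = (if i = j then 1 else 0)" for i j
  proof (cases i j rule: linorder_cases)
    case less
    then show ?thesis using lt[OF less] cinner_cnj[of "\<phi> j" "\<phi> i"] by simp
  next
    case equal
    then show ?thesis using n1[of j] by (simp add: cinner_self)
  next
    case greater
    then show ?thesis using lt[OF greater] by simp
  qed
  have "decseq \<mu>"
  proof (rule decseq_SucI)
    fix n
    have "inner (A (\<phi> (Suc n))) (\<phi> (Suc n)) \<le> \<mu> n * (norm (\<phi> (Suc n)))\<^sup>2"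
      by (rule \<mu>(3)) (simp add: orth)
    then show "\<mu> (Suc n) \<le> \<mu> n" by (simp add: \<mu>(1) n1 power2_norm_eq_inner[symmetric])
  qed
  then show thesis using that[of \<phi> \<mu>] orth \<mu> by blast
qed

lemma cinner_orthonormal_sum:
  assumes orth: "\<And>i j. i \<in> S \<Longrightarrow> j \<in> S \<Longrightarrow> cinner_L2 (\<phi> i) (\<phi> j) = (if i = j then 1 else 0)"
    and "finite S" "j \<in> S"
  shows "cinner_L2 (\<Sum>i\<in>S. cscale (a i) (\<phi> i)) (\<phi> j) = a j"
proof -
  have "cinner_L2 (\<Sum>i\<in>S. cscale (a i) (\<phi> i)) (\<phi> j) = (\<Sum>i\<in>S. if i = j then a i else 0)"
    unfolding cinner_sum_left using assms by (intro sum.cong) auto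
  then show ?thesis using assms by simp
qed

text \<open>Min-max: $n$ linear conditions leave a nonzero vector in the span of the first $n+1$
  eigenvectors, where the form is at least $\mu_n$.\<close>

lemma spectral_sequence_le:
  assumes A: "cblinear A" and orth: "\<And>i j. cinner_L2 (\<phi> i) (\<phi> j) = (if i = j then 1 else (0::complex))"
    and eig: "\<And>n. A (\<phi> n) = \<mu> n *\<^sub>R \<phi> n" and dec: "decseq \<mu>"
    and lin: "\<And>i a. l i (\<Sum>j\<in>{..n}. cscale (a j) (\<phi> j)) = (\<Sum>j\<in>{..n}. a j * l i (\<phi> j))"
    and bound: "\<And>g. (\<And>i. i < n \<Longrightarrow> l i g = 0) \<Longrightarrow> inner (A g) g \<le> c * (norm g)\<^sup>2"
  shows "\<mu> n \<le> c"
proof -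
  obtain a where a: "\<exists>j\<in>{..n}. a j \<noteq> 0" "\<And>i. i < n \<Longrightarrow> (\<Sum>j\<in>{..n}. a j * l i (\<phi> j)) = 0"
    by (rule underdetermined_system[of "{..n}" n "\<lambda>i j. l i (\<phi> j)"]) auto
  define g where "g = (\<Sum>j\<in>{..n}. cscale (a j) (\<phi> j))"
  have ga: "cinner_L2 g (\<phi> j) = a j" if "j \<le> n" for j
    unfolding g_def by (rule cinner_orthonormal_sum) (use orth that in auto)
  have ag: "cinner_L2 (\<phi> j) g = cnj (a j)" if "j \<le> n" for j using ga[OF that] cinner_cnj by metis
  have "g \<noteq> 0" using a(1) ga by auto
  have nrm: "(norm g)\<^sup>2 = (\<Sum>j\<in>{..n}. (norm (a j))\<^sup>2)"
  proof -
    have "complex_of_real ((norm g)\<^sup>2) = (\<Sum>j\<in>{..n}. a j * cinner_L2 (\<phi> j) g)"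
      unfolding cinner_self[symmetric] by (subst (1) g_def) (simp add: cinner_sum_left)
    also have "\<dots> = of_real (\<Sum>j\<in>{..n}. (norm (a j))\<^sup>2)"
      unfolding of_real_sum complex_norm_square by (intro sum.cong refl) (simp add: ag)
    finally show ?thesis by (simp only: of_real_eq_iff)
  qed
  have "\<mu> n * (norm g)\<^sup>2 \<le> inner (A g) g"
  proof -
    have "cinner_L2 (A g) g = (\<Sum>j\<in>{..n}. a j * (\<mu> j * cinner_L2 (\<phi> j) g))"
      by (subst (1) g_def) (simp add: cblinear_sum[OF A] cblinear_cscale[OF A] eig cinner_sum_left)
    also have "\<dots> = of_real (\<Sum>j\<in>{..n}. \<mu> j * (norm (a j))\<^sup>2)"
      unfolding of_real_sum of_real_mult complex_norm_square by (intro sum.cong refl) (simp add: ag)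
    finally have "inner (A g) g = (\<Sum>j\<in>{..n}. \<mu> j * (norm (a j))\<^sup>2)" unfolding inner_L2_def by simp
    also have "\<dots> \<ge> (\<Sum>j\<in>{..n}. \<mu> n * (norm (a j))\<^sup>2)"
      using decseqD[OF dec] by (intro sum_mono mult_right_mono) auto
    finally show ?thesis unfolding nrm sum_distrib_left .
  qed
  also have "\<dots> \<le> c * (norm g)\<^sup>2" by (rule bound) (use a(2) lin in \<open>simp add: g_def\<close>)
  finally show ?thesis using \<open>g \<noteq> 0\<close> by simp
qed

text \<open>The part of an eigenvector orthogonal to the $\phi_n$ with $\mu_n = c$ is orthogonal to all $\phi_n$. So the form
  on it has the factor $c$ but is bounded with every factor $\mu_n$, and $\mu_n \to 0$.\<close>

lemma eigenspace_span:
  assumes A: "cblinear A" and sym: "\<And>u v. cinner_L2 (A u) v = cinner_L2 u (A v)"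
    and orth: "\<And>i j. cinner_L2 (\<phi> i) (\<phi> j) = (if i = j then 1 else (0::complex))"
    and eig: "\<And>n. A (\<phi> n) = \<mu> n *\<^sub>R \<phi> n" and lim: "\<mu> \<longlonglongrightarrow> 0"
    and form: "\<And>n u. \<forall>i<n. cinner_L2 u (\<phi> i) = 0 \<Longrightarrow> inner (A u) u \<le> \<mu> n * (norm u)\<^sup>2"
    and c: "0 < c"
  shows "finite {n. \<mu> n = c}" "L2.span (\<phi> ` {n. \<mu> n = c}) = {u. A u = c *\<^sub>R u}"
    "L2.independent (\<phi> ` {n. \<mu> n = c})" "inj \<phi>"
proof -
  define S where "S = {n. \<mu> n = c}"
  obtain N where N: "\<And>n. n \<ge> N \<Longrightarrow> \<bar>\<mu> n\<bar> < c" using LIMSEQ_D[OF lim c] by auto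
  have "S \<subseteq> {..<N}" unfolding S_def using N by (force simp: not_le[symmetric])
  then show fin: "finite {n. \<mu> n = c}" using finite_subset unfolding S_def by blast
  have finS: "finite S" using fin by (simp add: S_def)
  show inj: "inj \<phi>"
  proof (rule injI)
    fix i j assume "\<phi> i = \<phi> j"
    then have "cinner_L2 (\<phi> i) (\<phi> j) = cinner_L2 (\<phi> i) (\<phi> i)" by simp
    then show "i = j" by (simp add: orth split: if_splits)
  qed
  have "u \<in> L2.span (\<phi> ` S)" if u: "A u = c *\<^sub>R u" for u
  proof -
    define v where "v = u - (\<Sum>i\<in>S. cscale (cinner_L2 u (\<phi> i)) (\<phi> i))"
    have Av: "A v = c *\<^sub>R v"
    proof -
      have "A (\<Sum>i\<in>S. cscale (cinner_L2 u (\<phi> i)) (\<phi> i)) = c *\<^sub>R (\<Sum>i\<in>S. cscale (cinner_L2 u (\<phi> i)) (\<phi> i))"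
        unfolding cblinear_sum[OF A] cblinear_cscale[OF A] eig scaleR_sum_right
        by (intro sum.cong refl) (simp add: S_def scaleR_eq_cscale mult.commute)
      then show ?thesis unfolding v_def cblinear_diff[OF A] u by (simp add: scaleR_diff_right)
    qed
    have "cinner_L2 v (\<phi> n) = 0" for n
    proof (cases "n \<in> S")
      case True
      have "cinner_L2 (\<Sum>i\<in>S. cscale (cinner_L2 u (\<phi> i)) (\<phi> i)) (\<phi> n) = cinner_L2 u (\<phi> n)"
        using orth finS True by (intro cinner_orthonormal_sum) auto
      then show ?thesis by (simp add: v_def cinner_diff_left)
    next
      case False
      have "of_real c * cinner_L2 v (\<phi> n) = of_real (\<mu> n) * cinner_L2 v (\<phi> n)"
        using sym[of v "\<phi> n"] by (simp add: Av eig)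
      then show ?thesis using False by (simp add: S_def)
    qed
    then have le: "c * (norm v)\<^sup>2 \<le> \<mu> n * (norm v)\<^sup>2" for n
      using form[of n v] by (simp add: Av power2_norm_eq_inner)
    have "\<mu> N < c" using N[of N] by simp
    then have "v = 0" using le[of N] by (cases "v = 0") auto
    then have "u = (\<Sum>i\<in>S. cscale (cinner_L2 u (\<phi> i)) (\<phi> i))" by (simp add: v_def)
    also have "\<dots> \<in> L2.span (\<phi> ` S)"
      by (intro L2.span_sum L2.span_scale L2.span_base) auto
    finally show ?thesis .
  qed
  moreover have "A u = c *\<^sub>R u" if "u \<in> L2.span (\<phi> ` S)" for u
    using that
  proof (induction rule: L2.span_induct_alt)
    case base
    then show ?case by (simp add: cblinear_zero[OF A])
  next
    case (step k x y)
    then obtain i where "i \<in> S" "x = \<phi> i" by blast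
    then show ?case using step
      by (simp add: cblinear_add[OF A] cblinear_cscale[OF A] eig S_def scaleR_eq_cscale
          L2.scale_right_distrib mult.commute)
  qed
  ultimately show "L2.span (\<phi> ` {n. \<mu> n = c}) = {u. A u = c *\<^sub>R u}" unfolding S_def by blast
  show "L2.independent (\<phi> ` {n. \<mu> n = c})"
    unfolding L2.independent_explicit_finite_subsets
  proof (intro allI impI ballI)
    fix T f v assume T: "T \<subseteq> \<phi> ` {n. \<mu> n = c}" "finite T" "(\<Sum>v\<in>T. cscale (f v) v) = 0" and v: "v \<in> T"
    have "cinner_L2 (\<Sum>v\<in>T. cscale (f v) (id v)) (id v) = f v"
    proof (rule cinner_orthonormal_sum[OF _ T(2) v])
      fix x y assume "x \<in> T" "y \<in> T"
      then obtain i j where "x = \<phi> i" "y = \<phi> j" using T(1) by blast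
      then show "cinner_L2 (id x) (id y) = (if x = y then 1 else 0)" using orth[of i j] inj by (simp add: inj_eq)
    qed
    then show "f v = 0" using T(3) by simp
  qed
qed

section \<open>Asymptotics from two-sided bounds\<close>

text \<open>By convexity in $x$ the power lies below its chord over $[0,1]$.\<close>

lemma power_one_plus_le:
  assumes "0 \<le> D" "0 \<le> x" "x \<le> 1"
  shows "(1 + D * x) ^ k \<le> 1 + x * ((1 + D) ^ k - 1 :: real)"
proof (induction k)
  case (Suc k)
  define E where "E = (1 + D) ^ k - 1"
  have E: "0 \<le> E" unfolding E_def using assms by simp
  have "(1 + D * x) ^ Suc k \<le> (1 + D * x) * (1 + x * E)"
    using Suc assms by (simp add: E_def mult_left_mono)
  also have "\<dots> = 1 + x * (E + D + D * E * x)" by (simp add: algebra_simps)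
  also have "\<dots> \<le> 1 + x * (E + D + D * E)"
    using assms E mult_left_le[of x "D * E"] by (intro add_left_mono mult_left_mono) auto
  also have "E + D + D * E = (1 + D) ^ Suc k - 1" by (simp add: E_def algebra_simps)
  finally show ?case .
qed simp

text \<open>Shifting $n$ by a constant and adding a lower order term both change $An^K$ by a factor $1 + O(1/n)$.\<close>

lemma asymptotics_of_bounds:
  fixes A C :: real and K :: nat and L :: "nat \<Rightarrow> real"
  assumes A: "0 < A" and C: "0 \<le> C" and K: "1 \<le> K"
    and up: "\<And>n. 1 \<le> n \<Longrightarrow> L n \<le> real (n + K) ^ (K - 1) * (A * real (n + K) + C)"
    and low: "\<And>n. K + 2 \<le> n \<Longrightarrow> C < A * (real n - (K + 1)) \<Longrightarrow>
      (real n - (K + 1)) ^ (K - 1) * (A * (real n - (K + 1)) - C) \<le> L n"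
  shows "(\<lambda>n. L n / (A * real n ^ K) - 1) \<in> O(\<lambda>n. 1 / real n)" "filterlim L at_top sequentially"
proof -
  define D where "D = real K + 1 + C / A"
  define B where "B = max ((1 + D) ^ K) (K * D)"
  have D: "0 \<le> D" "real K + 1 \<le> D" using A C by (auto simp: D_def)
  have Kpow: "x ^ K = x ^ (K - 1) * x" for x :: real using K by (cases K) auto
  have bounds: "\<bar>L n / (A * real n ^ K) - 1\<bar> \<le> B / real n \<and> A * real n ^ K * (1 - K * D / real n) \<le> L n"
    if n: "real n > D + 1" "n \<ge> K + 2" for n
  proof -
    define x where "x = 1 / real n"
    have n0: "real n > 0" using n D by linarith
    have x: "0 < x" "x \<le> 1" "D * x < 1" using n n0 D by (auto simp: x_def field_simps)
    have An: "0 < A * real n ^ K" using A n0 by simp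
    have split: "real (n + K) = real n * (1 + K * x)" "real n - (K + 1) = real n * (1 - (K + 1) * x)"
      using n0 by (simp_all add: x_def field_simps)
    have "L n \<le> real (n + K) ^ (K - 1) * (A * real (n + K) + C)" using n by (intro up) auto
    also have "\<dots> = real n ^ (K - 1) * (A * real n) * ((1 + K * x) ^ (K - 1) * (1 + K * x + C / A * x))"
    proof -
      have "A * real (n + K) + C = A * real n * (1 + K * x + C / A * x)" unfolding split using A n0
        by (simp add: x_def field_simps)
      then show ?thesis unfolding split power_mult_distrib by (simp add: mult_ac)
    qed
    also have "\<dots> \<le> real n ^ (K - 1) * (A * real n) * ((1 + D * x) ^ (K - 1) * (1 + D * x))"
      using A C D n0 x by (intro mult_left_mono mult_mono power_mono) (auto simp: D_def algebra_simps)
    also have "\<dots> = A * real n ^ K * (1 + D * x) ^ K" unfolding Kpow by (simp add: mult_ac)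
    finally have "L n / (A * real n ^ K) \<le> (1 + D * x) ^ K" using An by (simp add: divide_le_eq mult.commute)
    also have "\<dots> \<le> 1 + x * ((1 + D) ^ K - 1)" using D x by (intro power_one_plus_le) auto
    also have "\<dots> \<le> 1 + x * B" using x unfolding B_def by (intro add_left_mono mult_left_mono) auto
    finally have u: "L n / (A * real n ^ K) - 1 \<le> B / real n" by (simp add: x_def)
    have "C < A * (real n - (K + 1))"
      using n A by (simp add: D_def field_simps)
    then have l0: "(real n - (K + 1)) ^ (K - 1) * (A * (real n - (K + 1)) - C) \<le> L n" using n by (intro low) auto
    have "A * real n ^ K * (1 - K * D * x) \<le> A * real n ^ K * (1 - D * x) ^ K"
      using An Bernoulli_inequality[of "- (D * x)" K] x by (intro mult_left_mono) (auto simp: mult_ac)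
    also have "\<dots> = real n ^ (K - 1) * (A * real n) * ((1 - D * x) ^ (K - 1) * (1 - D * x))"
      unfolding Kpow by (simp add: mult_ac)
    also have "\<dots> \<le> real n ^ (K - 1) * (A * real n) * ((1 - (K + 1) * x) ^ (K - 1) * (1 - (K + 1) * x - C / A * x))"
    proof -
      have le: "(real K + 1) * x \<le> D * x" using D x by (intro mult_right_mono) auto
      then have "0 \<le> (1 - (real K + 1) * x) ^ (K - 1)" using x by (intro zero_le_power) linarith
      then show ?thesis using A C D n0 x le
        by (intro mult_left_mono mult_mono power_mono) (auto simp: D_def algebra_simps)
    qed
    also have "\<dots> = (real n - (K + 1)) ^ (K - 1) * (A * (real n - (K + 1)) - C)"
    proof -
      have "A * (real n - (K + 1)) - C = A * real n * (1 - (K + 1) * x - C / A * x)" unfolding split using A n0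
        by (simp add: x_def field_simps)
      then show ?thesis unfolding split power_mult_distrib by (simp add: mult_ac)
    qed
    also note l0
    finally have l: "A * real n ^ K * (1 - K * D * x) \<le> L n" .
    then have "1 - K * D * x \<le> L n / (A * real n ^ K)" using An by (simp add: le_divide_eq mult.commute)
    moreover have "K * D * x \<le> B * x" using x unfolding B_def by (intro mult_right_mono) auto
    ultimately have "- (B / real n) \<le> L n / (A * real n ^ K) - 1" by (simp add: x_def)
    then show ?thesis using u l by (simp add: x_def)
  qed
  have ev: "\<forall>\<^sub>F n in sequentially. real n > D + 1 \<and> n \<ge> K + 2"
    by (intro eventually_conj eventually_gt_at_top[THEN filterlim_real_sequentially[THEN filterlim_iff[THEN iffD1], rule_format]]
        eventually_ge_at_top)
  show "(\<lambda>n. L n / (A * real n ^ K) - 1) \<in> O(\<lambda>n. 1 / real n)"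
  proof (rule bigoI[of _ B])
    show "\<forall>\<^sub>F n in sequentially. norm (L n / (A * real n ^ K) - 1) \<le> B * norm (1 / real n)"
      using ev by eventually_elim (use bounds in simp)
  qed
  show "filterlim L at_top sequentially"
  proof (rule filterlim_at_top_mono)
    show "filterlim (\<lambda>n. (A / 2) * real n) at_top sequentially"
      using A by (intro filterlim_tendsto_pos_mult_at_top[OF tendsto_const] filterlim_real_sequentially) simp
    have "\<forall>\<^sub>F n in sequentially. real n > 2 * K * D"
      using eventually_gt_at_top[THEN filterlim_real_sequentially[THEN filterlim_iff[THEN iffD1], rule_format]] .
    with ev show "\<forall>\<^sub>F n in sequentially. (A / 2) * real n \<le> L n"
    proof eventually_elim
      case (elim n)
      then have n0: "real n \<ge> 1" using D by linarith
      have "K * D / real n \<le> 1 / 2" using elim n0 by (simp add: field_simps)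
      then have "A * real n ^ 1 * (1 / 2) \<le> A * real n ^ K * (1 - K * D / real n)"
        using A n0 K by (intro mult_mono power_increasing) auto
      also have "\<dots> \<le> L n" using bounds[of n] elim by simp
      finally show ?case by simp
    qed
  qed
qed

section \<open>The Fredholm alternative\<close>

text \<open>The equation decouples: it is diagonal on the span of the eigenvectors $\psi_i$, and on the orthogonal complement
  $zT$ has norm at most $1/2$, so that the Neumann series solves it.\<close>

lemma fredholm_alternative:
  assumes T: "cblinear T" "compact_operator T" and sym: "\<And>u v. cinner_L2 (T u) v = cinner_L2 u (T v)"
    and S: "finite S" and orth: "\<And>i j. i \<in> S \<Longrightarrow> j \<in> S \<Longrightarrow> cinner_L2 (\<psi> i) (\<psi> j) = (if i = j then 1 else 0)"
    and eig: "\<And>i. i \<in> S \<Longrightarrow> T (\<psi> i) = \<nu> i *\<^sub>R \<psi> i"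
    and small: "\<And>u. (\<And>i. i \<in> S \<Longrightarrow> cinner_L2 u (\<psi> i) = 0) \<Longrightarrow> norm z * norm (T u) \<le> norm u / 2"
    and inj: "\<And>u. u = cscale z (T u) \<Longrightarrow> u = 0"
  obtains C where "0 \<le> C" "\<And>v. \<exists>x. x - cscale z (T x) = v \<and> norm x \<le> C * norm v"
proof -
  define pr where "pr u = (\<Sum>i\<in>S. cscale (cinner_L2 u (\<psi> i)) (\<psi> i))" for u
  have pr\<psi>: "cinner_L2 (pr u) (\<psi> j) = cinner_L2 u (\<psi> j)" if "j \<in> S" for u j
    unfolding pr_def using orth S that by (intro cinner_orthonormal_sum) auto
  have perp: "cinner_L2 (u - pr u) (\<psi> j) = 0" if "j \<in> S" for u j
    using pr\<psi>[OF that] by (simp add: cinner_diff_left)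
  have n1: "norm (\<psi> i) = 1" if "i \<in> S" for i
  proof -
    have "complex_of_real ((norm (\<psi> i))\<^sup>2) = of_real 1" unfolding cinner_self[symmetric] using orth[OF that that] by simp
    then have "(norm (\<psi> i))\<^sup>2 = 1" by (simp only: of_real_eq_iff)
    then show ?thesis using norm_ge_zero[of "\<psi> i"] by (auto simp: power2_eq_1_iff)
  qed
  have le: "norm (u - pr u) \<le> norm u" for u
  proof -
    define x where "x = u - pr u"
    have "cinner_L2 x (pr u) = 0"
      unfolding pr_def[of u] cinner_sum_right by (intro sum.neutral) (simp add: x_def perp)
    then have "cinner_L2 x x = cinner_L2 x u" by (subst (2) x_def) (simp add: cinner_diff_right)
    then have "complex_of_real ((norm x)\<^sup>2) = cinner_L2 x u" by (simp only: cinner_self)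
    then have "(norm x)\<^sup>2 = norm (cinner_L2 x u)" by (metis norm_of_real abs_of_nonneg zero_le_power2)
    also have "\<dots> \<le> norm x * norm u" by (rule cinner_Cauchy_Schwarz)
    finally show ?thesis unfolding x_def[symmetric] by (cases "norm x = 0") (auto simp: power2_eq_square)
  qed
  have lin: "cblinear (\<lambda>u. u - pr u)"
  proof (rule cblinearI[of _ 1])
    show "u + v - pr (u + v) = u - pr u + (v - pr v)" for u v
      by (simp add: pr_def cinner_add_left L2.scale_left_distrib sum.distrib)
    show "cscale c u - pr (cscale c u) = cscale c (u - pr u)" for c u
      by (simp add: pr_def L2.scale_right_diff_distrib L2.scale_sum_right)
  qed (use le in simp)
  define A where "A u = cscale z (T (u - pr u))" for u
  have A: "cblinear A" unfolding A_def[abs_def] by (rule cblinear_cmult[OF cblinear_compose[OF T(1) lin]])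
  have cpt: "compact_operator A" unfolding A_def[abs_def]
    by (rule compact_operator_compose_left[OF compact_operator_compose_right[OF T(2) cblinear_bounded_linear[OF lin]]
        cblinear_bounded_linear[OF cblinear_cmult[OF cblinear_id]]])
  have Ahalf: "norm (A u) \<le> (1/2) * norm u" for u
    using small[of "u - pr u"] perp le[of u] by (simp add: A_def)
  have powA: "norm ((A ^^ n) u) \<le> (1/2) ^ n * norm u" for n u
    by (rule norm_funpow_le[OF Ahalf]) simp
  have sq: "summable (\<lambda>n. (1/2::real) ^ n)" by (rule summable_geometric) simp
  have suminf2: "(\<Sum>n. (1/2::real) ^ n) = 2" by (subst suminf_geometric) auto
  define k where "k i = 1 / (1 - z * of_real (\<nu> i))" for i
  have nz: "1 - z * of_real (\<nu> i) \<noteq> 0" if i: "i \<in> S" for i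
  proof
    assume "1 - z * of_real (\<nu> i) = 0"
    then have "\<psi> i = cscale z (T (\<psi> i))" by (simp add: eig[OF i] scaleR_eq_cscale)
    then show False using inj n1[OF i] by fastforce
  qed
  define C where "C = 2 + (\<Sum>i\<in>S. norm (k i))"
  have "\<exists>x. x - cscale z (T x) = v \<and> norm x \<le> C * norm v" for v
  proof -
    define v' where "v' = v - pr v"
    obtain x' where x': "x' - A x' = v'" "norm x' \<le> 2 * norm v'"
      by (rule neumann_series[OF cblinear_bounded_linear[OF A] cpt sq powA, of v', unfolded suminf2]) blast
    have px: "cinner_L2 x' (\<psi> j) = 0" if j: "j \<in> S" for j
    proof -
      have "cinner_L2 (A x') (\<psi> j) = 0"
        unfolding A_def cinner_cscale_left sym eig[OF j] cinner_scaleR_right perp[OF j] by simp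
      moreover have "x' = v' + A x'" using x'(1) by (simp add: algebra_simps)
      ultimately show ?thesis using perp[OF j, of v] by (metis add.right_neutral cinner_add_left v'_def)
    qed
    then have "pr x' = 0" by (simp add: pr_def)
    then have x'_eq: "x' - cscale z (T x') = v'" using x'(1) by (simp add: A_def)
    define y where "y = (\<Sum>i\<in>S. cscale (cinner_L2 v (\<psi> i) * k i) (\<psi> i))"
    have "y - cscale z (T y) = (\<Sum>i\<in>S. cscale (cinner_L2 v (\<psi> i) * k i) (\<psi> i) - cscale z (T (cscale (cinner_L2 v (\<psi> i) * k i) (\<psi> i))))"
      unfolding y_def cblinear_sum[OF T(1)] L2.scale_sum_right sum_subtractf ..
    also have "\<dots> = pr v" unfolding pr_def
    proof (intro sum.cong refl)
      fix i assume i: "i \<in> S"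
      have "cscale (cinner_L2 v (\<psi> i) * k i) (\<psi> i) - cscale z (T (cscale (cinner_L2 v (\<psi> i) * k i) (\<psi> i)))
          = cscale (cinner_L2 v (\<psi> i) * k i * (1 - z * of_real (\<nu> i))) (\<psi> i)"
        by (simp add: cblinear_cscale[OF T(1)] eig[OF i] scaleR_eq_cscale right_diff_distrib
            L2.scale_left_diff_distrib mult_ac)
      also have "cinner_L2 v (\<psi> i) * k i * (1 - z * of_real (\<nu> i)) = cinner_L2 v (\<psi> i)"
        using nz[OF i] by (simp add: k_def)
      finally show "cscale (cinner_L2 v (\<psi> i) * k i) (\<psi> i) - cscale z (T (cscale (cinner_L2 v (\<psi> i) * k i) (\<psi> i)))
          = cscale (cinner_L2 v (\<psi> i)) (\<psi> i)" .
    qed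
    finally have y_eq: "y - cscale z (T y) = pr v" .
    have "norm y \<le> (\<Sum>i\<in>S. norm v * norm (k i))" unfolding y_def
    proof (rule order_trans[OF norm_sum], intro sum_mono)
      fix i assume i: "i \<in> S"
      have "norm (cinner_L2 v (\<psi> i)) \<le> norm v" using cinner_Cauchy_Schwarz[of v "\<psi> i"] n1[OF i] by simp
      then show "norm (cscale (cinner_L2 v (\<psi> i) * k i) (\<psi> i)) \<le> norm v * norm (k i)"
        by (simp add: norm_mult n1[OF i] mult_right_mono)
    qed
    moreover have "norm x' \<le> 2 * norm v" using x'(2) le[of v] unfolding v'_def by linarith
    ultimately have "norm (x' + y) \<le> C * norm v"
      using norm_triangle_ineq[of x' y] unfolding C_def by (simp add: sum_distrib_left algebra_simps)
    moreover have "(x' + y) - cscale z (T (x' + y)) = v"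
    proof -
      have "(x' + y) - cscale z (T (x' + y)) = (x' - cscale z (T x')) + (y - cscale z (T y))"
        by (simp add: cblinear_add[OF T(1)] L2.scale_right_distrib)
      then show ?thesis unfolding x'_eq y_eq v'_def by simp
    qed
    ultimately show ?thesis by blast
  qed
  moreover have "0 \<le> C" unfolding C_def by (intro add_nonneg_nonneg sum_nonneg) auto
  ultimately show thesis using that by blast
qed

context hankel
begin

section \<open>Kernel and eigenfunctions of the Hankel operator\<close>

lemma eigenspace_iff:
  assumes "z \<noteq> 0" shows "u \<in> eigenspace (hankel_op K h t0) z \<longleftrightarrow> u = cscale z (T u)"
proof -
  have "P (cscale z u) = cscale z u \<longleftrightarrow> P u = u" using assms by (simp add: restr_cscale)
  moreover have "T (cscale z u) = cscale z (T u)" by (rule cblinear_cscale[OF cblinear_T])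
  moreover have "P u = u" if "u = cscale z (T u)" using that by (metis restr_T restr_cscale)
  ultimately show ?thesis unfolding eigenspace_def mem_Collect_eq hankel_op_iff by metis
qed

lemma kernel_eq: "op_ker (hankel_op K h t0) = L2_subspace {t0<..}"
proof -
  have "op_ker (hankel_op K h t0) = {u. P u = 0}"
    unfolding op_ker_def hankel_op_iff
    by (simp add: cblinear_zero[OF cblinear_T] cblinear_zero[OF cblinear_restr])
  also have "\<dots> = L2_subspace {t0<..}"
  proof (intro equalityI subsetI)
    have *: "P (abs_L2 f) = 0 \<longleftrightarrow> ae_eq ({0<..} - {t0<..}) f (\<lambda>x. 0)" if f: "L2_fun {0<..} f" for f
    proof -
      have "P (abs_L2 f) = 0 \<longleftrightarrow> ae_eq I f (\<lambda>x. 0)"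
        unfolding restr_abs[OF f] using emb_eq_iff[OF L2_fun_I[OF f] L2_fun_0] by simp
      also have "\<dots> \<longleftrightarrow> ae_eq ({0<..} - {t0<..}) f (\<lambda>x. 0)"
      proof
        assume "ae_eq I f (\<lambda>x. 0)"
        then show "ae_eq ({0<..} - {t0<..}) f (\<lambda>x. 0)" unfolding ae_eq_def
          using AE_lborel_singleton[of t0] by eventually_elim auto
      next
        assume "ae_eq ({0<..} - {t0<..}) f (\<lambda>x. 0)"
        then show "ae_eq I f (\<lambda>x. 0)" unfolding ae_eq_def by eventually_elim auto
      qed
      finally show ?thesis .
    qed
    show "u \<in> L2_subspace {t0<..}" if "u \<in> {u. P u = 0}" for u
      using *[OF L2_fun_rep, of u] that L2_fun_rep[of u]
      unfolding L2_subspace_def abs_rep_L2 by (auto intro!: exI[of _ "rep_L2 u"] simp: abs_rep_L2)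
    show "u \<in> {u. P u = 0}" if "u \<in> L2_subspace {t0<..}" for u
      using * that unfolding L2_subspace_def by auto
  qed
  finally show ?thesis .
qed

lemma eigenvalue_real:
  assumes u: "u = cscale z (T u)" "u \<noteq> 0" shows "z = of_real (Re z)" "z \<noteq> 0"
proof -
  have eq: "of_real ((norm u)\<^sup>2) = z * cinner_L2 (T u) u"
    using arg_cong[OF u(1), of "\<lambda>x. cinner_L2 x u"] unfolding cinner_self cinner_cscale_left .
  define r where "r = Re (cinner_L2 (T u) u)"
  have "cnj (cinner_L2 (T u) u) = cinner_L2 (T u) u" using T_sym[of u u] cinner_cnj[of "T u" u] by simp
  then have "cinner_L2 (T u) u = of_real r" by (simp add: complex_eq_iff r_def)
  then have e: "of_real ((norm u)\<^sup>2) = z * of_real r" using eq by simp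
  then show "z \<noteq> 0" using u(2) by auto
  have "r \<noteq> 0" using e u(2) by auto
  moreover have "Im z * r = 0" using arg_cong[OF e, of Im] by simp
  ultimately have "Im z = 0" by simp
  then show "z = of_real (Re z)" by (simp add: complex_eq_iff)
qed

text \<open>An eigenfunction with $f^{(j)}(t_0) = 0$ for $j < K$ vanishes: on such functions $J$
  anticommutes with $V$, so $y = f^{(K)}$ and $w = Jy$ solve two Volterra equations, and
  eliminating $w$ leaves one of the form $y = VR''y$.\<close>

lemma eigenvector_eq_0:
  assumes g: "g = cscale z (T g)" and constraint: "\<And>i. i < K \<Longrightarrow> constraint i g = 0"
  shows "g = 0"
proof -
  define y where "y = Y (J g)"
  define w where "w = J y"
  have Tg: "T g = (V ^^ K) y" by (simp add: T_def y_def)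
  have Pg: "P g = g" using g by (metis restr_T restr_cscale)
  have van: "cinner_L2 ((V ^^ i) y) one = 0" if "i < K" for i using constraint[OF that] that by (simp add: constraint_def y_def)
  have JV: "J ((V ^^ n) y) = (-1) ^ n *\<^sub>R (V ^^ n) w" if "n \<le> K" for n
    using that
  proof (induction n)
    case (Suc n)
    then have "J ((V ^^ Suc n) y) = - V (J ((V ^^ n) y))" using refl_prim[OF van[of n]] by simp
    also have "\<dots> = (-1) ^ Suc n *\<^sub>R (V ^^ Suc n) w" using Suc by (simp add: prim_scaleR)
    finally show ?case .
  qed (simp add: w_def)
  interpret r: hankel t0 K "\<lambda>k. (-1) ^ (K + k) * h k"
    by unfold_locales (use K hK in auto)
  have rcoef: "r.coef k = (-1) ^ (K - k) * coef k" if "k \<le> K" for k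
  proof -
    have "(-1) ^ k * (-1) ^ (K + k) = ((-1) ^ (K - k) * (-1) ^ k :: real)"
      using that by (simp flip: power_add) (simp add: power_add mult.assoc flip: power_mult_distrib)
    then show ?thesis unfolding r.coef_def coef_def by (simp only: mult.assoc[symmetric])
  qed
  have Dy: "D y = cscale z (J ((V ^^ K) y))"
    using arg_cong[OF g, of J] by (simp add: y_def refl_cscale T_def)
  have "r.D w = J (D y)"
    unfolding r.D_def D_def cblinear_sum[OF cblinear_refl] refl_scaleR
  proof (intro sum.cong refl)
    fix k assume "k \<in> {..K}"
    then have k: "k \<le> K" "K - k \<le> K" by auto
    show "r.coef k *\<^sub>R (V ^^ (K - k)) w = coef k *\<^sub>R J ((V ^^ (K - k)) y)"
      unfolding JV[OF k(2)] rcoef[OF k(1)] scaleR_scaleR by (simp only: mult.commute)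
  qed
  also have "\<dots> = cscale z (P ((V ^^ K) y))" by (simp add: Dy refl_cscale)
  also have "P ((V ^^ K) y) = (V ^^ K) y" using K by (intro restr_funpow) simp
  finally have Dw: "r.D w = cscale z ((V ^^ K) y)" .
  define \<kappa> where "\<kappa> = z * (-1) ^ K / of_real (coef K)"
  define \<kappa>' where "\<kappa>' = z / of_real (r.coef K)"
  have ey: "y - V (R y) = cscale \<kappa> ((V ^^ K) w)"
  proof -
    have "y - V (R y) = (1 / coef K) *\<^sub>R D y" unfolding D_eq using coef_K by simp
    then show ?thesis unfolding Dy JV[OF order_refl] by (simp add: \<kappa>_def scaleR_eq_cscale mult_ac)
  qed
  have ew: "w - V (r.R w) = cscale \<kappa>' ((V ^^ K) y)"
  proof -
    have "w - V (r.R w) = (1 / r.coef K) *\<^sub>R r.D w" unfolding r.D_eq using r.coef_K by simp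
    then show ?thesis unfolding Dw by (simp add: \<kappa>'_def scaleR_eq_cscale mult_ac)
  qed
  have comm: "R ((V ^^ n) u) = (V ^^ n) (R u)" "r.R ((V ^^ n) u) = (V ^^ n) (r.R u)" for n u
    by (induction n) (simp_all add: R_prim r.R_prim)
  have Vc: "V (cscale c u) = cscale c (V u)" and Vd: "V (u - v) = V u - V v" for c u v
    by (rule cblinear_cscale[OF cblinear_prim], rule cblinear_diff[OF cblinear_prim])
  define R'' where "R'' u = R u + r.R u - r.R (V (R u)) + cscale (\<kappa> * \<kappa>') ((V ^^ (K - 1)) ((V ^^ K) u))" for u
  have R'': "cblinear R''" unfolding R''_def[abs_def]
    by (rule cblinear_plus[OF cblinear_minus[OF cblinear_plus[OF cblinear_R r.cblinear_R]
        cblinear_compose[OF r.cblinear_R cblinear_compose[OF cblinear_prim cblinear_R]]]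
        cblinear_cmult[OF cblinear_compose[OF cblinear_funpow[OF cblinear_prim] cblinear_funpow[OF cblinear_prim]]]])
  have commR'': "R'' (V u) = V (R'' u)" for u
    unfolding R''_def by (simp add: R_prim r.R_prim Vc Vd cblinear_add[OF cblinear_prim] funpow_swap1)
  have "y - V (R'' y) = 0"
  proof -
    have rd: "r.R (u - v) = r.R u - r.R v" "r.R (cscale c u) = cscale c (r.R u)" for u v c
      by (rule cblinear_diff[OF r.cblinear_R], rule cblinear_cscale[OF r.cblinear_R])
    have Vn: "V ((V ^^ (K - Suc 0)) u) = (V ^^ K) u" for u using K by (cases K) simp_all
    have Kd: "(V ^^ K) (u - v) = (V ^^ K) u - (V ^^ K) v" "(V ^^ K) (cscale c u) = cscale c ((V ^^ K) u)" for u v c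
      by (rule cblinear_diff[OF cblinear_funpow[OF cblinear_prim]], rule cblinear_cscale[OF cblinear_funpow[OF cblinear_prim]])
    have "(y - V (R y)) - V (r.R (y - V (R y))) = cscale \<kappa> ((V ^^ K) (w - V (r.R w)))"
      unfolding ey rd comm Vc Kd L2.scale_right_diff_distrib by (simp add: funpow_swap1)
    also have "\<dots> = cscale (\<kappa> * \<kappa>') ((V ^^ K) ((V ^^ K) y))" unfolding ew Kd by simp
    finally show ?thesis
      unfolding R''_def by (simp add: Vc Vd cblinear_add[OF cblinear_prim] Vn rd) (simp add: algebra_simps)
  qed
  moreover obtain C where "\<And>y. norm y \<le> C * norm (y - V (R'' y))"
    by (rule volterra_solution[OF R'' commR'']) blast
  ultimately have "norm y \<le> C * norm (0::L2)" by metis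
  then have "y = 0" by simp
  then have "T g = 0" unfolding Tg by (simp add: cblinear_zero[OF cblinear_funpow[OF cblinear_prim]])
  then show ?thesis using g by simp
qed

text \<open>More than $K$ independent eigenvectors would have a nonzero combination satisfying the $K$ conditions of
  \<open>eigenvector_eq_0\<close>.\<close>

lemma eigenspace_dim_le:
  assumes S: "finite S" and orth: "\<And>i j. i \<in> S \<Longrightarrow> j \<in> S \<Longrightarrow> cinner_L2 (\<phi> i) (\<phi> j) = (if i = j then 1 else 0)"
    and eig: "\<And>i. i \<in> S \<Longrightarrow> \<phi> i = cscale z (T (\<phi> i))"
  shows "card S \<le> K"
proof (rule ccontr)
  assume "\<not> card S \<le> K"
  then have "K < card S" by simp
  then obtain a where a: "\<exists>j\<in>S. a j \<noteq> 0" "\<And>i. i < K \<Longrightarrow> (\<Sum>j\<in>S. a j * constraint i (\<phi> j)) = 0"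
    by (rule underdetermined_system[OF S, of K "\<lambda>i j. constraint i (\<phi> j)"]) blast
  define g where "g = (\<Sum>j\<in>S. cscale (a j) (\<phi> j))"
  have "cscale z (T g) = (\<Sum>j\<in>S. cscale (a j) (cscale z (T (\<phi> j))))"
    unfolding g_def cblinear_sum[OF cblinear_T] cblinear_cscale[OF cblinear_T] L2.scale_sum_right
    by (intro sum.cong refl cscale_commute)
  also have "\<dots> = g" unfolding g_def using eig by (intro sum.cong refl) simp
  finally have "g = cscale z (T g)" by simp
  moreover have "constraint i g = 0" if "i < K" for i unfolding g_def constraint_sum by (rule a(2)[OF that])
  ultimately have "g = 0" by (rule eigenvector_eq_0)
  moreover have "cinner_L2 g (\<phi> j) = a j" if "j \<in> S" for j
    unfolding g_def using orth S that by (intro cinner_orthonormal_sum) auto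
  ultimately show False using a(1) by auto
qed

text \<open>With $f = V^Ky$ the derivatives of order less than $K$ are continuous primitives. The $K$-th one is defined by
  solving the differential equation for it: the other terms are continuous.\<close>

lemma eigenvector_solves_bvp:
  assumes u: "u = cscale (of_real l) (T u)"
  obtains f where "L2_fun {0<..} f" "u = abs_L2 f" "solves_bvp K h t0 l f"
proof -
  define y where "y = cscale (of_real l) (Y (J u))"
  have uy: "u = (V ^^ K) y" unfolding y_def cblinear_cscale[OF cblinear_funpow[OF cblinear_prim]] using u by (simp only: T_def)
  have Py: "P y = y" unfolding y_def restr_cscale by (simp add: restr_Y)
  have Dy: "D y = cscale (of_real l) (J u)" unfolding y_def cblinear_cscale[OF cblinear_D] by simp
  define d where "d k t = cinner_L2 ((V ^^ (K - Suc k)) y) (\<eta> t)" for k t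
  define top where "top t = (of_real l * d 0 (t0 - t) - (\<Sum>k<K. (-1) ^ k * of_real (h k) * d k t)) / of_real (coef K)" for t
  have cd: "continuous_on {0..t0} (d k)" for k unfolding d_def[abs_def] by (rule continuous_on_cinner_chi)
  have cdr: "continuous_on {0..t0} (\<lambda>t. d 0 (t0 - t))"
    by (rule continuous_on_compose2[OF cd]) (auto intro!: continuous_intros)
  have ctop: "continuous_on {0..t0} top"
    unfolding top_def[abs_def] by (intro continuous_intros cd cdr) (use coef_K in simp)
  have ed: "emb t0 (d k) = (V ^^ (K - k)) y" if "k < K" for k
  proof -
    have "K - k = Suc (K - Suc k)" using that by simp
    then show ?thesis unfolding d_def[abs_def] by (simp add: prim_def)
  qed
  have ud: "u = emb t0 (d 0)" using uy ed[of 0] K by simp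
  have etop: "emb t0 top = y"
  proof -
    have "cscale (of_real (coef K)) (emb t0 top) = emb t0 (\<lambda>t. of_real l * d 0 (t0 - t) + (\<Sum>k<K. - ((-1) ^ k * of_real (h k)) * d k t))"
      unfolding emb_cscale[OF L2_fun_continuous[OF ctop]] using coef_K
      by (intro emb_cong) (simp add: top_def sum_negf)
    also have "\<dots> = cscale (of_real l) (J u) + (\<Sum>k<K. - (coef k *\<^sub>R (V ^^ (K - k)) y))"
    proof -
      note s = emb_sum[of "{..<K}" t0 "\<lambda>k t. - ((-1) ^ k * of_real (h k)) * d k t",
        OF finite_lessThan L2_fun_cmult[OF L2_fun_continuous[OF cd]]]
      have "cscale (of_real l) (J u) = emb t0 (\<lambda>t. of_real l * d 0 (t0 - t))"
        unfolding ud refl_emb[OF L2_fun_continuous[OF cd]] by (rule emb_cscale[OF L2_fun_continuous[OF cdr]])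
      moreover have "(\<Sum>k<K. - (coef k *\<^sub>R (V ^^ (K - k)) y)) = emb t0 (\<lambda>t. \<Sum>k<K. - ((-1) ^ k * of_real (h k)) * d k t)"
        unfolding conjunct2[OF s, symmetric]
      proof (intro sum.cong refl)
        fix k assume "k \<in> {..<K}"
        then show "- (coef k *\<^sub>R (V ^^ (K - k)) y) = emb t0 (\<lambda>t. - ((-1) ^ k * of_real (h k)) * d k t)"
          using emb_cscale[OF L2_fun_continuous[OF cd], of "- ((-1) ^ k * of_real (h k))" k]
          by (simp add: ed scaleR_eq_cscale coef_def)
      qed
      ultimately show ?thesis
        using emb_add[OF L2_fun_cmult[OF L2_fun_continuous[OF cdr]] conjunct1[OF s]] by simp
    qed
    also have "\<dots> = coef K *\<^sub>R y"
      using Dy unfolding D_def lessThan_Suc_atMost[symmetric] by (simp add: sum_negf algebra_simps)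
    finally show ?thesis using coef_K by (simp add: scaleR_eq_cscale)
  qed
  define f where "f t = (if t \<in> {0..t0} then d 0 t else 0)" for t
  define D' where "D' k = (if k < K then d k else top)" for k
  have "L2_fun {0<..} (\<lambda>t. indicator I t *\<^sub>R d 0 t)" by (rule L2_fun_indicator[OF L2_fun_continuous[OF cd]])
  moreover have ae: "ae_eq {0<..} (\<lambda>t. indicator I t *\<^sub>R d 0 t) f"
    unfolding ae_eq_def using AE_lborel_singleton[of t0] by eventually_elim (auto simp: f_def)
  moreover have Lf: "L2_fun {0<..} f"
  proof -
    have "L2_fun {0..t0} (d 0)"
      unfolding L2_fun_def set_borel_measurable_def measurable_lborel2
      by (intro conjI borel_measurable_continuous_on_indicator cd borel_integrable_atLeastAtMost' continuous_intros) auto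
    then have "L2_fun {0<..t0} (d 0)" by (rule L2_fun_subset) auto
    moreover have "indicator {0<..} x *\<^sub>R f x = indicator {0<..t0} x *\<^sub>R d 0 x" for x
      by (auto simp: f_def indicator_def)
    ultimately show ?thesis unfolding L2_fun_alt by (simp only:)
  qed
  ultimately have "abs_L2 (\<lambda>t. indicator I t *\<^sub>R d 0 t) = abs_L2 f" by (simp add: abs_L2_eq_iff)
  then have uf: "u = abs_L2 f" using ud unfolding emb_def by simp
  have "solves_bvp K h t0 l f"
    unfolding solves_bvp_def
  proof (intro exI[of _ D'] conjI ballI allI impI)
    show "D' 0 t = f t" if "t \<in> {0..t0}" for t using that K by (simp add: D'_def f_def)
    show "(D' k has_vector_derivative D' (Suc k) t) (at t within {0..t0})" if "k < K" "t \<in> {0..t0}" for k t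
    proof (cases "Suc k < K")
      case True
      have "((\<lambda>t. cinner_L2 (emb t0 (d (Suc k))) (\<eta> t)) has_vector_derivative d (Suc k) t) (at t within {0..t0})"
        by (rule cinner_chi_has_derivative[OF cd that(2)])
      then have "((\<lambda>t. d k t) has_vector_derivative d (Suc k) t) (at t within {0..t0})"
        unfolding ed[OF True] d_def[of k] .
      then show ?thesis using True that(1) by (simp add: D'_def)
    next
      case False
      then have k: "K - Suc k = 0" "K = Suc k" using that(1) by auto
      have "((\<lambda>t. cinner_L2 (emb t0 top) (\<eta> t)) has_vector_derivative top t) (at t within {0..t0})"
        by (rule cinner_chi_has_derivative[OF ctop that(2)])
      then show ?thesis using k by (simp add: etop D'_def d_def[abs_def])
    qed
    show "(\<Sum>k\<le>K. (- 1) ^ k * complex_of_real (h k) * D' k t) = of_real l * f (t0 - t)" if t: "t \<in> I" for t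
    proof -
      have "(\<Sum>k\<le>K. (- 1) ^ k * complex_of_real (h k) * D' k t)
          = (\<Sum>k<K. (- 1) ^ k * of_real (h k) * d k t) + of_real (coef K) * top t"
        unfolding lessThan_Suc_atMost[symmetric] by (simp add: D'_def coef_def)
      also have "\<dots> = of_real l * d 0 (t0 - t)" using coef_K by (simp add: top_def)
      finally show ?thesis using t by (simp add: f_def)
    qed
    show "D' j 0 = 0" if "j < K" for j using that by (simp add: D'_def d_def)
  qed
  then show thesis using that Lf uf by blast
qed

section \<open>The spectrum of the Hankel operator\<close>

definition lead_const :: real where "lead_const = \<bar>h K\<bar> * (2 * pi * inverse t0) ^ K"
definition lower_const :: real where "lower_const = (\<Sum>k<K. \<bar>h k\<bar> * (2 * pi * inverse t0) ^ k)"

lemma lead_const_pos: "0 < lead_const" and lower_const_nonneg: "0 \<le> lower_const"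
  using hK t0 by (auto simp: lead_const_def lower_const_def intro!: sum_nonneg)

lemma symbol_estimate:
  assumes "1 \<le> m"
  shows "\<bar>norm (symbol (int m)) - lead_const * real m ^ K\<bar> \<le> lower_const * real m ^ (K - 1)"
proof -
  let ?q = "2 * pi * inverse t0"
  have \<omega>: "\<omega> (int m) = ?q * real m" "0 \<le> \<omega> (int m)" using t0 by (simp_all add: \<omega>_def divide_inverse)
  have n: "norm (of_real (coef k) * (\<i> * of_real (\<omega> (int m))) ^ k) = \<bar>h k\<bar> * ?q ^ k * real m ^ k" for k
    using \<omega> t0 by (simp add: norm_mult norm_power norm_inverse coef_def power_abs abs_mult power_mult_distrib)
  have s: "symbol (int m) = (\<Sum>k<K. of_real (coef k) * (\<i> * of_real (\<omega> (int m))) ^ k) + of_real (coef K) * (\<i> * of_real (\<omega> (int m))) ^ K"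
    unfolding symbol_def lessThan_Suc_atMost[symmetric] by simp
  have "\<bar>norm (symbol (int m)) - norm (of_real (coef K) * (\<i> * of_real (\<omega> (int m))) ^ K)\<bar>
      \<le> norm (\<Sum>k<K. of_real (coef k) * (\<i> * of_real (\<omega> (int m))) ^ k)"
    unfolding s by (rule order_trans[OF norm_triangle_ineq3]) simp
  also have "\<dots> \<le> (\<Sum>k<K. \<bar>h k\<bar> * ?q ^ k * real m ^ k)"
    by (rule order_trans[OF norm_sum]) (simp only: n order_refl)
  also have "\<dots> \<le> (\<Sum>k<K. \<bar>h k\<bar> * ?q ^ k * real m ^ (K - 1))"
    using assms t0 by (intro sum_mono mult_left_mono power_increasing) auto
  finally show ?thesis unfolding n lead_const_def lower_const_def sum_distrib_right .
qed

text \<open>The $n$-th eigenvalue of $H$ is $1/\mu_{n-1}$. The test space for $\mu_{n-1}$ in \<open>form_lower_bound\<close> uses the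
  frequencies up to $n + K$, and the $n - 1$ conditions allowed for the opposite bound are those of
  \<open>form_upper_bound\<close> with $N = n - K - 2$; so $1/\mu_{n-1}$ lies between the symbol at $n - K - 1$ and at $n + K$, up
  to lower order terms.\<close>

lemma positive_spectrum:
  obtains \<phi> \<mu> where "\<And>i j. cinner_L2 (\<phi> i) (\<phi> j) = (if i = j then 1 else 0)"
    "\<And>n. T (\<phi> n) = \<mu> n *\<^sub>R \<phi> n" "\<And>n. 0 < \<mu> n" "decseq \<mu>" "\<mu> \<longlonglongrightarrow> 0"
    "\<And>n u. \<forall>i<n. cinner_L2 u (\<phi> i) = 0 \<Longrightarrow> inner (T u) u \<le> \<mu> n * (norm u)\<^sup>2"
    "(\<lambda>n. (1 / \<mu> (n - 1)) / (lead_const * real n ^ K) - 1) \<in> O(\<lambda>n. 1 / real n)"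
    "filterlim (\<lambda>n. 1 / \<mu> (n - 1)) at_top sequentially"
proof -
  define U where "U N = real N ^ (K - 1) * (lead_const * real N + lower_const)" for N
  have Kpow: "x ^ K = x ^ (K - 1) * x" for x :: real using K by (cases K) auto
  have U_pos: "0 < U N" if "1 \<le> N" for N using that lead_const_pos lower_const_nonneg by (simp add: U_def add_pos_nonneg)
  have U_mono: "U m \<le> U N" if "m \<le> N" for m N
    unfolding U_def using that lead_const_pos lower_const_nonneg
    by (intro mult_mono power_mono add_right_mono mult_left_mono add_nonneg_nonneg) auto
  have symbol_le: "norm (symbol (int m)) \<le> U m" if "1 \<le> m" for m
    using symbol_estimate[OF that] unfolding U_def Kpow by (simp add: algebra_simps)
  define a where "a n = 1 / U (n + K + 1)" for n
  have a_pos: "0 < a n" for n unfolding a_def using U_pos[of "n + K + 1"] by simp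
  have low: "\<exists>g. g \<noteq> 0 \<and> (\<forall>i<n. cinner_L2 g (b i) = 0) \<and> a n * (norm g)\<^sup>2 \<le> inner (T g) g" for n b
  proof (rule form_lower_bound[of "U (n + K + 1)" n b])
    show U0: "0 < U (n + K + 1)" by (rule U_pos) simp
    show "norm (symbol (int m)) \<le> U (n + K + 1)" if "m \<in> {1..n + K + 1}" for m
      using order_trans[OF symbol_le U_mono] that by simp
    fix g assume g: "g \<noteq> 0" "\<And>i. i < n \<Longrightarrow> cinner_L2 g (b i) = 0" "(norm g)\<^sup>2 \<le> U (n + K + 1) * inner (T g) g"
    have "a n * (norm g)\<^sup>2 \<le> a n * (U (n + K + 1) * inner (T g) g)"
      using a_pos[of n] by (intro mult_left_mono g(3)) simp
    also have "\<dots> = inner (T g) g" using U0 by (simp add: a_def)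
    finally show ?thesis using g by blast
  qed
  obtain \<phi> \<mu> where orth: "\<And>i j. cinner_L2 (\<phi> i) (\<phi> j) = (if i = j then 1 else 0)"
    and eig: "\<And>n. T (\<phi> n) = \<mu> n *\<^sub>R \<phi> n" and a\<mu>: "\<And>n. a n \<le> \<mu> n" and dec: "decseq \<mu>"
    and form: "\<And>n u. \<forall>i<n. cinner_L2 u (\<phi> i) = 0 \<Longrightarrow> inner (T u) u \<le> \<mu> n * (norm u)\<^sup>2"
    by (rule spectral_sequence[OF cblinear_T compact_operator_T T_sym low a_pos]) (rule that, assumption+)
  have \<mu>_pos: "0 < \<mu> n" for n using a_pos[of n] a\<mu>[of n] by linarith
  have up: "1 / \<mu> (n - 1) \<le> real (n + K) ^ (K - 1) * (lead_const * real (n + K) + lower_const)" if "1 \<le> n" for n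
  proof -
    have "1 / \<mu> (n - 1) \<le> 1 / a (n - 1)" using a_pos a\<mu> \<mu>_pos by (intro divide_left_mono) auto
    also have "\<dots> = U (n + K)" using that by (simp add: a_def)
    finally show ?thesis by (simp only: U_def)
  qed
  have lo: "(real n - (K + 1)) ^ (K - 1) * (lead_const * (real n - (K + 1)) - lower_const) \<le> 1 / \<mu> (n - 1)"
    if n: "K + 2 \<le> n" "lower_const < lead_const * (real n - (K + 1))" for n
  proof -
    define \<Lambda> where "\<Lambda> = (real n - (K + 1)) ^ (K - 1) * (lead_const * (real n - (K + 1)) - lower_const)"
    define N where "N = n - (K + 2)"
    have N: "n - 1 = Suc (K + N)" "real n - (K + 1) = real (Suc N)" using n(1) by (simp_all add: N_def of_nat_diff)
    have n2: "lower_const < lead_const * real (Suc N)" using n(2) unfolding N(2) .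
    have \<Lambda>0: "0 < \<Lambda>" unfolding \<Lambda>_def N(2) using n2 by simp
    have "\<Lambda> \<le> norm (symbol (int m))" if m: "N < m" for m
    proof -
      have "\<Lambda> \<le> real m ^ (K - 1) * (lead_const * real m - lower_const)"
        unfolding \<Lambda>_def N(2) using m n2 lead_const_pos by (intro mult_mono power_mono diff_right_mono mult_left_mono) auto
      also have "\<dots> \<le> norm (symbol (int m))"
        using symbol_estimate[of m] m unfolding Kpow by (simp add: algebra_simps)
      finally show ?thesis .
    qed
    then have ub: "inner (T g) g \<le> (1 / \<Lambda>) * (norm g)\<^sup>2" if "\<And>i. i < n - 1 \<Longrightarrow> constraint i g = 0" for g
      using form_upper_bound[of N g \<Lambda>] that \<Lambda>0 unfolding N(1) by (simp add: field_simps less_Suc_eq_le)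
    have "\<mu> (n - 1) \<le> 1 / \<Lambda>"
      by (rule spectral_sequence_le[OF cblinear_T orth eig dec, of constraint, OF constraint_sum ub])
    then show ?thesis using \<Lambda>0 \<mu>_pos[of "n - 1"] unfolding \<Lambda>_def[symmetric] by (simp add: field_simps)
  qed
  note asy = asymptotics_of_bounds[OF lead_const_pos lower_const_nonneg K, of "\<lambda>n. 1 / \<mu> (n - 1)", OF up lo]
  have "(\<lambda>n. inverse (1 / \<mu> (n - 1))) \<longlonglongrightarrow> 0" by (rule tendsto_inverse_0_at_top[OF asy(2)])
  then have "(\<lambda>n. \<mu> (n - 1)) \<longlonglongrightarrow> 0" by simp
  from LIMSEQ_Suc[OF this] have "\<mu> \<longlonglongrightarrow> 0" by simp
  then show thesis using that[of \<phi> \<mu>] orth eig \<mu>_pos dec form asy by blast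
qed

lemma T_eigen_iff:
  assumes "l \<noteq> 0" shows "u = cscale (of_real l) (T u) \<longleftrightarrow> T u = (1 / l) *\<^sub>R u"
proof
  assume "u = cscale (of_real l) (T u)"
  then have "(1 / l) *\<^sub>R u = (1 / l) *\<^sub>R cscale (of_real l) (T u)" by (rule arg_cong)
  also have "\<dots> = T u" using assms by (simp add: scaleR_eq_cscale)
  finally show "T u = (1 / l) *\<^sub>R u" by simp
next
  assume "T u = (1 / l) *\<^sub>R u"
  then have "cscale (of_real l) (T u) = cscale (of_real l) ((1 / l) *\<^sub>R u)" by (rule arg_cong)
  then show "u = cscale (of_real l) (T u)" using assms by (simp add: scaleR_eq_cscale)
qed

text \<open>Applied to the coefficients $-h_k$ this also gives the negative eigenvalues of $H$.\<close>

lemma positive_eigenvalues: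
  obtains lp \<phi> where
    "\<And>n. 1 \<le> n \<Longrightarrow> 0 < lp n \<and> lp n \<le> lp (Suc n)"
    "\<And>i j. cinner_L2 (\<phi> i) (\<phi> j) = (if i = j then 1 else 0)"
    "\<And>n. T (\<phi> n) = (1 / lp (Suc n)) *\<^sub>R \<phi> n"
    "\<And>n u. \<forall>i<n. cinner_L2 u (\<phi> i) = 0 \<Longrightarrow> inner (T u) u \<le> (1 / lp (Suc n)) * (norm u)\<^sup>2"
    "\<And>n. 1 \<le> n \<Longrightarrow> eigenvalue (hankel_op K h t0) (of_real (lp n))
      \<and> has_multiplicity (hankel_op K h t0) (of_real (lp n)) (card {m. 1 \<le> m \<and> lp m = lp n})
      \<and> card {m. 1 \<le> m \<and> lp m = lp n} \<le> K"
    "filterlim lp at_top sequentially"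
    "\<exists>\<epsilon>. \<epsilon> \<in> O(\<lambda>n. 1 / real n) \<and> (\<forall>n\<ge>1. lp n = \<bar>h K\<bar> * (2 * pi * inverse t0 * real n) ^ K * (1 + \<epsilon> n))"
    "\<And>l u. 0 < l \<Longrightarrow> u \<noteq> 0 \<Longrightarrow> u = cscale (of_real l) (T u) \<Longrightarrow> \<exists>n\<ge>1. l = lp n"
proof -
  obtain \<phi> \<mu> where orth: "\<And>i j. cinner_L2 (\<phi> i) (\<phi> j) = (if i = j then 1 else 0)"
    and eig: "\<And>n. T (\<phi> n) = \<mu> n *\<^sub>R \<phi> n" and pos: "\<And>n. 0 < \<mu> n" and dec: "decseq \<mu>" and lim: "\<mu> \<longlonglongrightarrow> 0"
    and form: "\<And>n u. \<forall>i<n. cinner_L2 u (\<phi> i) = 0 \<Longrightarrow> inner (T u) u \<le> \<mu> n * (norm u)\<^sup>2"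
    and asy: "(\<lambda>n. (1 / \<mu> (n - 1)) / (lead_const * real n ^ K) - 1) \<in> O(\<lambda>n. 1 / real n)"
      "filterlim (\<lambda>n. 1 / \<mu> (n - 1)) at_top sequentially"
    by (rule positive_spectrum) (rule that, assumption+)
  define lp where "lp n = 1 / \<mu> (n - 1)" for n
  have mu: "1 / lp (Suc n) = \<mu> n" for n by (simp add: lp_def)
  have lp_pos: "0 < lp n" for n using pos by (simp add: lp_def)
  have span: "finite {n. \<mu> n = c}" "L2.span (\<phi> ` {n. \<mu> n = c}) = {u. T u = c *\<^sub>R u}"
    "L2.independent (\<phi> ` {n. \<mu> n = c})" "inj \<phi>" if c: "0 < c" for c
    by (rule eigenspace_span[OF cblinear_T T_sym orth eig lim _ c], rule form, assumption)+
  have esp: "eigenspace (hankel_op K h t0) (of_real l) = {u. T u = (1 / l) *\<^sub>R u}" if "0 < l" for l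
  proof -
    have "u \<in> eigenspace (hankel_op K h t0) (of_real l) \<longleftrightarrow> T u = (1 / l) *\<^sub>R u" for u
      using that eigenspace_iff[of "of_real l" u] T_eigen_iff[of l u] by simp
    then show ?thesis by blast
  qed
  have mult: "eigenvalue (hankel_op K h t0) (of_real (lp n))
      \<and> has_multiplicity (hankel_op K h t0) (of_real (lp n)) (card {m. 1 \<le> m \<and> lp m = lp n})
      \<and> card {m. 1 \<le> m \<and> lp m = lp n} \<le> K" if n: "1 \<le> n" for n
  proof -
    define c where "c = 1 / lp n"
    have c: "0 < c" using lp_pos by (simp add: c_def)
    define S where "S = {j. \<mu> j = c}"
    have "{m. 1 \<le> m \<and> lp m = lp n} = Suc ` S"
    proof (intro equalityI subsetI)
      fix m assume "m \<in> {m. 1 \<le> m \<and> lp m = lp n}"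
      then have "m = Suc (m - 1)" "m - 1 \<in> S" using mu[of "m - 1"] by (auto simp: S_def c_def)
      then show "m \<in> Suc ` S" by blast
    next
      fix m assume "m \<in> Suc ` S"
      then obtain j where j: "m = Suc j" "\<mu> j = c" by (auto simp: S_def)
      then have "1 / lp m = 1 / lp n" using mu[of j] by (simp add: c_def)
      then show "m \<in> {m. 1 \<le> m \<and> lp m = lp n}" using j(1) by simp
    qed
    then have card: "card {m. 1 \<le> m \<and> lp m = lp n} = card S" by (simp add: card_image)
    have fin: "finite S" unfolding S_def by (rule span(1)[OF c])
    have "card S \<le> K"
    proof (rule eigenspace_dim_le[OF fin, of \<phi> "of_real (lp n)"])
      show "\<phi> i = cscale (complex_of_real (lp n)) (T (\<phi> i))" if "i \<in> S" for i
        using that lp_pos[of n] T_eigen_iff[of "lp n" "\<phi> i"] by (simp add: eig S_def c_def)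
    qed (rule orth)
    moreover have "has_multiplicity (hankel_op K h t0) (of_real (lp n)) (card S)"
      unfolding has_multiplicity_def
    proof (intro exI[of _ "\<phi> ` S"] conjI)
      show "finite (\<phi> ` S)" using fin by simp
      show "card (\<phi> ` S) = card S" using span(4)[OF c] by (intro card_image) (auto intro: inj_on_subset)
      show "L2.independent (\<phi> ` S)" unfolding S_def by (rule span(3)[OF c])
      show "L2.span (\<phi> ` S) = eigenspace (hankel_op K h t0) (of_real (lp n))"
        using span(2)[OF c] esp[OF lp_pos] unfolding S_def c_def by simp
    qed
    moreover have "eigenvalue (hankel_op K h t0) (of_real (lp n))"
      unfolding eigenvalue_def eigenvector_def esp[OF lp_pos]
    proof (intro exI[of _ "\<phi> (n - 1)"] conjI)
      show "\<phi> (n - 1) \<noteq> 0" using orth[of "n - 1" "n - 1"] by auto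
      show "\<phi> (n - 1) \<in> {u. T u = (1 / lp n) *\<^sub>R u}" by (simp add: eig lp_def)
    qed
    ultimately show ?thesis unfolding card by blast
  qed
  show thesis
  proof (rule that[of lp \<phi>])
    show "0 < lp n \<and> lp n \<le> lp (Suc n)" if "1 \<le> n" for n
      using lp_pos decseqD[OF dec, of "n - 1" n] pos unfolding lp_def by (auto intro: divide_left_mono)
    show "inner (T u) u \<le> (1 / lp (Suc n)) * (norm u)\<^sup>2" if "\<forall>i<n. cinner_L2 u (\<phi> i) = 0" for n u
      unfolding mu by (rule form[OF that])
    show "filterlim lp at_top sequentially" using asy(2) by (simp add: lp_def[abs_def])
    show "\<exists>\<epsilon>. \<epsilon> \<in> O(\<lambda>n. 1 / real n) \<and> (\<forall>n\<ge>1. lp n = \<bar>h K\<bar> * (2 * pi * inverse t0 * real n) ^ K * (1 + \<epsilon> n))"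
    proof (intro exI[of _ "\<lambda>n. lp n / (lead_const * real n ^ K) - 1"] conjI allI impI)
      show "(\<lambda>n. lp n / (lead_const * real n ^ K) - 1) \<in> O(\<lambda>n. 1 / real n)" using asy(1) by (simp add: lp_def)
      fix n :: nat assume n: "1 \<le> n"
      have "\<bar>h K\<bar> * (2 * pi * inverse t0 * real n) ^ K = lead_const * real n ^ K"
        by (simp add: lead_const_def power_mult_distrib mult.assoc)
      moreover have "lead_const * real n ^ K \<noteq> 0" using lead_const_pos n by simp
      ultimately show "lp n = \<bar>h K\<bar> * (2 * pi * inverse t0 * real n) ^ K * (1 + (lp n / (lead_const * real n ^ K) - 1))"
        by simp
    qed
    fix l u assume l: "0 < l" and u: "u \<noteq> 0" "u = cscale (of_real l) (T u)"
    have l0: "l \<noteq> 0" using l by simp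
    have "T u = (1 / l) *\<^sub>R u" using u(2) T_eigen_iff[OF l0] by blast
    then have "u \<in> L2.span (\<phi> ` {n. \<mu> n = 1 / l})" using span(2)[of "1 / l"] l by simp
    moreover have "L2.span (\<phi> ` {}) = {0}" by simp
    ultimately have "{n. \<mu> n = 1 / l} \<noteq> {}" using u(1) by (metis singletonD)
    then obtain j where "\<mu> j = 1 / l" by blast
    then have "lp (Suc j) = l" by (simp add: lp_def)
    then show "\<exists>n\<ge>1. l = lp n" by (intro exI[of _ "Suc j"]) simp
  qed (use orth eig mu mult in auto)
qed

text \<open>Off $(0,t_0)$ the operator is $0$, so there the resolvent equation is $-zu = w$.\<close>

lemma resolvent_setI:
  assumes z: "z \<noteq> 0" and inj: "\<And>u. u = cscale z (T u) \<Longrightarrow> u = 0"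
    and C: "0 \<le> C" "\<And>v. \<exists>x. x - cscale z (T x) = v \<and> norm x \<le> C * norm v"
  shows "z \<in> resolvent_set (hankel_op K h t0)"
proof -
  obtain B where B: "0 < B" "\<And>u. norm (T u) \<le> B * norm u" using cblinear_bound[OF cblinear_T] by blast
  have ex: "\<exists>u. (u, w + cscale z u) \<in> hankel_op K h t0 \<and> norm u \<le> (C * B + 2 / norm z) * norm w" for w
  proof -
    obtain x where x: "x - cscale z (T x) = T w" "norm x \<le> C * norm (T w)" using C(2) by blast
    have x_eq: "x = T w + cscale z (T x)" using x(1) by (simp add: algebra_simps)
    then have Px: "P x = x" by (metis restr_T restr_add restr_cscale)
    define u where "u = x - cscale (1 / z) (w - P w)"
    have e: "w + cscale z u = P w + cscale z x"
      using z unfolding u_def by (simp add: L2.scale_right_diff_distrib)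
    have "P (w + cscale z u) = w + cscale z u" unfolding e by (simp add: restr_add restr_cscale Px)
    moreover have "P u = x" unfolding u_def by (simp add: cblinear_diff[OF cblinear_restr] restr_cscale Px)
    moreover have "T (w + cscale z u) = x"
      unfolding e by (simp add: cblinear_add[OF cblinear_T] cblinear_cscale[OF cblinear_T] flip: x_eq)
    ultimately have "(u, w + cscale z u) \<in> hankel_op K h t0" unfolding hankel_op_iff by simp
    moreover have "norm u \<le> (C * B + 2 / norm z) * norm w"
    proof -
      have "norm x \<le> C * (B * norm w)" using x(2) mult_left_mono[OF B(2)[of w] C(1)] by linarith
      moreover have "norm (w - P w) \<le> 2 * norm w" using norm_triangle_ineq4[of w "P w"] norm_restr_le[of w] by linarith
      then have "norm (cscale (1 / z) (w - P w)) \<le> (1 / norm z) * (2 * norm w)"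
        unfolding norm_cscale norm_divide norm_one by (intro mult_left_mono) auto
      ultimately show ?thesis unfolding u_def
        using norm_triangle_ineq4[of x "cscale (1 / z) (w - P w)"] by (simp add: algebra_simps)
    qed
    ultimately show ?thesis by blast
  qed
  have uniq: "u = u'" if "(u, w + cscale z u) \<in> hankel_op K h t0" "(u', w + cscale z u') \<in> hankel_op K h t0" for u u' w
  proof -
    define d where "d = u - u'"
    have zd: "cscale z d = (w + cscale z u) - (w + cscale z u')" by (simp add: d_def L2.scale_right_diff_distrib)
    have "P (cscale z d) = cscale z d"
      unfolding zd cblinear_diff[OF cblinear_restr] using that unfolding hankel_op_iff by simp
    moreover have "P d = P u - P u'" by (simp add: d_def cblinear_diff[OF cblinear_restr])
    moreover have "P u - P u' = T (cscale z d)"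
      unfolding zd cblinear_diff[OF cblinear_T] using that unfolding hankel_op_iff by simp
    ultimately have "P (cscale z d) = cscale z d" "P d = T (cscale z d)" by simp_all
    then have "d = T (cscale z d)" using z by (simp only: restr_cscale L2.scale_cancel_left) simp
    then have "d = cscale z (T d)" by (simp only: cblinear_cscale[OF cblinear_T])
    then show ?thesis using inj unfolding d_def by fastforce
  qed
  show ?thesis unfolding resolvent_set_def
  proof (intro CollectI conjI allI)
    show "\<exists>!u. (u, w + cscale z u) \<in> hankel_op K h t0" for w using ex[of w] uniq by blast
    show "\<exists>C. \<forall>u w. (u, w + cscale z u) \<in> hankel_op K h t0 \<longrightarrow> norm u \<le> C * norm w"
    proof (intro exI[of _ "C * B + 2 / norm z"] allI impI)
      fix u w assume "(u, w + cscale z u) \<in> hankel_op K h t0"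
      then show "norm u \<le> (C * B + 2 / norm z) * norm w" using ex[of w] uniq by metis
    qed
  qed
qed

lemma eigenvalue_in_spectrum:
  assumes "eigenvalue (hankel_op K h t0) z" shows "z \<in> spectrum (hankel_op K h t0)"
proof -
  obtain u where u: "u \<noteq> 0" "(u, 0 + cscale z u) \<in> hankel_op K h t0"
    using assms unfolding eigenvalue_def eigenvector_def eigenspace_def by auto
  have "(0, 0 + cscale z 0) \<in> hankel_op K h t0"
    unfolding hankel_op_iff by (simp add: cblinear_zero[OF cblinear_restr] cblinear_zero[OF cblinear_T])
  then have "\<not> (\<exists>!u. (u, 0 + cscale z u) \<in> hankel_op K h t0)" using u by blast
  then show ?thesis unfolding spectrum_def resolvent_set_def by blast
qed

lemma T_uminus: "hankel.T t0 K (\<lambda>k. - h k) u = - T u"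
proof -
  interpret n: hankel t0 K "\<lambda>k. - h k" by unfold_locales (use K hK in auto)
  have coef: "n.coef k = - coef k" for k by (simp add: n.coef_def coef_def)
  have D: "n.D y = - D y" for y unfolding n.D_def D_def coef by (simp add: sum_negf)
  have D_minus: "D (- y) = - D y" and V_minus: "(V ^^ K) (- y) = - (V ^^ K) y" for y
    using linear_neg[OF cblinear_linear[OF cblinear_D]] linear_neg[OF cblinear_linear[OF cblinear_funpow[OF cblinear_prim]]] by auto
  have "n.D (- Y w) = w" for w unfolding D D_minus by simp
  then have "n.Y w = - Y w" for w using n.Y_D[of "- Y w"] by simp
  then show ?thesis unfolding n.T_def T_def by (simp add: V_minus)
qed

end

theorem theorem5p2:
  fixes K :: nat and t0 :: real and h :: "nat \<Rightarrow> real"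
  defines "H \<equiv> hankel_op K h t0"
  assumes "K \<ge> 1" and "t0 > 0" and "h K \<noteq> 0"
  shows "op_ker H = L2_subspace {t0<..} \<and>
    (\<exists>lp lm :: nat \<Rightarrow> real.
      spectrum H - {0} = (\<lambda>n. complex_of_real (lp n)) ` {1..} \<union> (\<lambda>n. complex_of_real (lm n)) ` {1..} \<and>
      (\<forall>n\<ge>1. 0 < lp n \<and> lp n \<le> lp (Suc n)) \<and>
      (\<forall>n\<ge>1. 0 > lm n \<and> lm n \<ge> lm (Suc n)) \<and>
      (\<forall>n\<ge>1. eigenvalue H (lp n) \<and> has_multiplicity H (lp n) (card {m. 1 \<le> m \<and> lp m = lp n}) \<and>
        card {m. 1 \<le> m \<and> lp m = lp n} \<le> K) \<and>
      (\<forall>n\<ge>1. eigenvalue H (lm n) \<and> has_multiplicity H (lm n) (card {m. 1 \<le> m \<and> lm m = lm n}) \<and>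
        card {m. 1 \<le> m \<and> lm m = lm n} \<le> K) \<and>
      filterlim lp at_top sequentially \<and> filterlim lm at_bot sequentially \<and>
      (\<exists>\<epsilon>. \<epsilon> \<in> O(\<lambda>n. 1 / real n) \<and>
        (\<forall>n\<ge>1. lp n = \<bar>h K\<bar> * (2 * pi * inverse t0 * real n) ^ K * (1 + \<epsilon> n))) \<and>
      (\<exists>\<epsilon>. \<epsilon> \<in> O(\<lambda>n. 1 / real n) \<and>
        (\<forall>n\<ge>1. lm n = - \<bar>h K\<bar> * (2 * pi * inverse t0 * real n) ^ K * (1 + \<epsilon> n))) \<and>
      (\<forall>n\<ge>1. \<forall>u. eigenvector H (lp n) u \<longrightarrow>
        (\<exists>f. L2_fun {0<..} f \<and> u = abs_L2 f \<and> solves_bvp K h t0 (lp n) f)) \<and>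
      (\<forall>n\<ge>1. \<forall>u. eigenvector H (lm n) u \<longrightarrow>
        (\<exists>f. L2_fun {0<..} f \<and> u = abs_L2 f \<and> solves_bvp K h t0 (lm n) f)))"
proof -
  interpret hankel t0 K h by unfold_locales (use assms in auto)
  interpret n: hankel t0 K "\<lambda>k. - h k" by unfold_locales (use assms in auto)
  obtain lp \<phi> where lp: "\<And>n. 1 \<le> n \<Longrightarrow> 0 < lp n \<and> lp n \<le> lp (Suc n)"
    and orth: "\<And>i j. cinner_L2 (\<phi> i) (\<phi> j) = (if i = j then 1 else 0)"
    and eig: "\<And>n. T (\<phi> n) = (1 / lp (Suc n)) *\<^sub>R \<phi> n"
    and form: "\<And>n u. \<forall>i<n. cinner_L2 u (\<phi> i) = 0 \<Longrightarrow> inner (T u) u \<le> (1 / lp (Suc n)) * (norm u)\<^sup>2"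
    and mult: "\<And>n. 1 \<le> n \<Longrightarrow> eigenvalue (hankel_op K h t0) (of_real (lp n))
      \<and> has_multiplicity (hankel_op K h t0) (of_real (lp n)) (card {m. 1 \<le> m \<and> lp m = lp n})
      \<and> card {m. 1 \<le> m \<and> lp m = lp n} \<le> K"
    and top: "filterlim lp at_top sequentially"
    and asy: "\<exists>\<epsilon>. \<epsilon> \<in> O(\<lambda>n. 1 / real n) \<and> (\<forall>n\<ge>1. lp n = \<bar>h K\<bar> * (2 * pi * inverse t0 * real n) ^ K * (1 + \<epsilon> n))"
    and all: "\<And>l u. 0 < l \<Longrightarrow> u \<noteq> 0 \<Longrightarrow> u = cscale (of_real l) (T u) \<Longrightarrow> \<exists>n\<ge>1. l = lp n"
    by (rule positive_eigenvalues) (rule that, assumption+)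
  obtain lq \<psi> where lq: "\<And>n. 1 \<le> n \<Longrightarrow> 0 < lq n \<and> lq n \<le> lq (Suc n)"
    and orth': "\<And>i j. cinner_L2 (\<psi> i) (\<psi> j) = (if i = j then 1 else 0)"
    and eig': "\<And>n. n.T (\<psi> n) = (1 / lq (Suc n)) *\<^sub>R \<psi> n"
    and form': "\<And>n u. \<forall>i<n. cinner_L2 u (\<psi> i) = 0 \<Longrightarrow> inner (n.T u) u \<le> (1 / lq (Suc n)) * (norm u)\<^sup>2"
    and mult': "\<And>n. 1 \<le> n \<Longrightarrow> eigenvalue (hankel_op K (\<lambda>k. - h k) t0) (of_real (lq n))
      \<and> has_multiplicity (hankel_op K (\<lambda>k. - h k) t0) (of_real (lq n)) (card {m. 1 \<le> m \<and> lq m = lq n})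
      \<and> card {m. 1 \<le> m \<and> lq m = lq n} \<le> K"
    and top': "filterlim lq at_top sequentially"
    and asy': "\<exists>\<epsilon>. \<epsilon> \<in> O(\<lambda>n. 1 / real n) \<and> (\<forall>n\<ge>1. lq n = \<bar>- h K\<bar> * (2 * pi * inverse t0 * real n) ^ K * (1 + \<epsilon> n))"
    and all': "\<And>l u. 0 < l \<Longrightarrow> u \<noteq> 0 \<Longrightarrow> u = cscale (of_real l) (n.T u) \<Longrightarrow> \<exists>n\<ge>1. l = lq n"
    by (rule n.positive_eigenvalues) (rule that, assumption+)
  define lm where "lm n = - lq n" for n
  have swap: "u = cscale (of_real l) (n.T u) \<longleftrightarrow> u = cscale (of_real (- l)) (T u)" for u l
    unfolding T_uminus by simp
  have esp: "eigenspace (hankel_op K (\<lambda>k. - h k) t0) (of_real l) = eigenspace H (of_real (- l))" if "l \<noteq> 0" for l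
  proof -
    have "u \<in> eigenspace (hankel_op K (\<lambda>k. - h k) t0) (of_real l) \<longleftrightarrow> u \<in> eigenspace H (of_real (- l))" for u
      unfolding H_def using that n.eigenspace_iff[of "of_real l" u] eigenspace_iff[of "of_real (- l)" u] swap[of u l] by simp
    then show ?thesis by blast
  qed
  have mult_m: "eigenvalue H (of_real (lm n)) \<and> has_multiplicity H (of_real (lm n)) (card {m. 1 \<le> m \<and> lm m = lm n})
      \<and> card {m. 1 \<le> m \<and> lm m = lm n} \<le> K" if "1 \<le> n" for n
  proof -
    have "lq n \<noteq> 0" using lq[OF that] by simp
    note e = esp[OF this]
    have "{m. 1 \<le> m \<and> lm m = lm n} = {m. 1 \<le> m \<and> lq m = lq n}" by (simp add: lm_def)
    then show ?thesis using mult'[OF that]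
      unfolding eigenvalue_def eigenvector_def has_multiplicity_def e by (simp add: lm_def)
  qed
  have spec: "spectrum H - {0} = (\<lambda>n. complex_of_real (lp n)) ` {1..} \<union> (\<lambda>n. complex_of_real (lm n)) ` {1..}"
  proof (intro equalityI subsetI)
    fix z assume "z \<in> (\<lambda>n. complex_of_real (lp n)) ` {1..} \<union> (\<lambda>n. complex_of_real (lm n)) ` {1..}"
    then obtain n where "1 \<le> n" "z = of_real (lp n) \<or> z = of_real (lm n)" by auto
    then have "eigenvalue H z" "z \<noteq> 0" using mult mult_m lp[of n] lq[of n] by (auto simp: H_def lm_def)
    then show "z \<in> spectrum H - {0}" using eigenvalue_in_spectrum unfolding H_def by simp
  next
    fix z assume z: "z \<in> spectrum H - {0}"
    show "z \<in> (\<lambda>n. complex_of_real (lp n)) ` {1..} \<union> (\<lambda>n. complex_of_real (lm n)) ` {1..}"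
    proof (cases "\<exists>u. u \<noteq> 0 \<and> u = cscale z (T u)")
      case True
      then obtain u where u: "u \<noteq> 0" "u = cscale z (T u)" by blast
      define l where "l = Re z"
      have zl: "z = of_real l" "z \<noteq> 0" using eigenvalue_real[OF u(2,1)] by (simp_all add: l_def)
      have ul: "u = cscale (of_real l) (T u)" using u(2) zl(1) by simp
      show ?thesis
      proof (cases "0 < l")
        case True
        from all[OF this u(1) ul] show ?thesis using zl by auto
      next
        case False
        then have "0 < - l" using zl by (cases "l = 0") auto
        moreover have "u = cscale (of_real (- l)) (n.T u)" using ul swap[of u "- l"] by simp
        ultimately obtain n where "n \<ge> 1" "- l = lq n" using all' u(1) by blast
        then have "z = complex_of_real (lm n)" using zl(1) by (simp add: lm_def flip: \<open>- l = lq n\<close>)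
        then show ?thesis using \<open>n \<ge> 1\<close> by auto
      qed
    next
      case False
      then have inj: "u = 0" if "u = cscale z (T u)" for u using that by blast
      have "\<forall>\<^sub>F n in sequentially. 2 * norm z \<le> lp n \<and> 2 * norm z \<le> lq n"
        using top top' unfolding filterlim_at_top by (intro eventually_conj) blast+
      then obtain N where N0: "\<And>n. n \<ge> N \<Longrightarrow> 2 * norm z \<le> lp n \<and> 2 * norm z \<le> lq n"
        unfolding eventually_sequentially by blast
      have N: "2 * norm z \<le> lp (Suc N)" "2 * norm z \<le> lq (Suc N)" using N0[of "Suc N"] by auto
      \<comment> \<open>The first \<open>N\<close> eigenvectors of either sign; on their orthogonal complement the form of \<open>T\<close> is
        at most $1/(2|z|)$ in absolute value.\<close>
      define S where "S = {..<N} <+> {..<N}"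
      define \<xi> where "\<xi> = case_sum \<phi> \<psi>"
      define \<nu> where "\<nu> = case_sum (\<lambda>n. 1 / lp (Suc n)) (\<lambda>n. - (1 / lq (Suc n)))"
      have T\<psi>: "T (\<psi> n) = (- (1 / lq (Suc n))) *\<^sub>R \<psi> n" for n
        using eig'[of n] unfolding T_uminus by (metis minus_minus scaleR_minus_left)
      have cross: "cinner_L2 (\<phi> i) (\<psi> j) = 0" for i j
      proof -
        have "of_real (1 / lp (Suc i)) * cinner_L2 (\<phi> i) (\<psi> j) = of_real (- (1 / lq (Suc j))) * cinner_L2 (\<phi> i) (\<psi> j)"
          using T_sym[of "\<phi> i" "\<psi> j"] by (simp only: eig T\<psi> cinner_scaleR_left cinner_scaleR_right)
        moreover have "1 / lp (Suc i) > 0" "1 / lq (Suc j) > 0" using lp[of "Suc i"] lq[of "Suc j"] by auto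
        then have "1 / lp (Suc i) \<noteq> - (1 / lq (Suc j))" by linarith
        ultimately show ?thesis by (simp only: mult_cancel_right of_real_eq_iff) blast
      qed
      have cross': "cinner_L2 (\<psi> j) (\<phi> i) = 0" for i j using cross[of i j] cinner_cnj[of "\<phi> i" "\<psi> j"] by simp
      have small: "norm z * norm (T u) \<le> norm u / 2" if u: "\<And>i. i \<in> S \<Longrightarrow> cinner_L2 u (\<xi> i) = 0" for u
      proof -
        define M where "M = {u. \<forall>i\<in>S. cinner_L2 u (\<xi> i) = 0}"
        define c where "c = max (1 / lp (Suc N)) (1 / lq (Suc N))"
        have "norm (T u) \<le> c * norm u"
        proof (rule norm_le_of_form_bound[OF cblinear_linear[OF cblinear_T], of M])
          show "inner (T u) v = inner u (T v)" for u v by (simp add: inner_L2_def T_sym)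
          show "subspace M" unfolding M_def subspace_def by (simp add: cinner_add_left)
          show "u \<in> M" using u by (simp add: M_def)
          show "T v \<in> M" if "v \<in> M" for v
            unfolding M_def
          proof (intro CollectI ballI)
            fix i assume "i \<in> S"
            then have "cinner_L2 v (\<xi> i) = 0" using that by (simp add: M_def)
            moreover have "T (\<xi> i) = \<nu> i *\<^sub>R \<xi> i" by (cases i) (simp_all only: \<xi>_def \<nu>_def sum.case eig T\<psi>)
            ultimately show "cinner_L2 (T v) (\<xi> i) = 0" by (simp add: T_sym)
          qed
          fix v assume "v \<in> M"
          then have v: "cinner_L2 v (\<phi> i) = 0" "cinner_L2 v (\<psi> i) = 0" if "i < N" for i
            using that unfolding M_def S_def \<xi>_def by (auto dest: bspec[of _ _ "Inl i"] bspec[of _ _ "Inr i"])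
          have "inner (T v) v \<le> (1 / lp (Suc N)) * (norm v)\<^sup>2" "- inner (T v) v \<le> (1 / lq (Suc N)) * (norm v)\<^sup>2"
            using form[of N v] form'[of N v] v unfolding T_uminus by simp_all
          moreover have "(1 / lp (Suc N)) * (norm v)\<^sup>2 \<le> c * (norm v)\<^sup>2" "(1 / lq (Suc N)) * (norm v)\<^sup>2 \<le> c * (norm v)\<^sup>2"
            unfolding c_def by (intro mult_right_mono; simp)+
          ultimately show "\<bar>inner (T v) v\<bar> \<le> c * (norm v)\<^sup>2" by linarith
        qed
        then have "norm z * norm (T u) \<le> (norm z * c) * norm u" by (simp add: mult_left_mono mult.assoc)
        also have "\<dots> \<le> (1 / 2) * norm u"
        proof (rule mult_right_mono)
          have "norm z * (1 / lp (Suc N)) \<le> 1 / 2" "norm z * (1 / lq (Suc N)) \<le> 1 / 2"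
            using N lp[of "Suc N"] lq[of "Suc N"] by (simp_all add: field_simps)
          then show "norm z * c \<le> 1 / 2" unfolding c_def by (simp add: max_def)
        qed simp
        finally show ?thesis by simp
      qed
      obtain C where C: "0 \<le> C" "\<And>v. \<exists>x. x - cscale z (T x) = v \<and> norm x \<le> C * norm v"
      proof (rule fredholm_alternative[OF cblinear_T compact_operator_T T_sym, of S \<xi> \<nu> z])
        show "finite S" by (simp add: S_def)
        show "cinner_L2 (\<xi> i) (\<xi> j) = (if i = j then 1 else 0)" for i j
          by (cases i; cases j) (simp_all add: \<xi>_def orth orth' cross cross')
        show "T (\<xi> i) = \<nu> i *\<^sub>R \<xi> i" for i by (cases i) (simp_all only: \<xi>_def \<nu>_def sum.case eig T\<psi>)
      qed (rule small inj that; assumption)+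
      have "z \<in> resolvent_set H" unfolding H_def
        by (rule resolvent_setI[OF _ inj C]) (use z in auto)
      then show ?thesis using z by (simp add: spectrum_def)
    qed
  qed
  have bvp: "\<exists>f. L2_fun {0<..} f \<and> u = abs_L2 f \<and> solves_bvp K h t0 l f"
    if "eigenvector H (of_real l) u" "l \<noteq> 0" for l u
  proof -
    have "u = cscale (of_real l) (T u)"
      using that eigenspace_iff[of "of_real l" u] unfolding eigenvector_def H_def by simp
    then show ?thesis by (rule eigenvector_solves_bvp) blast
  qed
  have asy_m: "\<exists>\<epsilon>. \<epsilon> \<in> O(\<lambda>n. 1 / real n) \<and> (\<forall>n\<ge>1. lm n = - \<bar>h K\<bar> * (2 * pi * inverse t0 * real n) ^ K * (1 + \<epsilon> n))"
    using asy' by (auto simp: lm_def)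
  have bot: "filterlim lm at_bot sequentially"
    unfolding lm_def[abs_def] using top' by (simp add: filterlim_uminus_at_top)
  have kernel: "op_ker H = L2_subspace {t0<..}" unfolding H_def by (rule kernel_eq)
  have mono: "\<forall>n\<ge>1. 0 < lp n \<and> lp n \<le> lp (Suc n)" "\<forall>n\<ge>1. 0 > lm n \<and> lm n \<ge> lm (Suc n)"
    using lp lq by (simp_all add: lm_def)
  have mults: "\<forall>n\<ge>1. eigenvalue H (lp n) \<and> has_multiplicity H (lp n) (card {m. 1 \<le> m \<and> lp m = lp n}) \<and>
        card {m. 1 \<le> m \<and> lp m = lp n} \<le> K"
      "\<forall>n\<ge>1. eigenvalue H (lm n) \<and> has_multiplicity H (lm n) (card {m. 1 \<le> m \<and> lm m = lm n}) \<and>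
        card {m. 1 \<le> m \<and> lm m = lm n} \<le> K"
    unfolding H_def using mult mult_m[unfolded H_def] by blast+
  have bvps: "\<forall>n\<ge>1. \<forall>u. eigenvector H (lp n) u \<longrightarrow>
        (\<exists>f. L2_fun {0<..} f \<and> u = abs_L2 f \<and> solves_bvp K h t0 (lp n) f)"
      "\<forall>n\<ge>1. \<forall>u. eigenvector H (lm n) u \<longrightarrow>
        (\<exists>f. L2_fun {0<..} f \<and> u = abs_L2 f \<and> solves_bvp K h t0 (lm n) f)"
  proof -
    have nz: "lp n \<noteq> 0" "lm n \<noteq> 0" if "1 \<le> n" for n using lp[OF that] lq[OF that] by (auto simp: lm_def)
    show "\<forall>n\<ge>1. \<forall>u. eigenvector H (lp n) u \<longrightarrow>
        (\<exists>f. L2_fun {0<..} f \<and> u = abs_L2 f \<and> solves_bvp K h t0 (lp n) f)"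
      using bvp nz(1) by blast
    show "\<forall>n\<ge>1. \<forall>u. eigenvector H (lm n) u \<longrightarrow>
        (\<exists>f. L2_fun {0<..} f \<and> u = abs_L2 f \<and> solves_bvp K h t0 (lm n) f)"
      using bvp nz(2) by blast
  qed
  show ?thesis
    by (rule conjI[OF kernel], rule exI[of _ lp], rule exI[of _ lm], intro conjI)
       (rule spec mono mults top bot asy asy_m bvps)+
qed

end
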